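(* There exists a universal constant $K>0$ such that for every $n\in\mathbb{N}$ and every projection $T\in \mathbb{M}_{2^{n}}$, $$\mathrm{var}(T)\sqrt{\log\left(1+\frac{1}{\sum_{j=1}^{n}\|\mathbf{d}_{j}(T)\|^{2}_{L_{1}}}\right)}\;\le\; K\left\|\left(\sum_{j=1}^{n}|\mathbf{d}_{j}(T)|^{2}\right)^{1/2}\right\|_{L_{1}},$$ where the left-hand side is read as $0$ if $\mathbf{d}_j(T)=0$ for all $j$ (in which case $\mathrm{var}(T)=0$).
   Context: $n\ge 1$ is an integer, $[n]=\{1,\dots,n\}$. $\mathbb{M}_{2^n}=M_2(\mathbb{C})^{\otimes n}$ is the algebra of complex $2^n\times 2^n$ matrices with unit $\mathbf{1}$, equipped with the normalized trace $\mathrm{tr}$ (so $\mathrm{tr}(\mathbf{1})=1$). A projection is $T$ with $T^*=T=T^2$. $|T|=(T^*T)^{1/2}$, and for $1\le p<\infty$, $\|T\|_{L_p}=(\mathrm{tr}(|T|^p))^{1/p}$. The variance is $\mathrm{var}(T)=\mathrm{tr}(|T|^2)-|\mathrm{tr}(T)|^2$. The $j$-th partial derivative is the linear map $\mathbf{d}_j=\mathrm{id}^{\otimes(j-1)}\otimes D\otimes \mathrm{id}^{\otimes(n-j)}$ on $\mathbb{M}_{2^n}$, where $D:M_2(\mathbb{C})\to M_2(\mathbb{C})$ is $D(A)=A-\mathrm{tr}(A)\mathbf{1}_2$ ($\mathrm{tr}$ being the normalized trace on $M_2(\mathbb{C})$). Here $|\mathbf{d}_j(T)|^2=\mathbf{d}_j(T)^*\mathbf{d}_j(T)$.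 *)

theory Defs
  imports Complex_Main "Jordan_Normal_Form.Schur_Decomposition"
begin

definition ntr :: "complex mat \<Rightarrow> complex" where
  "ntr A = (\<Sum>i<dim_row A. A $$ (i, i)) / of_nat (dim_row A)"

definition hermitian_mat :: "complex mat \<Rightarrow> bool" where
  "hermitian_mat A \<longleftrightarrow> square_mat A \<and> mat_adjoint A = A"

definition positive_mat :: "complex mat \<Rightarrow> bool" where
  "positive_mat A \<longleftrightarrow> hermitian_mat A \<and>
     (\<forall>v \<in> carrier_vec (dim_row A). 0 \<le> Re ((A *\<^sub>v v) \<bullet>c v))"

definition projection_mat :: "complex mat \<Rightarrow> bool" where
  "projection_mat A \<longleftrightarrow> hermitian_mat A \<and> A * A = A"

(* Only meaningful for positive A, which has exactly one positive square root. *)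
definition mat_sqrt :: "complex mat \<Rightarrow> complex mat" where
  "mat_sqrt A = (THE B. B \<in> carrier_mat (dim_row A) (dim_row A) \<and> positive_mat B \<and> B * B = A)"

(* |A|^2 = A^* A *)
definition abs_sq_mat :: "complex mat \<Rightarrow> complex mat" where
  "abs_sq_mat A = mat_adjoint A * A"

definition abs_mat :: "complex mat \<Rightarrow> complex mat" where
  "abs_mat A = mat_sqrt (abs_sq_mat A)"

(* The trace of the positive matrix |A| is real, so Re only adjusts the type here;
   likewise in the next definition. *)
definition L1_norm :: "complex mat \<Rightarrow> real" where
  "L1_norm A = Re (ntr (abs_mat A))"

definition mat_var :: "complex mat \<Rightarrow> real" where
  "mat_var A = Re (ntr (abs_sq_mat A)) - (cmod (ntr A))\<^sup>2"

definition sum_square_mats :: "nat \<Rightarrow> ('i \<Rightarrow> complex mat) \<Rightarrow> 'i set \<Rightarrow> complex mat" where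
  "sum_square_mats N f J = mat N N (\<lambda>(r, c). \<Sum>j\<in>J. f j $$ (r, c))"

definition unit_matrix :: "nat \<Rightarrow> nat \<Rightarrow> nat \<Rightarrow> complex mat" where
  "unit_matrix N i j = mat N N (\<lambda>(r, c). if r = i \<and> c = j then 1 else 0)"

definition kron :: "complex mat \<Rightarrow> complex mat \<Rightarrow> complex mat" where
  "kron A B = mat (dim_row A * dim_row B) (dim_col A * dim_col B)
     (\<lambda>(r, c). A $$ (r div dim_row B, c div dim_col B) * B $$ (r mod dim_row B, c mod dim_col B))"

(* The tensor product F \<otimes> G of linear maps F on M_a and G on M_b, acting on
   M_(ab) = M_a \<otimes> M_b.  The entry of A at (ib + k, jb + l) is its coefficient with
   respect to the basis element E_ij \<otimes> E_kl, so that
     (F \<otimes> G)(A) = sum over i, j, k, l of A_(ib+k, jb+l) * (F(E_ij) \<otimes> G(E_kl)). *)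
definition tensor_map ::
  "nat \<Rightarrow> nat \<Rightarrow> (complex mat \<Rightarrow> complex mat) \<Rightarrow> (complex mat \<Rightarrow> complex mat)
     \<Rightarrow> complex mat \<Rightarrow> complex mat" where
  "tensor_map a b F G A = sum_square_mats (a * b)
     (\<lambda>(i, j, k, l). A $$ (i * b + k, j * b + l) \<cdot>\<^sub>m
        kron (F (unit_matrix a i j)) (G (unit_matrix b k l)))
     ({..<a} \<times> {..<a} \<times> {..<b} \<times> {..<b})"

definition D_map :: "complex mat \<Rightarrow> complex mat" where
  "D_map A = A - ntr A \<cdot>\<^sub>m 1\<^sub>m 2"

(* (id^(j-1) \<otimes> D) \<otimes> id^(n-j) on M_(2^n), for 1 \<le> j \<le> n *)
definition partial_deriv :: "nat \<Rightarrow> nat \<Rightarrow> complex mat \<Rightarrow> complex mat" where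
  "partial_deriv n j =
     tensor_map (2 ^ j) (2 ^ (n - j)) (tensor_map (2 ^ (j - 1)) 2 id D_map) id"

end

theory Submission
  imports Defs "HOL-Analysis.Inner_Product" "HOL-Analysis.L2_Norm"
begin

text \<open>
  The argument is the semigroup proof of the Eldan--Gross inequality for Boolean functions, carried
  over to matrices.  Let \<open>E\<^sub>b\<close> be the normalized partial trace over qubit \<open>b\<close>, tensored back with the
  unit, let \<open>d\<^sub>b = id - E\<^sub>b\<close>, and let \<open>P\<^sub>r\<close> be the depolarizing noise, that is the product over all
  qubits of \<open>r id + (1 - r) E\<^sub>b\<close>.  It multiplies the Pauli coefficients of level \<open>i\<close> (those which act
  on exactly \<open>i\<close> qubits) by \<open>r\<^sup>i\<close>.  For a projection \<open>T\<close> let \<open>W\<^sub>i \<ge> 0\<close> be the squared \<open>L\<^sub>2\<close> norm of the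
  level \<open>i\<close> part, and let \<open>V(r)\<close> be the sum of \<open>r\<^sup>i W\<^sub>i\<close> over \<open>i \<ge> 1\<close>, so that \<open>V(1) = var(T)\<close>.  Write
  \<open>M\<close> for the right-hand side without its constant and \<open>\<epsilon>\<close> for the sum of the squared \<open>L\<^sub>1\<close>
  influences.

  High levels cost gradient.  The noise satisfies a local reverse Poincare inequality
  (\<open>reverse_poincare\<close>): the sum of \<open>|d\<^sub>b P\<^sub>r T|\<^sup>2\<close> is at most \<open>r / (1 - r)\<close> in operator norm.  Pairing
  \<open>(d\<^sub>b P\<^sub>r T)\<^sub>b\<close> with \<open>(d\<^sub>b T)\<^sub>b\<close> by the duality of column \<open>L\<^sub>\<infinity>\<close> and column \<open>L\<^sub>1\<close> (\<open>duality\<close>) gives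
  \<open>r V'(r) \<le> sqrt (r / (1 - r)) M\<close>, and integration yields \<open>var(T) - V(r) \<le> C sqrt (1 - r) M\<close> for
  \<open>r \<ge> 1/2\<close> (\<open>variance_increment\<close>).

  Low levels are small.  The noise with parameter \<open>1/3\<close> maps \<open>L\<^sub>2\<close> to \<open>L\<^sub>4\<close> contractively
  (\<open>hypercontractive\<close>).  The noise \<open>P\<close> with parameter \<open>1/9\<close> is its square, and therefore
  \<open>\<langle>g, P g\<rangle> \<le> \<parallel>g\<parallel>\<^sub>1 \<parallel>g\<parallel>\<^sub>2\<close> for Hermitian \<open>g\<close> (\<open>inner_noise_le_trace_norm\<close>).  Applied to the martingale differences
  \<open>\<Delta>\<^sub>k = E\<^sub>0 ... E\<^sub>k\<^sub>-\<^sub>1 d\<^sub>k T\<close>, whose squared \<open>L\<^sub>2\<close> norms add up to \<open>var(T)\<close> and whose \<open>L\<^sub>1\<close> norms are at most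
  those of \<open>d\<^sub>k T\<close>, it gives \<open>V(1/9) \<le> sqrt (\<epsilon> var(T))\<close>; applied to \<open>T - tr(T)\<close> it gives
  \<open>V(1/9) \<le> 2 var(T)\<^sup>3\<^sup>/\<^sup>2\<close>.  The geometric mean of the two bounds is a multiple of \<open>\<epsilon>\<^sup>1\<^sup>/\<^sup>4 var(T)\<close>, in which the
  variance appears with the exponent one.

  The two parts meet as follows (\<open>weighted_bound\<close>).  If \<open>V(r)\<close> exceeded \<open>var(T) / 2\<close> for \<open>r\<^sup>m = 1/9\<close>,
  then the power mean inequality would give \<open>V(1/9) \<ge> 2\<^sup>-\<^sup>m var(T)\<close>, which is false when \<open>m\<close> is a small
  multiple of \<open>log (1/\<epsilon>)\<close>.  So \<open>var(T) / 2 \<le> var(T) - V(r)\<close>, and this is at most a multiple of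
  \<open>sqrt (1 - r) M\<close> where \<open>1 - r\<close> is of order \<open>1 / log (1/\<epsilon>)\<close>.

  Matrices of all sizes are treated as elements of the single ring of finitely supported
  infinite matrices, so that the algebra takes place in a type with ring, vector space and
  inner product structure.
\<close>

section \<open>The ring of finitely supported matrices\<close>

typedef fmat = "{f :: nat \<Rightarrow> nat \<Rightarrow> complex. \<exists>N. \<forall>i j. f i j \<noteq> 0 \<longrightarrow> i < N \<and> j < N}"
  morphisms ent Fmat
  by (rule exI[of _ "\<lambda>i j. 0"]) auto

text \<open>
  The matrices of size \<open>N\<close> form a corner of the big ring.  A general element is handled by putting
  it, together with finitely many others, into a common corner.
\<close>

definition corner :: "nat \<Rightarrow> fmat set" where
  "corner N = {x. \<forall>i j. ent x i j \<noteq> 0 \<longrightarrow> i < N \<and> j < N}"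

lemma ex_corner: "\<exists>N. x \<in> corner N"
  using ent[of x] by (auto simp: corner_def)

lemma corner_mono: "x \<in> corner N \<Longrightarrow> N \<le> M \<Longrightarrow> x \<in> corner M"
  by (auto simp: corner_def) (meson less_le_trans)+

lemma ex_corner2: "\<exists>N. x \<in> corner N \<and> y \<in> corner N"
  by (meson corner_mono ex_corner linear)

lemma ex_corner3: "\<exists>N. x \<in> corner N \<and> y \<in> corner N \<and> z \<in> corner N"
  by (meson corner_mono ex_corner ex_corner2 linear)

lemma ent_Fmat: "(\<And>i j. i \<ge> N \<or> j \<ge> N \<Longrightarrow> f i j = 0) \<Longrightarrow> ent (Fmat f) = f"
  by (rule Fmat_inverse) (auto, meson not_le)

lemma fmat_eqI: "(\<And>i j. ent x i j = ent y i j) \<Longrightarrow> x = y"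
  by (metis ent_inject ext)

lemma cornerI: "(\<And>i j. i \<ge> N \<or> j \<ge> N \<Longrightarrow> ent x i j = 0) \<Longrightarrow> x \<in> corner N"
  by (auto simp: corner_def) (meson not_le)+

lemma cornerD: "x \<in> corner N \<Longrightarrow> i \<ge> N \<or> j \<ge> N \<Longrightarrow> ent x i j = 0"
  by (fastforce simp: corner_def)

text \<open>
  A fixed choice of corner, through which products and inner products become finite sums; by
  \<open>ent_mult_left\<close>, \<open>ent_mult_right\<close> and \<open>inner_left\<close> any other corner gives the same value.
\<close>

definition support_bound :: "fmat \<Rightarrow> nat" where "support_bound x = (SOME N. x \<in> corner N)"

lemma support_bound: "x \<in> corner (support_bound x)"
  unfolding support_bound_def by (rule someI_ex) (rule ex_corner)

definition star :: "fmat \<Rightarrow> fmat" where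
  "star x = Fmat (\<lambda>i j. cnj (ent x j i))"

lemma ent_star [simp]: "ent (star x) i j = cnj (ent x j i)"
  unfolding star_def
  by (subst ent_Fmat[where N = "support_bound x"]) (auto simp: cornerD[OF support_bound])

lemma star_corner: "x \<in> corner N \<Longrightarrow> star x \<in> corner N"
  by (auto simp: corner_def)

instantiation fmat :: ab_group_add
begin
definition "0 = Fmat (\<lambda>i j. 0)"
definition "x + y = Fmat (\<lambda>i j. ent x i j + ent y i j)"
definition "x - y = Fmat (\<lambda>i j. ent x i j - ent y i j)"
definition "- x = Fmat (\<lambda>i j. - ent x i j)"

lemma ent_0 [simp]: "ent 0 i j = 0"
  unfolding zero_fmat_def by (subst ent_Fmat[where N = 0]) auto

lemma ent_add [simp]: "ent (x + y) i j = ent x i j + ent y i j"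
proof -
  obtain N where "x \<in> corner N" "y \<in> corner N" using ex_corner2 by blast
  then show ?thesis
    unfolding plus_fmat_def by (subst ent_Fmat[where N = N]) (auto simp: cornerD)
qed

lemma ent_diff [simp]: "ent (x - y) i j = ent x i j - ent y i j"
proof -
  obtain N where "x \<in> corner N" "y \<in> corner N" using ex_corner2 by blast
  then show ?thesis
    unfolding minus_fmat_def by (subst ent_Fmat[where N = N]) (auto simp: cornerD)
qed

lemma ent_uminus [simp]: "ent (- x) i j = - ent x i j"
  unfolding uminus_fmat_def
  by (subst ent_Fmat[where N = "support_bound x"]) (auto simp: cornerD[OF support_bound])

instance by standard (auto intro!: fmat_eqI)
end

lemma ent_sum [simp]: "ent (sum f S) i j = (\<Sum>a\<in>S. ent (f a) i j)"
  by (induction S rule: infinite_finite_induct) auto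

instantiation fmat :: ring
begin
definition "x * y = Fmat (\<lambda>i j. \<Sum>k<support_bound x. ent x i k * ent y k j)"

lemma ent_mult_raw: "ent (x * y) i j = (\<Sum>k<support_bound x. ent x i k * ent y k j)"
proof -
  obtain N where "x \<in> corner N" "y \<in> corner N" using ex_corner2 by blast
  then show ?thesis
    unfolding times_fmat_def 
    by (subst ent_Fmat[where N = N]) 
       (auto simp: cornerD intro!: sum.neutral)
qed

lemma ent_mult_left: "x \<in> corner N \<Longrightarrow> ent (x * y) i j = (\<Sum>k<N. ent x i k * ent y k j)"
  unfolding ent_mult_raw
  by (rule sum.mono_neutral_cong) (use cornerD[OF support_bound, of x] in \<open>auto simp: cornerD\<close>)

lemma ent_mult_right: "y \<in> corner N \<Longrightarrow> ent (x * y) i j = (\<Sum>k<N. ent x i k * ent y k j)"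
  unfolding ent_mult_raw
  by (rule sum.mono_neutral_cong) (use cornerD[OF support_bound, of x] in \<open>auto simp: cornerD\<close>)

instance
proof
  fix x y z :: fmat
  obtain N where N: "x \<in> corner N" "y \<in> corner N" "z \<in> corner N" using ex_corner3 by blast
  show "x * y * z = x * (y * z)"
    by (rule fmat_eqI) (simp add: ent_mult_left[OF N(1)] ent_mult_left[OF N(2)]
        ent_mult_right[OF N(3)] sum_distrib_left sum_distrib_right mult.assoc, rule sum.swap)
  show "(x + y) * z = x * z + y * z"
    by (rule fmat_eqI) (simp add: ent_mult_right[OF N(3)] algebra_simps sum.distrib)
  show "x * (y + z) = x * y + x * z"
    by (rule fmat_eqI) (simp add: ent_mult_left[OF N(1)] algebra_simps sum.distrib)
qed
end

instantiation fmat :: real_algebra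
begin
definition "c *\<^sub>R x = Fmat (\<lambda>i j. c *\<^sub>R ent x i j)"

lemma ent_scaleR [simp]: "ent (c *\<^sub>R x) i j = c *\<^sub>R ent x i j"
  unfolding scaleR_fmat_def
  by (subst ent_Fmat[where N = "support_bound x"]) (auto simp: cornerD[OF support_bound])

instance
proof
  fix a b :: real and x y :: fmat
  obtain N where N: "x \<in> corner N" "y \<in> corner N" using ex_corner2 by blast
  show "a *\<^sub>R (x + y) = a *\<^sub>R x + a *\<^sub>R y" by (rule fmat_eqI) (simp add: algebra_simps)
  show "(a + b) *\<^sub>R x = a *\<^sub>R x + b *\<^sub>R x" by (rule fmat_eqI) (simp add: algebra_simps)
  show "a *\<^sub>R b *\<^sub>R x = (a * b) *\<^sub>R x" by (rule fmat_eqI) simp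
  show "1 *\<^sub>R x = x" by (rule fmat_eqI) simp
  show "a *\<^sub>R x * y = a *\<^sub>R (x * y)"
    by (rule fmat_eqI) (simp add: ent_mult_right[OF N(2)] scaleR_sum_right)
  show "x * a *\<^sub>R y = a *\<^sub>R (x * y)"
    by (rule fmat_eqI) (simp add: ent_mult_left[OF N(1)] scaleR_sum_right)
qed
end

text \<open>
  The inner product is the real part of the unnormalized \<open>Tr (x\<^sup>* y)\<close>.  Real scalars suffice, since
  only Hermitian matrices and real coefficients are combined, and they make the library of real
  inner product spaces applicable.
\<close>

instantiation fmat :: real_inner
begin
definition "inner x y = Re (\<Sum>i<support_bound x. \<Sum>j<support_bound x. cnj (ent x i j) * ent y i j)"
definition "norm (x::fmat) = sqrt (inner x x)"
definition "sgn (x::fmat) = x /\<^sub>R norm x"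
definition "dist (x::fmat) y = norm (x - y)"
definition "(uniformity :: (fmat \<times> fmat) filter) = (INF e\<in>{0<..}. principal {(x, y). dist x y < e})"
definition "open (U :: fmat set) \<longleftrightarrow>
    (\<forall>x\<in>U. eventually (\<lambda>(x', y). x' = x \<longrightarrow> y \<in> U) uniformity)"

lemma inner_left: "x \<in> corner N \<Longrightarrow> inner x y = Re (\<Sum>i<N. \<Sum>j<N. cnj (ent x i j) * ent y i j)"
  unfolding inner_fmat_def sum.cartesian_product
  by (rule arg_cong[where f = Re], rule sum.mono_neutral_cong)
     (use support_bound[of x] in \<open>auto simp: corner_def\<close>)

lemma inner_fmat_commute: "inner x y = inner y (x::fmat)"
proof -
  obtain N where N: "x \<in> corner N" "y \<in> corner N" using ex_corner2 by blast
  show ?thesis by (simp add: inner_left[OF N(1)] inner_left[OF N(2)] mult.commute)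
qed

instance
proof
  fix x y z :: fmat and c :: real
  obtain N where N: "x \<in> corner N" "y \<in> corner N" "z \<in> corner N" using ex_corner3 by blast
  show "inner x y = inner y x" by (rule inner_fmat_commute)
  show "inner (x + y) z = inner x z + inner y z"
    unfolding inner_fmat_commute[of _ z]
    by (simp add: inner_left[OF N(3)] algebra_simps sum.distrib)
  show "inner (c *\<^sub>R x) y = c * inner x y"
    unfolding inner_fmat_commute[of _ y]
    by (simp add: inner_left[OF N(2)] algebra_simps sum_distrib_left)
  have eq: "inner x x = (\<Sum>i<N. \<Sum>j<N. (cmod (ent x i j))\<^sup>2)"
    unfolding inner_left[OF N(1)] Re_sum
    by (intro sum.cong refl) (simp add: cmod_power2, simp add: power2_eq_square)
  show "0 \<le> inner x x" unfolding eq by (intro sum_nonneg) auto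
  show "(inner x x = 0) = (x = 0)"
  proof
    assume "inner x x = 0"
    then have "\<forall>i<N. \<forall>j<N. ent x i j = 0"
      unfolding eq by (simp add: sum_nonneg_eq_0_iff sum_nonneg)
    then show "x = 0" by (intro fmat_eqI) (metis N(1) cornerD ent_0 not_le)
  qed (simp add: inner_fmat_def)
  show "norm x = sqrt (inner x x)" by (rule norm_fmat_def)
  show "sgn x = x /\<^sub>R norm x" by (rule sgn_fmat_def)
  show "dist x y = norm (x - y)" by (rule dist_fmat_def)
  show "(uniformity :: (fmat \<times> fmat) filter) = (INF e\<in>{0<..}. principal {(x, y). dist x y < e})"
    by (rule uniformity_fmat_def)
  show "\<And>U :: fmat set. open U = (\<forall>x\<in>U. eventually (\<lambda>(x', y). x' = x \<longrightarrow> y \<in> U) uniformity)"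
    by (rule open_fmat_def)
qed
end

lemma star_star [simp]: "star (star x) = x" by (rule fmat_eqI) simp
lemma star_0 [simp]: "star 0 = 0" by (rule fmat_eqI) simp
lemma star_add [simp]: "star (x + y) = star x + star y" by (rule fmat_eqI) simp
lemma star_diff [simp]: "star (x - y) = star x - star y" by (rule fmat_eqI) simp
lemma star_uminus [simp]: "star (- x) = - star x" by (rule fmat_eqI) simp
lemma star_scaleR [simp]: "star (c *\<^sub>R x) = c *\<^sub>R star x" by (rule fmat_eqI) simp
lemma star_sum [simp]: "star (sum f S) = (\<Sum>a\<in>S. star (f a))" by (rule fmat_eqI) simp
lemma star_mult [simp]: "star (x * y) = star y * star x"
proof -
  obtain N where N: "x \<in> corner N" "y \<in> corner N" using ex_corner2 by blast
  show ?thesis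
    by (rule fmat_eqI)
       (simp add: ent_mult_left[OF N(1)] ent_mult_right[OF star_corner[OF N(1)]] mult.commute)
qed

lemma inner_star_star [simp]: "inner (star x) (star y) = inner x y"
proof -
  obtain N where N: "x \<in> corner N" using ex_corner by blast
  have "(\<Sum>i<N. \<Sum>j<N. ent x j i * cnj (ent y j i))
      = (\<Sum>j<N. \<Sum>i<N. ent x j i * cnj (ent y j i))" by (rule sum.swap)
  also have "\<dots> = cnj (\<Sum>j<N. \<Sum>i<N. cnj (ent x j i) * ent y j i)" by simp
  finally have "Re (\<Sum>i<N. \<Sum>j<N. ent x j i * cnj (ent y j i))
      = Re (cnj (\<Sum>j<N. \<Sum>i<N. cnj (ent x j i) * ent y j i))" by (rule arg_cong)
  also have "\<dots> = inner x y" by (simp only: inner_left[OF N] cnj.sel)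
  finally show ?thesis by (simp only: inner_left[OF star_corner[OF N]] ent_star complex_cnj_cnj)
qed

lemma norm_star [simp]: "norm (star x) = norm x"
  by (simp add: norm_eq_sqrt_inner)

text \<open>
  Left and right multiplication have the expected adjoints.  These two rules contain the cyclicity
  of the trace and replace it in everything below.
\<close>

lemma inner_mult_adjoint_left: "inner x (y * z) = inner (star y * x) z"
proof -
  obtain N where N: "x \<in> corner N" "y \<in> corner N" "z \<in> corner N" using ex_corner3 by blast
  have "(\<Sum>i<N. \<Sum>j<N. cnj (ent z i j) * (\<Sum>k<N. cnj (ent y k i) * ent x k j))
      = (\<Sum>i<N. \<Sum>j<N. \<Sum>k<N. cnj (ent z i j) * (cnj (ent y k i) * ent x k j))"
    by (simp only: sum_distrib_left)
  also have "\<dots> = (\<Sum>i<N. \<Sum>k<N. \<Sum>j<N. cnj (ent z i j) * (cnj (ent y k i) * ent x k j))"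
    by (rule sum.cong[OF refl], rule sum.swap)
  also have "\<dots> = (\<Sum>k<N. \<Sum>i<N. \<Sum>j<N. cnj (ent z i j) * (cnj (ent y k i) * ent x k j))"
    by (rule sum.swap)
  also have "\<dots> = (\<Sum>k<N. \<Sum>j<N. \<Sum>i<N. cnj (ent z i j) * (cnj (ent y k i) * ent x k j))"
    by (rule sum.cong[OF refl], rule sum.swap)
  also have "\<dots> = (\<Sum>k<N. \<Sum>j<N. ent x k j * (\<Sum>i<N. cnj (ent y k i) * cnj (ent z i j)))"
    by (simp only: sum_distrib_left mult_ac)
  also have "\<dots> = cnj (\<Sum>k<N. \<Sum>j<N. cnj (ent x k j) * (\<Sum>i<N. ent y k i * ent z i j))"
    by simp
  finally have "Re (\<Sum>i<N. \<Sum>j<N. cnj (ent z i j) * (\<Sum>k<N. cnj (ent y k i) * ent x k j))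
     = Re (cnj (\<Sum>k<N. \<Sum>j<N. cnj (ent x k j) * (\<Sum>i<N. ent y k i * ent z i j)))"
    by (rule arg_cong)
  then have "inner z (star y * x) = inner x (y * z)"
    by (simp only: inner_left[OF N(3)] inner_left[OF N(1)] ent_mult_right[OF N(1)]
        ent_mult_right[OF N(3)] ent_star cnj.sel)
  then show ?thesis by (simp add: inner_commute)
qed

lemma inner_mult_adjoint_right: "inner x (y * z) = inner (x * star z) y"
  by (metis inner_mult_adjoint_left inner_star_star star_mult star_star)

lemma norm_mult_star: "norm (x * star x) = norm (star x * x)"
proof -
  have "inner (x * star x) (x * star x) = inner (star x * (x * star x)) (star x)"
    by (simp add: inner_mult_adjoint_left)
  also have "\<dots> = inner (star x * x) (star x * x)"
    using inner_mult_adjoint_right[of "star x * x" "star x" x] by (simp add: mult.assoc)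
  finally show ?thesis by (simp add: norm_eq_sqrt_inner)
qed

section \<open>Commuting conditional expectations\<close>

text \<open>
  Testing \<open>x\<close> by left multiplication on the Hilbert space of matrices is the same as testing it on
  every column.  The real part does not detect a skew-Hermitian summand, so Hermitian symmetry
  is a separate condition where a positive matrix is meant.
\<close>

definition psd :: "fmat \<Rightarrow> bool" where
  "psd x \<longleftrightarrow> (\<forall>y. 0 \<le> inner y (x * y))"

lemma psd_add: "psd x \<Longrightarrow> psd y \<Longrightarrow> psd (x + y)"
  by (simp add: psd_def algebra_simps inner_add_right)

lemma psd_scaleR: "0 \<le> c \<Longrightarrow> psd x \<Longrightarrow> psd (c *\<^sub>R x)"
  by (simp add: psd_def)

lemma psd_0: "psd 0"
  by (simp add: psd_def)

lemma psd_sum: "(\<And>a. a \<in> S \<Longrightarrow> psd (f a)) \<Longrightarrow> psd (sum f S)"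
  by (induction S rule: infinite_finite_induct) (auto intro: psd_add psd_0)

lemma psd_star_mult: "psd (star x * x)"
  by (simp add: psd_def mult.assoc inner_mult_adjoint_left[of _ "star x"])

text \<open>
  The properties of the partial traces that the semigroup arguments rest on: trace-preserving
  conditional expectations (\<open>E_adj\<close> and \<open>E_module\<close>) that commute with each other.
\<close>

locale expectations =
  fixes E :: "nat \<Rightarrow> fmat \<Rightarrow> fmat"
  assumes linear_E: "linear (E b)"
    and E_idem [simp]: "E b (E b x) = E b x"
    and E_star: "E b (star x) = star (E b x)"
    and E_adj: "inner (E b x) y = inner x (E b y)"
    and E_module: "E b (E b x * y) = E b x * E b y"
    and E_pos: "psd x \<Longrightarrow> psd (E b x)"
    and E_commute: "E b (E c x) = E c (E b x)"
begin

lemmas E_lin = linear_add[OF linear_E] linear_diff[OF linear_E] linear_scale[OF linear_E]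
  linear_0[OF linear_E]

lemma E_module': "E b (y * E b x) = E b y * E b x"
  by (metis E_module E_star star_mult star_star)

definition diff_op :: "nat \<Rightarrow> fmat \<Rightarrow> fmat" where
  "diff_op b x = x - E b x"

definition damp :: "real \<Rightarrow> nat \<Rightarrow> fmat \<Rightarrow> fmat" where
  "damp r b x = r *\<^sub>R x + (1 - r) *\<^sub>R E b x"

primrec noise :: "real \<Rightarrow> nat \<Rightarrow> fmat \<Rightarrow> fmat" where
  "noise r 0 x = x"
| "noise r (Suc k) x = damp r k (noise r k x)"

text \<open>
  \<open>level k i\<close> is the sum, over all sets \<open>S\<close> of \<open>i\<close> indices below \<open>k\<close>, of the product of \<open>diff_op b\<close>
  for \<open>b \<in> S\<close> and \<open>E b\<close> for the other \<open>b < k\<close>.  Splitting according to whether \<open>k\<close> lies in \<open>S\<close>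
  gives the recursion, which avoids the sets.
\<close>

primrec level :: "nat \<Rightarrow> nat \<Rightarrow> fmat \<Rightarrow> fmat" where
  "level 0 i x = (if i = 0 then x else 0)"
| "level (Suc k) i x = E k (level k i x) + (case i of 0 \<Rightarrow> 0 | Suc i' \<Rightarrow> diff_op k (level k i' x))"

lemma linear_diff_op: "linear (diff_op b)"
  by (rule linearI) (auto simp: diff_op_def E_lin algebra_simps)

lemma linear_damp: "linear (damp r b)"
  by (rule linearI) (auto simp: damp_def E_lin algebra_simps)

lemma linear_noise: "linear (noise r k)"
  by (induction k) (auto intro!: linearI simp: linear_add linear_scale linear_add[OF linear_damp] linear_scale[OF linear_damp])

lemma linear_level: "linear (level k i)"
proof (induction k arbitrary: i)
  case 0
  show ?case by (rule linearI) auto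
next
  case (Suc k)
  show ?case
    by (rule linearI)
       (auto simp: linear_add[OF Suc] linear_scale[OF Suc] linear_add[OF linear_diff_op]
         linear_scale[OF linear_diff_op] E_lin algebra_simps split: nat.split)
qed

lemmas diff_op_lin = linear_add[OF linear_diff_op] linear_diff[OF linear_diff_op] linear_scale[OF linear_diff_op] linear_0[OF linear_diff_op]
lemmas damp_lin = linear_add[OF linear_damp] linear_diff[OF linear_damp] linear_scale[OF linear_damp] linear_0[OF linear_damp]
lemmas noise_lin = linear_add[OF linear_noise] linear_diff[OF linear_noise] linear_scale[OF linear_noise] linear_0[OF linear_noise]
lemmas level_lin = linear_add[OF linear_level] linear_diff[OF linear_level] linear_scale[OF linear_level] linear_0[OF linear_level]

lemma E_diff_op [simp]: "E b (diff_op b x) = 0" and diff_op_E [simp]: "diff_op b (E b x) = 0"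
  by (simp_all add: diff_op_def E_lin)

lemma diff_op_idem [simp]: "diff_op b (diff_op b x) = diff_op b x"
  by (simp add: diff_op_def E_lin)

lemma E_diff_op_commute: "E b (diff_op c x) = diff_op c (E b x)"
  by (simp add: diff_op_def E_lin E_commute[of b c])

lemma diff_op_commute: "diff_op b (diff_op c x) = diff_op c (diff_op b x)"
  by (simp add: diff_op_def E_lin E_commute[of b c])

lemma diff_op_star: "diff_op b (star x) = star (diff_op b x)"
  by (simp add: diff_op_def E_star)

lemma diff_op_adj: "inner (diff_op b x) y = inner x (diff_op b y)"
  by (simp add: diff_op_def inner_diff_left inner_diff_right E_adj)

lemma damp_star: "damp r b (star x) = star (damp r b x)"
  by (simp add: damp_def E_star)

lemma noise_star: "noise r k (star x) = star (noise r k x)"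
  by (induction k) (auto simp: damp_star)

lemma damp_adj: "inner (damp r b x) y = inner x (damp r b y)"
  by (simp add: damp_def inner_add_left inner_add_right E_adj)

lemma E_damp_commute: "E b (damp r c x) = damp r c (E b x)"
  by (simp add: damp_def E_lin E_commute[of b c])

lemma diff_op_damp_commute: "diff_op b (damp r c x) = damp r c (diff_op b x)"
  by (simp add: diff_op_def E_damp_commute damp_lin)

lemma E_noise_commute: "E b (noise r k x) = noise r k (E b x)"
  by (induction k) (auto simp: E_damp_commute)

lemma diff_op_noise_commute: "diff_op b (noise r k x) = noise r k (diff_op b x)"
  by (simp add: diff_op_def E_noise_commute noise_lin)

lemma damp_noise_commute: "damp s b (noise r k x) = noise r k (damp s b x)"
  by (simp add: damp_def E_noise_commute noise_lin)

lemma noise_adj: "inner (noise r k x) y = inner x (noise r k y)"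
  by (induction k arbitrary: x y) (auto simp: damp_adj damp_noise_commute)

lemma E_level_commute: "E b (level k i x) = level k i (E b x)"
  by (induction k arbitrary: i) (auto simp: E_lin E_commute[of b] E_diff_op_commute split: nat.split)

lemma diff_op_level_commute: "diff_op b (level k i x) = level k i (diff_op b x)"
  by (simp add: diff_op_def E_level_commute level_lin)

lemma damp_damp: "damp r b (damp s b x) = damp (r * s) b x"
  by (simp add: damp_def E_lin algebra_simps flip: scaleR_add_left)

lemma noise_noise: "noise r k (noise s k x) = noise (r * s) k x"
  by (induction k arbitrary: x) (auto simp: damp_damp damp_noise_commute[symmetric] mult.commute)

lemma noise_1 [simp]: "noise 1 k x = x"
  by (induction k) (auto simp: damp_def)

lemma level_eq_0: "k < i \<Longrightarrow> level k i x = 0"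
  by (induction k arbitrary: i) (auto simp: E_lin diff_op_lin split: nat.split)

lemma level_0: "level k 0 x = noise 0 k x"
  by (induction k) (auto simp: damp_def)

text \<open>
  Expansion of the product of \<open>E b + r diff_op b\<close> in powers of \<open>r\<close>.
\<close>

lemma noise_eq_sum_level: "noise r k x = (\<Sum>i\<le>k. r ^ i *\<^sub>R level k i x)"
proof (induction k)
  case (Suc k)
  have "noise r (Suc k) x = E k (noise r k x) + r *\<^sub>R diff_op k (noise r k x)"
    by (simp add: damp_def diff_op_def algebra_simps)
  also have "E k (noise r k x) = (\<Sum>i\<le>Suc k. r ^ i *\<^sub>R E k (level k i x))"
    by (simp add: Suc linear_sum[OF linear_E] E_lin level_eq_0)
  also have "r *\<^sub>R diff_op k (noise r k x) = (\<Sum>i\<le>k. r ^ Suc i *\<^sub>R diff_op k (level k i x))"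
    by (simp add: Suc linear_sum[OF linear_diff_op] diff_op_lin scaleR_sum_right)
  also have "\<dots> = (\<Sum>i\<le>Suc k. r ^ i *\<^sub>R (case i of 0 \<Rightarrow> 0 | Suc i' \<Rightarrow> diff_op k (level k i' x)))"
    by (subst sum.atMost_Suc_shift) simp
  finally show ?case
    by (simp only: level.simps scaleR_add_right sum.distrib)
qed simp

text \<open>
  The generator of the noise semigroup acts on level \<open>i\<close> as multiplication by \<open>i\<close>: each product of
  idempotents in the level is fixed by \<open>diff_op b\<close> for its \<open>i\<close> indices \<open>b \<in> S\<close> and killed by the
  others.
\<close>

lemma sum_diff_op_level: "(\<Sum>b<k. diff_op b (level k i x)) = real i *\<^sub>R level k i x"
proof (induction k arbitrary: i)
  case (Suc k)
  have 1: "(\<Sum>b<k. diff_op b (E k (level k i x))) = real i *\<^sub>R E k (level k i x)" for i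
    by (simp add: E_diff_op_commute[symmetric] linear_sum[OF linear_E, symmetric] Suc E_lin)
  have 2: "(\<Sum>b<k. diff_op b (diff_op k (level k i x))) = real i *\<^sub>R diff_op k (level k i x)" for i
    by (simp add: diff_op_commute[of _ k] linear_sum[OF linear_diff_op, symmetric] Suc diff_op_lin)
  show ?case
    by (cases i) (auto simp: diff_op_lin sum.distrib 1 2 algebra_simps)
qed simp

lemma inner_level_nonneg: "0 \<le> inner x (level k i x)"
proof (induction k arbitrary: i x)
  case (Suc k)
  have 1: "inner x (E k (level k i x)) = inner (E k x) (level k i (E k x))" for i
    by (metis E_adj E_level_commute E_idem)
  have 2: "inner x (diff_op k (level k i x)) = inner (diff_op k x) (level k i (diff_op k x))" for i
    by (metis diff_op_adj diff_op_level_commute diff_op_idem)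
  show ?case
    by (auto simp: inner_add_right 1 2 intro!: add_nonneg_nonneg Suc split: nat.split)
qed simp


text \<open>
  The conditional variance of \<open>x\<close>.  The cross terms vanish by the module property.
\<close>

lemma E_square_defect: "E b (star x * x) - star (E b x) * E b x = E b (star (diff_op b x) * diff_op b x)"
proof -
  have "E b (star x * E b x) = star (E b x) * E b x"
    by (simp add: E_module' E_star)
  moreover have "E b (star (E b x) * x) = star (E b x) * E b x"
    by (metis E_module E_star)
  moreover have "E b (star (E b x) * E b x) = star (E b x) * E b x"
    by (metis E_module E_star E_idem)
  ultimately show ?thesis
    by (simp add: diff_op_def algebra_simps E_lin)
qed

text \<open>
  The Kadison--Schwarz defect of a single noise factor is an explicit combination of squares.  Its
  first term is the gradient that \<open>reverse_poincare\<close> collects.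
\<close>

lemma damp_square_defect:
  "damp r b (star x * x) - star (damp r b x) * damp r b x
     = (r * (1 - r)) *\<^sub>R (star (diff_op b x) * diff_op b x) + (1 - r) *\<^sub>R E b (star (diff_op b x) * diff_op b x)"
proof -
  define e where "e = E b x"
  define y where "y = diff_op b x"
  have x: "x = e + y" by (simp add: e_def y_def diff_op_def)
  have E: "E b (star x * x) = star e * e + E b (star y * y)"
    using E_square_defect[of b x] by (simp add: e_def y_def algebra_simps)
  have damp: "damp r b x = e + r *\<^sub>R y"
    by (simp add: damp_def e_def y_def diff_op_def algebra_simps)
  show ?thesis
    unfolding damp_def[of r b "star x * x"] E damp y_def[symmetric]
    by (simp add: x algebra_simps)
qed

lemma damp_pos: "psd x \<Longrightarrow> 0 \<le> r \<Longrightarrow> r \<le> 1 \<Longrightarrow> psd (damp r b x)"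
  by (simp add: damp_def E_pos psd_add psd_scaleR)

lemma noise_pos: "psd x \<Longrightarrow> 0 \<le> r \<Longrightarrow> r \<le> 1 \<Longrightarrow> psd (noise r k x)"
  by (induction k) (auto intro: damp_pos)

lemma damp_square_gt:
  assumes "0 \<le> r" "r \<le> 1"
  shows "psd (damp r b (star x * x) - star (damp r b x) * damp r b x - (r * (1 - r)) *\<^sub>R (star (diff_op b x) * diff_op b x))"
  unfolding damp_square_defect using assms by (simp add: psd_scaleR E_pos psd_star_mult)

lemma kadison_schwarz_damp:
  assumes "0 \<le> r" "r \<le> 1"
  shows "psd (damp r b (star x * x) - star (damp r b x) * damp r b x)"
  unfolding damp_square_defect using assms by (simp add: psd_add psd_scaleR E_pos psd_star_mult)

lemma kadison_schwarz_noise: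
  assumes "0 \<le> r" "r \<le> 1"
  shows "psd (noise r k (star x * x) - star (noise r k x) * noise r k x)"
proof (induction k)
  case (Suc k)
  have "noise r (Suc k) (star x * x) - star (noise r (Suc k) x) * noise r (Suc k) x =
    damp r k (noise r k (star x * x) - star (noise r k x) * noise r k x) +
    (damp r k (star (noise r k x) * noise r k x) - star (damp r k (noise r k x)) * damp r k (noise r k x))"
    by (simp add: damp_lin)
  then show ?case
    by (simp only:) (intro psd_add damp_pos Suc kadison_schwarz_damp assms)
qed (simp add: psd_0)

text \<open>
  Each new noise factor contributes its own gradient through \<open>damp_square_gt\<close>, while
  the gradients collected so far pass through it by the Kadison--Schwarz inequality.  The constant
  comes from \<open>diff_op k\<close> of a damped element being \<open>r\<close> times \<open>diff_op k\<close>, so that \<open>r (1 - r)\<close> turns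
  into \<open>(1 - r) / r\<close>.
\<close>

lemma reverse_poincare:
  assumes "0 < r" "r \<le> 1"
  shows "psd (noise r k (star x * x) - star (noise r k x) * noise r k x
    - ((1 - r) / r) *\<^sub>R (\<Sum>b<k. star (diff_op b (noise r k x)) * diff_op b (noise r k x)))"
proof (induction k)
  case (Suc k)
  let ?c = "(1 - r) / r"
  define g where "g = noise r k x"
  define S where "S = (\<Sum>b<k. star (diff_op b g) * diff_op b g)"
  have dQ: "star (damp r k (diff_op k g)) * damp r k (diff_op k g) = r\<^sup>2 *\<^sub>R (star (diff_op k g) * diff_op k g)"
    by (simp add: damp_def power2_eq_square)
  have cY: "?c *\<^sub>R (star (damp r k (diff_op k g)) * damp r k (diff_op k g)) = (r * (1 - r)) *\<^sub>R (star (diff_op k g) * diff_op k g)"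
    unfolding dQ using assms by (simp add: power2_eq_square)
  have "noise r (Suc k) (star x * x) - star (noise r (Suc k) x) * noise r (Suc k) x
      - ?c *\<^sub>R (\<Sum>b<Suc k. star (diff_op b (noise r (Suc k) x)) * diff_op b (noise r (Suc k) x))
    = damp r k (noise r k (star x * x) - star g * g - ?c *\<^sub>R S)
      + (damp r k (star g * g) - star (damp r k g) * damp r k g - (r * (1 - r)) *\<^sub>R (star (diff_op k g) * diff_op k g))
      + ?c *\<^sub>R (\<Sum>b<k. damp r k (star (diff_op b g) * diff_op b g) - star (damp r k (diff_op b g)) * damp r k (diff_op b g))"
    unfolding cY[symmetric]
    by (simp add: g_def[symmetric] damp_lin S_def linear_sum[OF linear_damp]
        sum_subtractf algebra_simps diff_op_damp_commute)
  also have "psd \<dots>"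
    using assms Suc[folded g_def, folded S_def]
    by (intro psd_add damp_pos damp_square_gt psd_scaleR psd_sum kadison_schwarz_damp) auto
  finally show ?case .
qed (simp add: psd_0)


text \<open>
  \<open>noise 0 k\<close> averages over the first \<open>k\<close> indices.  Consecutive averages differ by the martingale
  differences, which are orthogonal to the next average also after the application of the noise,
  because the noise commutes with every \<open>E b\<close>.
\<close>

lemma martingale_split:
  "inner x (noise r n x) = inner (noise 0 m x) (noise r n (noise 0 m x))
     + (\<Sum>k<m. inner (diff_op k (noise 0 k x)) (noise r n (diff_op k (noise 0 k x))))"
proof (induction m)
  case (Suc m)
  define y where "y = noise 0 m x"
  define e where "e = E m y"
  define z where "z = diff_op m y"
  have "inner e (noise r n z) = 0"
    unfolding e_def z_def E_adj E_noise_commute by (simp add: noise_lin)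
  moreover have "inner z (noise r n e) = 0"
    unfolding e_def z_def diff_op_adj diff_op_noise_commute by (simp add: noise_lin)
  moreover have y: "y = e + z" by (simp add: e_def z_def diff_op_def)
  ultimately have "inner y (noise r n y) = inner e (noise r n e) + inner z (noise r n z)"
    by (simp add: noise_lin inner_add_left inner_add_right)
  with Suc show ?case by (simp add: y_def e_def z_def damp_def)
qed simp

lemma damp_noise_0: "b < k \<Longrightarrow> damp r b (noise 0 k x) = noise 0 k x"
proof -
  have *: "damp r b (E b y) = E b y" for y by (simp add: damp_def flip: scaleR_add_left)
  show "b < k \<Longrightarrow> damp r b (noise 0 k x) = noise 0 k x"
  proof (induction k)
    case (Suc k)
    have "noise 0 (Suc k) x = E k (noise 0 k x)" by (simp add: damp_def)
    with Suc * show ?case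
      by (cases "b = k") (auto simp: E_damp_commute[symmetric])
  qed simp
qed

end

section \<open>Units of corners and the embedding of matrices\<close>

text \<open>
  The unit of a corner.  The unnormalized trace of \<open>x\<close> is written as the inner product with it.
\<close>

definition unit_upto :: "nat \<Rightarrow> fmat" where
  "unit_upto N = Fmat (\<lambda>i j. if i = j \<and> i < N then 1 else 0)"

lemma ent_unit_upto [simp]: "ent (unit_upto N) i j = (if i = j \<and> i < N then 1 else 0)"
  unfolding unit_upto_def by (subst ent_Fmat[where N = N]) auto

lemma unit_upto_corner [simp]: "unit_upto N \<in> corner N"
  by (auto simp: corner_def split: if_splits)

lemma star_unit_upto [simp]: "star (unit_upto N) = unit_upto N"
  by (rule fmat_eqI) auto

lemma unit_upto_mult [simp]:
  assumes x: "x \<in> corner N"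
  shows "unit_upto N * x = x"
proof (rule fmat_eqI)
  fix i j
  have "ent (unit_upto N * x) i j = (\<Sum>k<N. if k = i then ent x k j else 0)"
    unfolding ent_mult_right[OF x] by (intro sum.cong) auto
  then show "ent (unit_upto N * x) i j = ent x i j" by (simp add: cornerD[OF x])
qed

lemma mult_unit_upto [simp]: "x \<in> corner N \<Longrightarrow> x * unit_upto N = x"
  by (metis unit_upto_mult star_unit_upto star_corner star_mult star_star)

lemma norm_unit_upto: "(norm (unit_upto N))\<^sup>2 = real N"
proof -
  have "(\<Sum>i<N. \<Sum>j<N. cnj (ent (unit_upto N) i j) * ent (unit_upto N) i j) = (\<Sum>i<N. \<Sum>j<N. if i = j then 1 else 0)"
    by (intro sum.cong) auto
  also have "\<dots> = of_nat N" by (simp add: sum.delta)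
  finally show ?thesis
    by (simp add: power2_norm_eq_inner inner_left[of _ N])
qed

lemma corner_closed:
  shows corner_0: "0 \<in> corner N"
    and corner_add: "x \<in> corner N \<Longrightarrow> y \<in> corner N \<Longrightarrow> x + y \<in> corner N"
    and corner_diff: "x \<in> corner N \<Longrightarrow> y \<in> corner N \<Longrightarrow> x - y \<in> corner N"
    and corner_scaleR: "x \<in> corner N \<Longrightarrow> c *\<^sub>R x \<in> corner N"
    and corner_sum: "(\<And>a. a \<in> S \<Longrightarrow> f a \<in> corner N) \<Longrightarrow> sum f S \<in> corner N"
    and corner_mult: "x \<in> corner N \<Longrightarrow> y \<in> corner N \<Longrightarrow> x * y \<in> corner N"
proof -
  show "x \<in> corner N \<Longrightarrow> y \<in> corner N \<Longrightarrow> x * y \<in> corner N"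
    by (rule cornerI) (auto simp: ent_mult_left[of _ N] cornerD)
  show "(\<And>a. a \<in> S \<Longrightarrow> f a \<in> corner N) \<Longrightarrow> sum f S \<in> corner N"
    by (rule cornerI) (auto intro!: sum.neutral dest: cornerD)
qed (auto intro!: cornerI simp: cornerD)

definition of_mat :: "complex mat \<Rightarrow> fmat" where
  "of_mat A = Fmat (\<lambda>i j. if i < dim_row A \<and> j < dim_col A then A $$ (i, j) else 0)"

definition to_mat :: "nat \<Rightarrow> fmat \<Rightarrow> complex mat" where
  "to_mat N x = mat N N (\<lambda>(i, j). ent x i j)"

lemma ent_of_mat: "ent (of_mat A) i j = (if i < dim_row A \<and> j < dim_col A then A $$ (i, j) else 0)"
  unfolding of_mat_def by (subst ent_Fmat[where N = "max (dim_row A) (dim_col A)"]) auto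

lemma to_mat_carrier [simp]: "to_mat N x \<in> carrier_mat N N"
  by (simp add: to_mat_def)

lemma of_mat_to_mat [simp]: "x \<in> corner N \<Longrightarrow> of_mat (to_mat N x) = x"
  by (rule fmat_eqI) (auto simp: ent_of_mat to_mat_def cornerD)

lemma trace_mult_commute:
  assumes "X \<in> carrier_mat N N" "Y \<in> carrier_mat N (N::nat)"
  shows "(\<Sum>i<N. (X * Y) $$ (i, i)) = (\<Sum>i<N. (Y * X) $$ (i, i :: nat) :: complex)"
proof -
  have "(\<Sum>i<N. (X * Y) $$ (i, i)) = (\<Sum>i<N. \<Sum>k<N. X $$ (i, k) * Y $$ (k, i))"
    using assms by (intro sum.cong) (auto simp: scalar_prod_def atLeast0LessThan)
  also have "\<dots> = (\<Sum>k<N. \<Sum>i<N. X $$ (i, k) * Y $$ (k, i))" by (rule sum.swap)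
  also have "\<dots> = (\<Sum>i<N. (Y * X) $$ (i, i))"
    using assms by (intro sum.cong) (auto simp: scalar_prod_def atLeast0LessThan mult.commute)
  finally show ?thesis .
qed

section \<open>The spectral theorem\<close>

text \<open>
  A Schur form with zero diagonal has a square of trace zero; for a Hermitian matrix this
  trace is the squared Frobenius norm.
\<close>

lemma nonzero_eigenvalue:
  assumes x: "x \<in> corner N" "star x = x" "x \<noteq> 0"
  shows "\<exists>a. a \<noteq> 0 \<and> eigenvalue (to_mat N x) a"
proof -
  define A where "A = to_mat N x"
  have A: "A \<in> carrier_mat N N" by (simp add: A_def)
  obtain as where as: "char_poly A = (\<Prod>a\<leftarrow>as. [:- a, 1:])"
    using char_poly_factorized[OF A] by blast
  obtain B U V where BUV: "schur_decomposition A as = (B, U, V)" by (cases "schur_decomposition A as") auto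
  from schur_decomposition[OF A as BUV]
  have sim: "similar_mat_wit A B U V" and ut: "upper_triangular B" and diag: "diag_mat B = as" by auto
  from similar_mat_witD2[OF A sim]
  have B: "B \<in> carrier_mat N N" and U: "U \<in> carrier_mat N N" and V: "V \<in> carrier_mat N N"
    and VU: "V * U = 1\<^sub>m N" and A_eq: "A = U * B * V" by auto
  have "\<exists>a\<in>set as. a \<noteq> 0"
  proof (rule ccontr)
    assume "\<not> (\<exists>a\<in>set as. a \<noteq> 0)"
    then have d0: "B $$ (i, i) = 0" if "i < N" for i
      using that B diag by (auto simp: diag_mat_def)
    have AA: "A * A = U * (B * B * V)"
    proof -
      have "A * A = U * B * (V * U) * B * V"
        unfolding A_eq using B U V by (simp add: assoc_mult_mat[of _ N N _ N _ N])
      then show ?thesis unfolding VU using B U V by (simp add: assoc_mult_mat[of _ N N _ N _ N])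
    qed
    have "(\<Sum>i<N. (A * A) $$ (i, i)) = (\<Sum>i<N. (B * B * V * U) $$ (i, i))"
      unfolding AA using B U V by (intro trace_mult_commute) auto
    also have "B * B * V * U = B * B"
      using B U V VU by (simp add: assoc_mult_mat[of _ N N _ N _ N])
    also have "(\<Sum>i<N. (B * B) $$ (i, i)) = (\<Sum>i<N. \<Sum>k<N. B $$ (i, k) * B $$ (k, i))"
      using B by (intro sum.cong) (auto simp: scalar_prod_def atLeast0LessThan)
    also have "\<dots> = 0"
    proof (intro sum.neutral ballI)
      fix i k assume "i \<in> {..<N}" "k \<in> {..<N}"
      then show "B $$ (i, k) * B $$ (k, i) = 0"
        using ut B d0 by (cases i k rule: linorder_cases) (auto simp: upper_triangular_def)
    qed
    finally have 0: "(\<Sum>i<N. (A * A) $$ (i, i)) = 0" .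
    have "(\<Sum>i<N. (A * A) $$ (i, i)) = (\<Sum>i<N. \<Sum>k<N. A $$ (i, k) * A $$ (k, i))"
      using A by (intro sum.cong) (auto simp: scalar_prod_def atLeast0LessThan)
    also have "\<dots> = (\<Sum>i<N. \<Sum>k<N. cnj (ent x i k) * ent x i k)"
    proof (intro sum.cong refl)
      fix i k assume "i \<in> {..<N}" "k \<in> {..<N}"
      moreover have "ent x k i = cnj (ent x i k)" by (metis ent_star x(2))
      ultimately show "A $$ (i, k) * A $$ (k, i) = cnj (ent x i k) * ent x i k"
        by (simp add: A_def to_mat_def)
    qed
    finally have "inner x x = 0" unfolding inner_left[OF x(1)] using 0 by simp
    then show False using x(3) by simp
  qed
  then obtain a where a: "a \<in> set as" "a \<noteq> 0" by blast
  then have "poly (char_poly A) a = 0"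
    unfolding as by (simp add: poly_prod_list prod_list_zero_iff image_iff o_def)
  then show ?thesis using a(2) eigenvalue_root_char_poly[OF A] by (auto simp: A_def)
qed

text \<open>
  The projection onto the line spanned by an eigenvector for a nonzero eigenvalue.  The eigenvalue is
  real because \<open>e x e\<close> is Hermitian.
\<close>

lemma eigenprojection:
  assumes x: "x \<in> corner N" "star x = x" "x \<noteq> 0"
  shows "\<exists>l e. l \<noteq> 0 \<and> e \<in> corner N \<and> star e = e \<and> e * e = e \<and> norm e = 1 \<and> x * e = l *\<^sub>R e"
proof -
  obtain a where a: "a \<noteq> 0" "eigenvalue (to_mat N x) a"
    using nonzero_eigenvalue[OF x] by blast
  then obtain v where v: "v \<in> carrier_vec N" "v \<noteq> 0\<^sub>v N" "to_mat N x *\<^sub>v v = a \<cdot>\<^sub>v v"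
    unfolding eigenvalue_def eigenvector_def by (auto simp: to_mat_def)
  have eig: "(\<Sum>k<N. ent x i k * v $ k) = a * v $ i" if "i < N" for i
    using arg_cong[OF v(3), of "\<lambda>w. w $ i"] that v(1)
    by (auto simp: to_mat_def scalar_prod_def atLeast0LessThan)
  define s where "s = (\<Sum>k<N. (cmod (v $ k))\<^sup>2)"
  have "s \<noteq> 0"
  proof
    assume "s = 0"
    then have "\<forall>k<N. v $ k = 0" by (simp add: s_def sum_nonneg_eq_0_iff)
    with v show False by (auto intro!: eq_vecI)
  qed
  have s: "(\<Sum>k<N. v $ k * cnj (v $ k)) = of_real s"
    by (simp add: s_def complex_mult_cnj cmod_power2)
  define e where "e = Fmat (\<lambda>i j. if i < N \<and> j < N then v $ i * cnj (v $ j) / of_real s else 0)"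
  have ent_e: "ent e i j = (if i < N \<and> j < N then v $ i * cnj (v $ j) / of_real s else 0)" for i j
    unfolding e_def by (subst ent_Fmat[where N = N]) auto
  have e: "e \<in> corner N" by (rule cornerI) (auto simp: ent_e)
  have star_e: "star e = e" by (rule fmat_eqI) (auto simp: ent_e)
  have ee: "e * e = e"
  proof (rule fmat_eqI)
    fix i j
    have "ent (e * e) i j = (if i < N \<and> j < N then
        (v $ i * cnj (v $ j) / (of_real s * of_real s)) * (\<Sum>k<N. v $ k * cnj (v $ k)) else 0)"
      by (auto simp: ent_mult_left[OF e] ent_e sum_distrib_left sum_divide_distrib mult_ac intro!: sum.cong)
    also have "\<dots> = ent e i j" using \<open>s \<noteq> 0\<close> unfolding s by (simp add: ent_e)
    finally show "ent (e * e) i j = ent e i j" .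
  qed
  have xe: "ent (x * e) i j = a * ent e i j" for i j
  proof -
    have "ent (x * e) i j = (if i < N \<and> j < N then
        (\<Sum>k<N. ent x i k * v $ k) * (cnj (v $ j) / of_real s) else 0)"
      by (auto simp: ent_mult_left[OF x(1)] ent_e sum_distrib_left sum_divide_distrib cornerD[OF x(1)] mult_ac intro!: sum.cong)
    also have "\<dots> = a * ent e i j" by (simp add: eig ent_e)
    finally show ?thesis .
  qed
  have "(\<Sum>i<N. \<Sum>j<N. cnj (ent e i j) * ent e i j)
      = (\<Sum>i<N. v $ i * cnj (v $ i)) * (\<Sum>j<N. v $ j * cnj (v $ j)) / (of_real s * of_real s)"
    by (simp add: ent_e sum_product sum_divide_distrib mult_ac)
  also have "\<dots> = 1" using \<open>s \<noteq> 0\<close> unfolding s by simp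
  finally have norm_e: "norm e = 1" by (simp only: norm_eq_sqrt_inner inner_left[OF e]) simp
  then have "e \<noteq> 0" by auto
  then obtain i j where ij: "ent e i j \<noteq> 0" by (metis ent_0 fmat_eqI)
  have exe: "ent (e * (x * e)) i j = a * ent e i j" for i j
  proof -
    have "ent (e * (x * e)) i j = a * ent (e * e) i j"
      unfolding ent_mult_left[OF e] xe by (simp add: sum_distrib_left mult_ac)
    then show ?thesis by (simp add: ee)
  qed
  have "star (e * (x * e)) = e * (x * e)" by (simp add: star_e x mult.assoc)
  then have "cnj (ent (e * (x * e)) j i) = ent (e * (x * e)) i j" by (metis ent_star)
  moreover have "cnj (ent e j i) = ent e i j" by (metis ent_star star_e)
  ultimately have "cnj a * ent e i j = a * ent e i j" unfolding exe by simp
  then have "cnj a = a" using ij by simp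
  then have a_real: "a = of_real (Re a)" by (simp add: complex_eq_iff)
  have "x * e = Re a *\<^sub>R e"
    by (rule fmat_eqI) (use xe a_real in \<open>metis ent_scaleR scaleR_conv_of_real\<close>)
  moreover have "Re a \<noteq> 0" using a(1) a_real by force
  ultimately show ?thesis using e star_e ee norm_e by blast
qed

text \<open>
  Resolutions of the unit into orthogonal projections, which may be zero or have any rank.
\<close>

definition resolution :: "nat \<Rightarrow> nat \<Rightarrow> (nat \<Rightarrow> fmat) \<Rightarrow> bool" where
  "resolution N k e \<longleftrightarrow> (\<forall>i<k. e i \<in> corner N \<and> star (e i) = e i) \<and>
     (\<forall>i<k. \<forall>j<k. e i * e j = (if i = j then e i else 0)) \<and> (\<Sum>i<k. e i) = unit_upto N"

text \<open>
  Orthogonal rank-one eigenprojections, not necessarily complete; norm one expresses rank one.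
\<close>

definition eigensystem :: "nat \<Rightarrow> fmat \<Rightarrow> nat \<Rightarrow> (nat \<Rightarrow> fmat) \<Rightarrow> (nat \<Rightarrow> real) \<Rightarrow> bool" where
  "eigensystem N x k e l \<longleftrightarrow>
     (\<forall>i<k. e i \<in> corner N \<and> star (e i) = e i \<and> norm (e i) = 1 \<and> x * e i = l i *\<^sub>R e i) \<and>
     (\<forall>i<k. \<forall>j<k. e i * e j = (if i = j then e i else 0))"

lemma inner_proj:
  assumes "e \<in> corner N" "star e = e" "e * e = e"
  shows "inner (unit_upto N) e = (norm e)\<^sup>2"
  using inner_mult_adjoint_left[of "unit_upto N" e e] assms by (simp add: power2_norm_eq_inner)

lemma inner_orth_proj:
  assumes "star e = e" "e * e = e" "e * f = 0"
  shows "inner e f = 0"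
proof -
  have "inner e (e * f) = inner (star e * e) f" by (rule inner_mult_adjoint_left)
  then show ?thesis by (simp add: assms)
qed

text \<open>
  With \<open>p\<close> the sum of the projections, the squared norm of \<open>unit_upto N - p\<close> is \<open>N - k\<close>.
\<close>

lemma eigensystem_le:
  assumes "eigensystem N x k e l"
  shows "k \<le> N"
proof -
  define p where "p = (\<Sum>i<k. e i)"
  have orth: "inner (e i) (e j) = (if i = j then 1 else 0)" if "i < k" "j < k" for i j
    using that assms inner_orth_proj[of "e i" "e j"]
    by (cases "i = j") (auto simp: eigensystem_def norm_eq_1)
  have "inner p p = real k"
    by (simp add: p_def inner_sum_left inner_sum_right orth sum.delta)
  moreover have "inner (unit_upto N) p = real k"
    using assms by (simp add: p_def inner_sum_right inner_proj eigensystem_def)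
  moreover have "0 \<le> inner (unit_upto N - p) (unit_upto N - p)" by simp
  moreover have "inner (unit_upto N) (unit_upto N) = real N" using norm_unit_upto by (simp add: power2_norm_eq_inner)
  ultimately show ?thesis
    by (simp add: inner_diff_left inner_diff_right inner_commute)
qed

text \<open>
  Deflation: in an eigensystem of maximal length the remainder \<open>x'\<close> vanishes, since otherwise an
  eigenprojection of \<open>x'\<close> for a nonzero eigenvalue would extend it.  Such an eigenprojection
  is automatically orthogonal to the previous ones because they annihilate \<open>x'\<close>.  The
  projection onto the kernel completes the resolution.
\<close>

theorem spectral:
  assumes x: "x \<in> corner N" "star x = x"
  obtains k e l where "resolution N k e" "x = (\<Sum>i<k. l i *\<^sub>R e i)" "\<forall>i<k. e i = 0 \<longrightarrow> l i = 0"
proof -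
  define K where "K = {k. \<exists>e l. eigensystem N x k e l}"
  have "finite K" by (rule finite_subset[of _ "{..N}"]) (auto simp: K_def eigensystem_le)
  moreover have "0 \<in> K" by (auto simp: K_def eigensystem_def)
  ultimately have "Max K \<in> K" and max: "\<And>k. k \<in> K \<Longrightarrow> k \<le> Max K"
    by (auto intro: Max_in)
  then obtain e l where es: "eigensystem N x (Max K) e l" by (auto simp: K_def)
  define k where "k = Max K"
  have e: "e i \<in> corner N" "star (e i) = e i" "norm (e i) = 1" "x * e i = l i *\<^sub>R e i" if "i < k" for i
    using es that by (auto simp: eigensystem_def k_def)
  have ee: "e i * e j = (if i = j then e i else 0)" if "i < k" "j < k" for i j
    using es that by (auto simp: eigensystem_def k_def)
  have ex: "e i * x = l i *\<^sub>R e i" if "i < k" for i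
    by (metis e(2,4) star_mult star_scaleR that x(2))
  define x' where "x' = x - (\<Sum>i<k. l i *\<^sub>R e i)"
  have "x' = 0"
  proof (rule ccontr)
    assume "x' \<noteq> 0"
    moreover have "x' \<in> corner N" "star x' = x'"
      by (auto simp: x'_def x e intro!: corner_closed)
    ultimately obtain m f where f: "m \<noteq> 0" "f \<in> corner N" "star f = f" "f * f = f" "norm f = 1"
      "x' * f = m *\<^sub>R f"
      using eigenprojection by blast
    have ex': "e i * x' = 0" if "i < k" for i
      using that by (simp add: x'_def right_diff_distrib ex sum_distrib_left ee sum.delta' if_distrib[of "\<lambda>a. _ *\<^sub>R a"] cong: if_cong)
    have ef: "e i * f = 0" if "i < k" for i
    proof -
      have "m *\<^sub>R (e i * f) = e i * x' * f" by (simp add: mult.assoc f)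
      then show ?thesis using ex'[OF that] f(1) by simp
    qed
    have fe: "f * e i = 0" if "i < k" for i
      using arg_cong[OF ef[OF that], of star] e(2)[OF that] f(3) by simp
    have xf: "x * f = m *\<^sub>R f"
    proof -
      have "x * f = x' * f + (\<Sum>i<k. l i *\<^sub>R (e i * f))"
        by (simp add: x'_def left_diff_distrib sum_distrib_right)
      then show ?thesis by (simp add: f ef)
    qed
    have "eigensystem N x (Suc k) (e(k := f)) (l(k := m))"
      unfolding eigensystem_def by (auto simp: less_Suc_eq e ee ef fe f xf)
    then have "Suc k \<in> K" by (auto simp: K_def)
    then show False using max[of "Suc k"] by (simp add: k_def)
  qed
  define p where "p = unit_upto N - (\<Sum>i<k. e i)"
  have p: "p \<in> corner N" "star p = p"
    by (auto simp: p_def e intro!: corner_closed)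
  have ep: "e i * p = 0" if "i < k" for i
    using that by (simp add: p_def right_diff_distrib sum_distrib_left ee e sum.delta' cong: if_cong)
  have pe: "p * e i = 0" if "i < k" for i
    using arg_cong[OF ep[OF that], of star] e(2)[OF that] p(2) by simp
  have "p * p = p" using p by (subst (1) p_def) (simp add: left_diff_distrib sum_distrib_right ep)
  then have "resolution N (Suc k) (e(k := p))"
    unfolding resolution_def by (auto simp: less_Suc_eq e ee ep pe p) (simp add: p_def)
  moreover have "x = (\<Sum>i<Suc k. (l(k := 0)) i *\<^sub>R (e(k := p)) i)"
    using \<open>x' = 0\<close> by (simp add: x'_def)
  moreover have "\<forall>i<Suc k. (e(k := p)) i = 0 \<longrightarrow> (l(k := 0)) i = 0"
    using e(3) by (auto simp: less_Suc_eq) (metis norm_zero zero_neq_one)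
  ultimately show thesis by (rule that)
qed

section \<open>Square roots, trace norms and duality\<close>

text \<open>
  Functional calculus: if \<open>x\<close> is the spectral sum of \<open>l\<close>, then that of \<open>\<lambda>i. \<phi> (l i)\<close> is \<open>\<phi>\<close> applied to
  \<open>x\<close>.
\<close>

definition spectral_sum :: "nat \<Rightarrow> (nat \<Rightarrow> fmat) \<Rightarrow> (nat \<Rightarrow> real) \<Rightarrow> fmat" where
  "spectral_sum k e f = (\<Sum>i<k. f i *\<^sub>R e i)"

lemma spectral_sum_props:
  assumes "resolution N k e"
  shows spectral_sum_star: "star (spectral_sum k e f) = spectral_sum k e f"
    and spectral_sum_corner: "spectral_sum k e f \<in> corner N"
    and spectral_sum_mult: "spectral_sum k e f * spectral_sum k e g = spectral_sum k e (\<lambda>i. f i * g i)"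
    and spectral_sum_inner: "inner (spectral_sum k e f) (spectral_sum k e g) = (\<Sum>i<k. f i * g i * (norm (e i))\<^sup>2)"
    and spectral_sum_trace: "inner (unit_upto N) (spectral_sum k e f) = (\<Sum>i<k. f i * (norm (e i))\<^sup>2)"
    and spectral_sum_1: "spectral_sum k e (\<lambda>i. 1) = unit_upto N"
proof -
  have e: "e i \<in> corner N" "star (e i) = e i" if "i < k" for i
    using assms that by (auto simp: resolution_def)
  have ee: "e i * e j = (if i = j then e i else 0)" if "i < k" "j < k" for i j
    using assms that by (auto simp: resolution_def)
  show "star (spectral_sum k e f) = spectral_sum k e f" "spectral_sum k e f \<in> corner N"
    by (auto simp: spectral_sum_def e intro!: corner_closed)
  show "spectral_sum k e f * spectral_sum k e g = spectral_sum k e (\<lambda>i. f i * g i)"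
    by (simp add: spectral_sum_def sum_distrib_left sum_distrib_right ee sum.delta if_distrib[of "\<lambda>a. _ *\<^sub>R a"] mult.commute cong: if_cong)
  have orth: "inner (e i) (e j) = (if i = j then (norm (e i))\<^sup>2 else 0)" if "i < k" "j < k" for i j
    using that e ee inner_orth_proj[of "e i" "e j"]
    by (cases "i = j") (auto simp: power2_norm_eq_inner)
  show "inner (spectral_sum k e f) (spectral_sum k e g) = (\<Sum>i<k. f i * g i * (norm (e i))\<^sup>2)"
    by (simp add: spectral_sum_def inner_sum_left inner_sum_right orth sum.delta if_distrib[of "\<lambda>a. _ * a"] mult_ac cong: if_cong)
  show "inner (unit_upto N) (spectral_sum k e f) = (\<Sum>i<k. f i * (norm (e i))\<^sup>2)"
    by (simp add: spectral_sum_def inner_sum_right inner_proj e ee)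
  show "spectral_sum k e (\<lambda>i. 1) = unit_upto N" using assms by (simp add: spectral_sum_def resolution_def)
qed

lemma spectral_sum_psd:
  assumes "resolution N k e" "\<And>i. i < k \<Longrightarrow> 0 \<le> f i"
  shows "psd (spectral_sum k e f)"
  unfolding spectral_sum_def
proof (intro psd_sum psd_scaleR)
  fix i assume i: "i \<in> {..<k}"
  then show "0 \<le> f i" using assms by simp
  have "e i = star (e i) * e i" using assms(1) i by (simp add: resolution_def)
  then show "psd (e i)" by (metis psd_star_mult)
qed

lemma spectral_sum_cong: "(\<And>i. i < k \<Longrightarrow> f i = g i) \<Longrightarrow> spectral_sum k e f = spectral_sum k e g"
  by (simp add: spectral_sum_def)

lemma spectral_psd:
  assumes x: "x \<in> corner N" "star x = x" "psd x"
  obtains k e l where "resolution N k e" "x = spectral_sum k e l" "\<And>i. i < k \<Longrightarrow> 0 \<le> l i"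
proof -
  obtain k e l where s: "resolution N k e" "x = (\<Sum>i<k. l i *\<^sub>R e i)" "\<forall>i<k. e i = 0 \<longrightarrow> l i = 0"
    using spectral[OF x(1,2)] by blast
  have "0 \<le> l i" if i: "i < k" for i
  proof (cases "e i = 0")
    case False
    have "x * e i = l i *\<^sub>R e i"
      using s(1) i unfolding s(2) resolution_def
      by (simp add: sum_distrib_right sum.delta if_distrib[of "\<lambda>a. _ *\<^sub>R a"] cong: if_cong)
    then have "0 \<le> l i * (norm (e i))\<^sup>2"
      using x(3) unfolding psd_def by (metis inner_scaleR_right power2_norm_eq_inner)
    then show ?thesis using False by (simp add: zero_le_mult_iff)
  qed (use s(3) i in auto)
  with s show thesis using that unfolding spectral_sum_def by blast
qed

definition is_psd_root :: "nat \<Rightarrow> fmat \<Rightarrow> fmat \<Rightarrow> bool" where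
  "is_psd_root N x R \<longleftrightarrow> R \<in> corner N \<and> star R = R \<and> psd R \<and> R * R = x"

lemma psd_root_exists:
  assumes "x \<in> corner N" "star x = x" "psd x"
  shows "\<exists>R. is_psd_root N x R"
proof -
  obtain k e l where s: "resolution N k e" "x = spectral_sum k e l" "\<And>i. i < k \<Longrightarrow> 0 \<le> l i"
    using spectral_psd[OF assms] by metis
  have "is_psd_root N x (spectral_sum k e (\<lambda>i. sqrt (l i)))"
    unfolding is_psd_root_def using s
    by (auto simp: spectral_sum_star spectral_sum_corner spectral_sum_mult intro!: spectral_sum_psd spectral_sum_cong)
  then show ?thesis ..
qed

text \<open>
  If \<open>R\<close> and \<open>S\<close> have spectral projections \<open>e i\<close> and \<open>e' j\<close>, then \<open>e i (R R) e' j = e i (S S) e' j\<close>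
  forces the eigenvalues to agree, being nonnegative, whenever \<open>e i e' j \<noteq> 0\<close>; both roots then have
  the same expansion in the \<open>e i e' j\<close>.
\<close>

lemma psd_root_unique:
  assumes "is_psd_root N x R" "is_psd_root N x S"
  shows "R = S"
proof -
  obtain k e l where r: "resolution N k e" "R = spectral_sum k e l" "\<And>i. i < k \<Longrightarrow> 0 \<le> l i"
    using spectral_psd[of R N] assms unfolding is_psd_root_def by metis
  obtain k' e' l' where s: "resolution N k' e'" "S = spectral_sum k' e' l'" "\<And>i. i < k' \<Longrightarrow> 0 \<le> l' i"
    using spectral_psd[of S N] assms unfolding is_psd_root_def by metis
  have mulr: "e i * spectral_sum k e f = f i *\<^sub>R e i" if "i < k" for i f
    using r(1) that unfolding spectral_sum_def resolution_def
    by (simp add: sum_distrib_left sum.delta' if_distrib[of "\<lambda>a. _ *\<^sub>R a"] cong: if_cong)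
  have muls: "spectral_sum k' e' f * e' j = f j *\<^sub>R e' j" if "j < k'" for j f
    using s(1) that unfolding spectral_sum_def resolution_def
    by (simp add: sum_distrib_right sum.delta if_distrib[of "\<lambda>a. _ *\<^sub>R a"] cong: if_cong)
  have *: "l i *\<^sub>R (e i * e' j) = l' j *\<^sub>R (e i * e' j)" if "i < k" "j < k'" for i j
  proof -
    have "R * R = S * S" using assms by (simp add: is_psd_root_def)
    then have "e i * (R * R) * e' j = e i * (S * S) * e' j" by simp
    then have "(l i * l i) *\<^sub>R (e i * e' j) = (l' j * l' j) *\<^sub>R (e i * e' j)"
      unfolding r(2) s(2) spectral_sum_mult[OF r(1)] spectral_sum_mult[OF s(1)]
      using that by (simp add: mulr muls mult.assoc)
    then have "(l i)\<^sup>2 = (l' j)\<^sup>2 \<or> e i * e' j = 0" by (auto simp: power2_eq_square)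
    then show ?thesis using r(3) s(3) that by auto
  qed
  have "R = R * unit_upto N" using assms by (simp add: is_psd_root_def)
  also have "unit_upto N = (\<Sum>j<k'. e' j)" using s(1) by (simp add: resolution_def)
  also have "R * \<dots> = (\<Sum>i<k. \<Sum>j<k'. l i *\<^sub>R (e i * e' j))"
    by (simp add: r(2) spectral_sum_def sum_distrib_left sum_distrib_right scaleR_sum_right sum.swap[of _ "{..<k}"])
  also have "\<dots> = (\<Sum>i<k. \<Sum>j<k'. l' j *\<^sub>R (e i * e' j))"
    by (intro sum.cong refl) (auto simp: *)
  also have "\<dots> = (\<Sum>i<k. e i) * S"
    by (simp add: s(2) spectral_sum_def sum_distrib_left sum_distrib_right scaleR_sum_right sum.swap[of _ "{..<k}"])
  also have "(\<Sum>i<k. e i) = unit_upto N" using r(1) by (simp add: resolution_def)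
  also have "unit_upto N * S = S" using assms by (simp add: is_psd_root_def)
  finally show ?thesis .
qed

definition psd_root :: "nat \<Rightarrow> fmat \<Rightarrow> fmat" where
  "psd_root N x = (THE R. is_psd_root N x R)"

lemma psd_root_eq: "is_psd_root N x R \<Longrightarrow> psd_root N x = R"
  unfolding psd_root_def by (rule the_equality) (auto intro: psd_root_unique)

lemma psd_root:
  assumes "x \<in> corner N" "star x = x" "psd x"
  shows "is_psd_root N x (psd_root N x)"
  using psd_root_exists[OF assms] psd_root_eq by auto

text \<open>
  The unnormalized Schatten 1-norm.
\<close>

definition trace_norm :: "nat \<Rightarrow> fmat \<Rightarrow> real" where
  "trace_norm N x = inner (unit_upto N) (psd_root N (star x * x))"

text \<open>
  Column \<open>L\<^sub>\<infinity>\<close> against column \<open>L\<^sub>1\<close>.  In the eigenbasis of the square root \<open>R\<close> of the sum of the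
  \<open>|b j|\<^sup>2\<close>, the Cauchy--Schwarz inequality over \<open>j\<close> bounds the contribution of each eigenprojection
  by \<open>c\<close> times the corresponding eigenvalue of \<open>R\<close>.
\<close>

lemma duality:
  assumes b: "\<And>j. j \<in> J \<Longrightarrow> b j \<in> corner N"
    and a: "psd (c\<^sup>2 *\<^sub>R unit_upto N - (\<Sum>j\<in>J. star (a j) * a j))" and c: "0 \<le> c"
  shows "(\<Sum>j\<in>J. inner (a j) (b j)) \<le> c * inner (unit_upto N) (psd_root N (\<Sum>j\<in>J. star (b j) * b j))"
proof -
  define S where "S = (\<Sum>j\<in>J. star (b j) * b j)"
  define R where "R = psd_root N S"
  have "is_psd_root N S R" unfolding R_def
    by (rule psd_root) (auto simp: S_def b intro!: corner_closed star_corner psd_sum psd_star_mult)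
  then have R: "R \<in> corner N" "star R = R" "psd R" "R * R = S" by (auto simp: is_psd_root_def)
  obtain k e l where s: "resolution N k e" "R = spectral_sum k e l" "\<And>i. i < k \<Longrightarrow> 0 \<le> l i"
    using spectral_psd[OF R(1-3)] by metis
  have e: "e i \<in> corner N" "star (e i) = e i" "e i * e i = e i" if "i < k" for i
    using s(1) that by (auto simp: resolution_def)
  have Re: "R * e i = l i *\<^sub>R e i" if "i < k" for i
    using s(1) that unfolding s(2) spectral_sum_def resolution_def
    by (simp add: sum_distrib_right sum.delta if_distrib[of "\<lambda>a. _ *\<^sub>R a"] cong: if_cong)
  have split: "inner (a j) (b j) = (\<Sum>i<k. inner (a j * e i) (b j * e i))" if "j \<in> J" for j
  proof -
    have "b j = b j * (\<Sum>i<k. e i)"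
      using s(1) b[OF that] by (simp add: resolution_def)
    then have "inner (a j) (b j) = (\<Sum>i<k. inner (a j) (b j * e i))"
      by (metis inner_sum_right sum_distrib_left)
    also have "\<dots> = (\<Sum>i<k. inner (a j * e i) (b j * e i))"
    proof (intro sum.cong refl)
      fix i assume "i \<in> {..<k}"
      then have i: "i < k" by simp
      have "inner (a j) (b j * e i) = inner (a j) ((b j * e i) * e i)"
        using e[OF i] by (simp add: mult.assoc)
      also have "\<dots> = inner (a j * e i) (b j * e i)"
        by (subst inner_mult_adjoint_right) (simp add: e[OF i])
      finally show "inner (a j) (b j * e i) = inner (a j * e i) (b j * e i)" .
    qed
    finally show ?thesis .
  qed
  have nrm: "(norm (y * e i))\<^sup>2 = inner (e i) (star y * y * e i)" for y i
    by (simp add: power2_norm_eq_inner mult.assoc inner_mult_adjoint_left[of _ "star y"])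
  have bnd: "(\<Sum>j\<in>J. inner (a j * e i) (b j * e i)) \<le> c * (l i * (norm (e i))\<^sup>2)" if i: "i < k" for i
  proof -
    have "(\<Sum>j\<in>J. (norm (b j * e i))\<^sup>2) = inner (e i) (S * e i)"
      by (simp add: nrm S_def sum_distrib_right inner_sum_right)
    also have "\<dots> = (l i * norm (e i))\<^sup>2"
      by (simp add: R(4)[symmetric] mult.assoc Re[OF i] power2_norm_eq_inner power_mult_distrib power2_eq_square[of "l i"])
    finally have B: "(\<Sum>j\<in>J. (norm (b j * e i))\<^sup>2) = (l i * norm (e i))\<^sup>2" .
    have "0 \<le> inner (e i) ((c\<^sup>2 *\<^sub>R unit_upto N - (\<Sum>j\<in>J. star (a j) * a j)) * e i)"
      using a by (simp add: psd_def)
    also have "\<dots> = (c * norm (e i))\<^sup>2 - (\<Sum>j\<in>J. (norm (a j * e i))\<^sup>2)"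
      by (simp add: nrm left_diff_distrib inner_diff_right sum_distrib_right inner_sum_right
          e[OF i] power_mult_distrib power2_norm_eq_inner[of "e i"])
    finally have A: "(\<Sum>j\<in>J. (norm (a j * e i))\<^sup>2) \<le> (c * norm (e i))\<^sup>2" by simp
    have "(\<Sum>j\<in>J. inner (a j * e i) (b j * e i)) \<le> (\<Sum>j\<in>J. \<bar>norm (a j * e i)\<bar> * \<bar>norm (b j * e i)\<bar>)"
      by (intro sum_mono) (simp add: norm_cauchy_schwarz)
    also have "\<dots> \<le> L2_set (\<lambda>j. norm (a j * e i)) J * L2_set (\<lambda>j. norm (b j * e i)) J"
      by (rule L2_set_mult_ineq)
    also have "\<dots> \<le> (c * norm (e i)) * (l i * norm (e i))"
      unfolding L2_set_def B
      using A c s(3)[OF i] by (intro mult_mono) (auto intro!: real_le_lsqrt sum_nonneg)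
    finally show ?thesis by (simp add: power2_eq_square mult_ac)
  qed
  have "(\<Sum>j\<in>J. inner (a j) (b j)) = (\<Sum>i<k. \<Sum>j\<in>J. inner (a j * e i) (b j * e i))"
    by (simp add: split sum.swap[of _ J])
  also have "\<dots> \<le> (\<Sum>i<k. c * (l i * (norm (e i))\<^sup>2))"
    by (intro sum_mono bnd) auto
  also have "\<dots> = c * inner (unit_upto N) R"
    by (simp add: s(2) spectral_sum_trace[OF s(1)] sum_distrib_left)
  finally show ?thesis by (simp add: R_def S_def)
qed

lemma hermitian_abs:
  assumes g: "g \<in> corner N" "star g = g"
  obtains k e l where "resolution N k e" "g = spectral_sum k e l" "psd_root N (star g * g) = spectral_sum k e (\<lambda>i. \<bar>l i\<bar>)"
proof -
  obtain k e l where s: "resolution N k e" "g = spectral_sum k e l"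
    using spectral[OF g] unfolding spectral_sum_def by metis
  have "is_psd_root N (star g * g) (spectral_sum k e (\<lambda>i. \<bar>l i\<bar>))"
    unfolding is_psd_root_def g(2) using s by (auto simp: spectral_sum_star spectral_sum_corner spectral_sum_mult intro!: spectral_sum_psd)
  from that[OF s psd_root_eq[OF this]] show thesis .
qed

text \<open>
  The sign of \<open>g\<close> is a contraction that attains the trace norm; \<open>duality\<close> for a one-element index set
  is the converse bound.
\<close>

lemma trace_norm_attained:
  assumes g: "g \<in> corner N" "star g = g"
  obtains s where "s \<in> corner N" "star s = s" "psd (unit_upto N - star s * s)" "inner s g = trace_norm N g"
proof -
  obtain k e l where s: "resolution N k e" "g = spectral_sum k e l" "psd_root N (star g * g) = spectral_sum k e (\<lambda>i. \<bar>l i\<bar>)"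
    using hermitian_abs[OF g] by blast
  define u where "u = spectral_sum k e (\<lambda>i. sgn (l i))"
  have "unit_upto N - star u * u = spectral_sum k e (\<lambda>i. 1 - sgn (l i) * sgn (l i))"
    unfolding u_def spectral_sum_star[OF s(1)] spectral_sum_mult[OF s(1)] spectral_sum_1[OF s(1), symmetric]
    by (simp add: spectral_sum_def sum_subtractf algebra_simps)
  moreover have "psd (spectral_sum k e (\<lambda>i. 1 - sgn (l i) * sgn (l i)))"
    by (rule spectral_sum_psd[OF s(1)]) (simp add: sgn_if)
  moreover have "inner u g = trace_norm N g"
    unfolding trace_norm_def s(3) spectral_sum_trace[OF s(1)] unfolding u_def s(2) spectral_sum_inner[OF s(1)]
    by (intro sum.cong refl) (simp add: sgn_if)
  ultimately show thesis
    using that[of u] spectral_sum_corner[OF s(1)] spectral_sum_star[OF s(1)] by (simp add: u_def)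
qed

text \<open>
  A substitute for Hoelder's inequality with exponents \<open>4/3\<close> and \<open>4\<close> followed by the interpolation of
  \<open>L\<^sub>4\<^sub>/\<^sub>3\<close> between \<open>L\<^sub>1\<close> and \<open>L\<^sub>2\<close>: writing \<open>g = |g|\<^sup>1\<^sup>/\<^sup>2 sgn(g) |g|\<^sup>1\<^sup>/\<^sup>2\<close>, one application of the
  Cauchy--Schwarz inequality leaves \<open>\<parallel>g\<parallel>\<^sub>1\<close> and the pairing of \<open>|g|\<close> with \<open>h h\<^sup>*\<close>.
\<close>

lemma inner_trace_norm_bound:
  assumes g: "g \<in> corner N" "star g = g"
  shows "(inner g h)\<^sup>2 \<le> trace_norm N g * norm g * norm (star h * h)"
proof -
  obtain k e l where s: "resolution N k e" "g = spectral_sum k e l" "psd_root N (star g * g) = spectral_sum k e (\<lambda>i. \<bar>l i\<bar>)"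
    using hermitian_abs[OF g] by blast
  define r where "r = spectral_sum k e (\<lambda>i. sqrt \<bar>l i\<bar>)"
  define u where "u = spectral_sum k e (\<lambda>i. sgn (l i) * sqrt \<bar>l i\<bar>)"
  define A where "A = spectral_sum k e (\<lambda>i. \<bar>l i\<bar>)"
  have gru: "g = r * u"
    unfolding r_def u_def s(2) spectral_sum_mult[OF s(1)] by (intro spectral_sum_cong) (simp add: sgn_if real_sqrt_mult_self mult.left_commute)
  have rr: "star r * r = A"
    unfolding r_def A_def spectral_sum_star[OF s(1)] spectral_sum_mult[OF s(1)] by (intro spectral_sum_cong) simp
  have nA: "norm A = norm g"
    unfolding norm_eq_sqrt_inner A_def s(2) spectral_sum_inner[OF s(1)] by (simp add: abs_mult_self_eq)
  have nu: "(norm u)\<^sup>2 \<le> trace_norm N g"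
    unfolding trace_norm_def s(3) unfolding power2_norm_eq_inner u_def spectral_sum_inner[OF s(1)] spectral_sum_trace[OF s(1)]
    by (intro sum_mono mult_right_mono) (auto simp: sgn_if)
  have "(norm (r * h))\<^sup>2 = inner h (A * h)"
    unfolding power2_norm_eq_inner rr[symmetric] by (simp add: mult.assoc inner_mult_adjoint_left[of h "star r"])
  also have "\<dots> = inner (h * star h) A" by (rule inner_mult_adjoint_right)
  also have "\<dots> \<le> norm (star h * h) * norm g"
    using norm_cauchy_schwarz[of "h * star h" A] by (simp add: norm_mult_star nA)
  finally have nrh: "(norm (r * h))\<^sup>2 \<le> norm (star h * h) * norm g" .
  have "inner g h = inner h (r * u)" by (simp add: gru inner_commute)
  also have "\<dots> = inner (star r * h) u" by (rule inner_mult_adjoint_left)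
  also have "star r = r" by (simp add: r_def spectral_sum_star[OF s(1)])
  finally have "(inner g h)\<^sup>2 = (inner (r * h) u)\<^sup>2" by simp
  also have "\<dots> \<le> (norm (r * h))\<^sup>2 * (norm u)\<^sup>2"
    using Cauchy_Schwarz_ineq[of "r * h" u] by (simp add: power2_norm_eq_inner)
  also have "\<dots> \<le> (norm (star h * h) * norm g) * trace_norm N g"
    by (intro mult_mono nrh nu) auto
  finally show ?thesis by (simp add: mult_ac)
qed

text \<open>
  By duality, since the noise is self-adjoint and maps contractions to contractions.
\<close>

lemma (in expectations) trace_norm_noise_le:
  assumes corner: "\<And>b x. b < k \<Longrightarrow> x \<in> corner N \<Longrightarrow> E b x \<in> corner N" and unit: "\<And>b. b < k \<Longrightarrow> E b (unit_upto N) = unit_upto N"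
    and g: "g \<in> corner N" "star g = g" and r: "0 \<le> r" "r \<le> 1"
  shows "trace_norm N (noise r k g) \<le> trace_norm N g"
proof -
  have PI: "noise r k (unit_upto N) = unit_upto N" using unit
    by (induction k) (auto simp: damp_def simp flip: scaleR_add_left)
  have "noise r k g \<in> corner N" using corner
    by (induction k) (auto simp: damp_def g intro!: corner_closed)
  then obtain s where s: "s \<in> corner N" "star s = s" "psd (unit_upto N - star s * s)" "inner s (noise r k g) = trace_norm N (noise r k g)"
    using trace_norm_attained[of "noise r k g" N] by (metis noise_star g(2))
  have "psd (noise r k (unit_upto N - star s * s) + (noise r k (star s * s) - star (noise r k s) * noise r k s))"
    by (intro psd_add noise_pos s kadison_schwarz_noise r)
  then have "psd (1\<^sup>2 *\<^sub>R unit_upto N - (\<Sum>j\<in>{()}. star (noise r k s) * noise r k s))" by (simp add: noise_lin PI)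
  from duality[OF _ this, of "\<lambda>_. g"] have "inner (noise r k s) g \<le> trace_norm N g"
    by (simp add: g trace_norm_def)
  then show ?thesis using s(4) by (simp add: noise_adj)
qed

section \<open>Qubits\<close>

lemma flip_flip [simp]: "flip_bit b (flip_bit b i) = (i::nat)"
  by (rule bit_eqI) (auto simp: bit_simps)

lemma flip_commute: "flip_bit b (flip_bit c i) = flip_bit c (flip_bit b (i::nat))"
  by (rule bit_eqI) (auto simp: bit_simps)

lemma bit_flip [simp]: "bit (flip_bit b (i::nat)) c \<longleftrightarrow> (b = c) \<noteq> bit i c"
  by (auto simp: bit_simps)

lemma less_exp_iff_bits: "(i::nat) < 2 ^ n \<longleftrightarrow> (\<forall>b\<ge>n. \<not> bit i b)"
proof
  assume "i < 2 ^ n"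
  then show "\<forall>b\<ge>n. \<not> bit i b"
    by (metis bit_take_bit_iff linorder_not_less take_bit_nat_eq_self)
next
  assume "\<forall>b\<ge>n. \<not> bit i b"
  then have "take_bit n i = i" by (intro bit_eqI) (simp add: bit_take_bit_iff, meson not_le)
  then show "i < 2 ^ n" by (simp add: take_bit_nat_eq_self_iff)
qed

lemma flip_less_iff [simp]: "b < n \<Longrightarrow> flip_bit b i < 2 ^ n \<longleftrightarrow> (i::nat) < 2 ^ n"
  by (auto simp: less_exp_iff_bits)

lemma flip_ge_iff [simp]: "b < n \<Longrightarrow> 2 ^ n \<le> flip_bit b i \<longleftrightarrow> 2 ^ n \<le> (i::nat)"
  by (simp add: linorder_not_less[symmetric])

lemma bij_flip: "b < n \<Longrightarrow> bij_betw (flip_bit b) {..<2 ^ n} {..<2 ^ n :: nat}"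
  by (rule bij_betw_byWitness[where f' = "flip_bit b"]) auto

lemma ex_dyadic: "\<exists>n>b. x \<in> corner (2 ^ n)"
proof -
  have "support_bound x \<le> 2 ^ (b + support_bound x + 1)"
    by (metis add.commute add_leD1 le_add1 le_trans less_exp less_imp_le one_le_numeral power_increasing)
  then show ?thesis by (intro exI[of _ "b + support_bound x + 1"]) (auto intro: corner_mono[OF support_bound])
qed

lemma ex_dyadic2: "\<exists>n>b. x \<in> corner (2 ^ n) \<and> y \<in> corner (2 ^ n)"
proof -
  obtain n m where "n > b" "x \<in> corner (2 ^ n)" "m > b" "y \<in> corner (2 ^ m)"
    using ex_dyadic by meson
  then show ?thesis
    by (intro exI[of _ "max n m"]) (auto intro: corner_mono[OF _ power_increasing])
qed

definition bit_sign :: "nat \<Rightarrow> nat \<Rightarrow> complex" where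
  "bit_sign b i = (if bit i b then - 1 else 1)"

lemma bit_sign_sq [simp]: "bit_sign b i * bit_sign b i = 1" "bit_sign b i * (bit_sign b i * z) = z" and cnj_bit_sign [simp]: "cnj (bit_sign b i) = bit_sign b i"
  by (simp_all add: bit_sign_def)

lemma bit_sign_flip: "bit_sign b (flip_bit c i) = (if b = c then - bit_sign b i else bit_sign b i)"
  by (simp add: bit_sign_def)

text \<open>
  Conjugation by, and left multiplication with, the Pauli matrices \<open>X\<close> and \<open>Z\<close> on qubit \<open>b\<close>, where
  qubit \<open>b\<close> is the binary digit of weight \<open>2\<^sup>b\<close> of a row or column index.  They are maps of the whole
  ring, so that no reference to the number of qubits is needed.
\<close>

definition conj_X :: "nat \<Rightarrow> fmat \<Rightarrow> fmat" where
  "conj_X b x = Fmat (\<lambda>i j. ent x (flip_bit b i) (flip_bit b j))"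

definition conj_Z :: "nat \<Rightarrow> fmat \<Rightarrow> fmat" where
  "conj_Z b x = Fmat (\<lambda>i j. bit_sign b i * bit_sign b j * ent x i j)"

definition left_X :: "nat \<Rightarrow> fmat \<Rightarrow> fmat" where
  "left_X b x = Fmat (\<lambda>i j. ent x (flip_bit b i) j)"

definition left_Z :: "nat \<Rightarrow> fmat \<Rightarrow> fmat" where
  "left_Z b x = Fmat (\<lambda>i j. bit_sign b i * ent x i j)"

lemma ent_conj_X [simp]: "ent (conj_X b x) i j = ent x (flip_bit b i) (flip_bit b j)"
proof -
  obtain n where "n > b" "x \<in> corner (2 ^ n)" using ex_dyadic by meson
  then show ?thesis unfolding conj_X_def by (subst ent_Fmat[where N = "2 ^ n"]) (auto simp: cornerD)
qed

lemma ent_conj_Z [simp]: "ent (conj_Z b x) i j = bit_sign b i * bit_sign b j * ent x i j"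
  unfolding conj_Z_def by (subst ent_Fmat[where N = "support_bound x"]) (auto simp: cornerD[OF support_bound])

lemma ent_left_X [simp]: "ent (left_X b x) i j = ent x (flip_bit b i) j"
proof -
  obtain n where "n > b" "x \<in> corner (2 ^ n)" using ex_dyadic by meson
  then show ?thesis unfolding left_X_def by (subst ent_Fmat[where N = "2 ^ n"]) (auto simp: cornerD)
qed

lemma ent_left_Z [simp]: "ent (left_Z b x) i j = bit_sign b i * ent x i j"
  unfolding left_Z_def by (subst ent_Fmat[where N = "support_bound x"]) (auto simp: cornerD[OF support_bound])

lemma corner_conj_X: "x \<in> corner (2 ^ n) \<Longrightarrow> b < n \<Longrightarrow> conj_X b x \<in> corner (2 ^ n)"
  and corner_left_X: "x \<in> corner (2 ^ n) \<Longrightarrow> b < n \<Longrightarrow> left_X b x \<in> corner (2 ^ n)"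
  by (rule cornerI, auto simp: cornerD)+

lemma corner_conj_Z: "x \<in> corner N \<Longrightarrow> conj_Z b x \<in> corner N"
  and corner_left_Z: "x \<in> corner N \<Longrightarrow> left_Z b x \<in> corner N"
  by (rule cornerI, auto simp: cornerD)+

text \<open>
  Trace-preserving involutive automorphisms, such as the conjugation by a Pauli matrix.  They grade
  the algebra into even and odd elements.
\<close>

locale involution =
  fixes \<alpha> :: "fmat \<Rightarrow> fmat"
  assumes lin: "linear \<alpha>"
    and mult: "\<alpha> (x * y) = \<alpha> x * \<alpha> y"
    and star: "\<alpha> (star x) = star (\<alpha> x)"
    and inner: "inner (\<alpha> x) (\<alpha> y) = inner x y"
    and invol [simp]: "\<alpha> (\<alpha> x) = x"
begin

lemmas lin_simps = linear_add[OF lin] linear_diff[OF lin] linear_scale[OF lin] linear_0[OF lin] linear_neg[OF lin]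

lemma adj: "inner (\<alpha> x) y = inner x (\<alpha> y)"
  by (metis inner invol)

lemma psd: "psd x \<Longrightarrow> psd (\<alpha> x)"
  unfolding psd_def by (metis adj mult invol)

definition even_part :: "fmat \<Rightarrow> fmat" where "even_part x = (1/2) *\<^sub>R (x + \<alpha> x)"
definition odd_part :: "fmat \<Rightarrow> fmat" where "odd_part x = (1/2) *\<^sub>R (x - \<alpha> x)"

lemma even_plus_odd: "even_part x + odd_part x = x"
  by (simp add: even_part_def odd_part_def algebra_simps flip: scaleR_add_left)

lemma invol_even [simp]: "\<alpha> (even_part x) = even_part x" and invol_odd [simp]: "\<alpha> (odd_part x) = - odd_part x"
  by (simp_all add: even_part_def odd_part_def lin_simps algebra_simps)

lemma orth: "\<alpha> x = x \<Longrightarrow> \<alpha> y = - y \<Longrightarrow> inner x y = 0"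
  using inner[of x y] by simp

lemma norm_even_odd: "(norm (even_part x))\<^sup>2 + (norm (odd_part x))\<^sup>2 = (norm x)\<^sup>2"
proof -
  have "inner (even_part x) (odd_part x) = 0" by (rule orth) auto
  then have "(norm (even_part x + odd_part x))\<^sup>2 = (norm (even_part x))\<^sup>2 + (norm (odd_part x))\<^sup>2"
    by (simp add: power2_norm_eq_inner inner_add_left inner_add_right inner_commute)
  then show ?thesis by (simp add: even_plus_odd)
qed

end

text \<open>
  The square of the unnormalized Schatten 4-norm.
\<close>

definition l4_sq :: "fmat \<Rightarrow> real" where "l4_sq x = norm (star x * x)"

lemma l4_sq_scaleR: "l4_sq (c *\<^sub>R x) = c\<^sup>2 * l4_sq x"
  by (simp add: l4_sq_def power2_eq_square)

lemma l4_sq_nonneg [simp]: "0 \<le> l4_sq x"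
  by (simp add: l4_sq_def)

lemma norm_star_mult_le: "(norm (star x * y))\<^sup>2 \<le> l4_sq x * l4_sq y"
proof -
  have "inner (star x * y) (star x * y) = inner (x * star x * y) y"
    by (simp add: inner_mult_adjoint_left mult.assoc)
  also have "\<dots> = inner (x * star x) (y * star y)"
    using inner_mult_adjoint_right[of y "x * star x" y] by (simp add: inner_commute)
  also have "\<dots> \<le> norm (x * star x) * norm (y * star y)" by (rule norm_cauchy_schwarz)
  finally show ?thesis by (simp add: power2_norm_eq_inner norm_mult_star l4_sq_def)
qed

text \<open>
  The two-point inequality behind hypercontractivity.  The square of \<open>|x + y|\<close> is the sum of an even
  part \<open>A\<close> and an odd part \<open>B\<close>; these are orthogonal, and \<open>B\<close> only contains mixed products of \<open>x\<close> and
  \<open>y\<close>.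
\<close>

lemma (in involution) l4_sq_add_le:
  assumes "\<alpha> x = x" "\<alpha> y = - y"
  shows "l4_sq (x + y) \<le> l4_sq x + 3 * l4_sq y"
proof -
  define A where "A = star x * x + star y * y"
  define B where "B = star x * y + star y * x"
  have "\<alpha> A = A" "\<alpha> B = - B"
    by (simp_all add: A_def B_def lin_simps mult star assms)
  then have "inner A B = 0" by (rule orth)
  then have "(norm (A + B))\<^sup>2 = (norm A)\<^sup>2 + (norm B)\<^sup>2"
    by (simp add: power2_norm_eq_inner inner_add_left inner_add_right inner_commute)
  moreover have "star (x + y) * (x + y) = A + B"
    by (simp add: A_def B_def algebra_simps)
  ultimately have eq: "(l4_sq (x + y))\<^sup>2 = (norm A)\<^sup>2 + (norm B)\<^sup>2" by (simp add: l4_sq_def)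
  have "norm A \<le> l4_sq x + l4_sq y" unfolding A_def l4_sq_def by (rule norm_triangle_ineq)
  then have A: "(norm A)\<^sup>2 \<le> (l4_sq x + l4_sq y)\<^sup>2" by (intro power_mono) auto
  have yx: "norm (star y * x) = norm (star x * y)"
    by (metis norm_star star_mult star_star)
  have "norm B \<le> 2 * norm (star x * y)"
    unfolding B_def using norm_triangle_ineq[of "star x * y" "star y * x"] yx by simp
  then have "(norm B)\<^sup>2 \<le> (2 * norm (star x * y))\<^sup>2" by (intro power_mono) auto
  also have "\<dots> \<le> 4 * (l4_sq x * l4_sq y)"
    using norm_star_mult_le[of x y] by (simp add: power_mult_distrib)
  finally have "(l4_sq (x + y))\<^sup>2 \<le> (l4_sq x + l4_sq y)\<^sup>2 + 4 * (l4_sq x * l4_sq y)" using A eq by linarith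
  also have "\<dots> \<le> (l4_sq x + 3 * l4_sq y)\<^sup>2"
    by (simp add: power2_eq_square algebra_simps)
  finally show ?thesis by (rule power2_le_imp_le) simp
qed

interpretation X: involution "conj_X b" for b
proof (rule involution.intro)
  fix x y :: fmat
  obtain n where n: "n > b" "x \<in> corner (2 ^ n)" "y \<in> corner (2 ^ n)" using ex_dyadic2 by meson
  note re = sum.reindex_bij_betw[OF bij_flip[OF n(1)], symmetric]
  show "linear (conj_X b)" by (rule linearI) (auto intro!: fmat_eqI)
  show "conj_X b (star x) = star (conj_X b x)" by (rule fmat_eqI) simp
  show "conj_X b (conj_X b x) = x" by (rule fmat_eqI) simp
  show "conj_X b (x * y) = conj_X b x * conj_X b y"
    by (rule fmat_eqI)
       (simp add: ent_mult_left[OF n(2)] ent_mult_left[OF corner_conj_X[OF n(2,1)]], subst re, simp)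
  show "inner (conj_X b x) (conj_X b y) = inner x y"
    unfolding inner_left[OF n(2)] inner_left[OF corner_conj_X[OF n(2,1)]]
    by (subst (3) re, subst (4) re) (simp del: Re_sum)
qed

interpretation Z: involution "conj_Z b" for b
proof (rule involution.intro)
  fix x y :: fmat
  obtain N where N: "x \<in> corner N" using ex_corner by blast
  show "linear (conj_Z b)" by (rule linearI) (auto intro!: fmat_eqI simp: algebra_simps)
  show "conj_Z b (star x) = star (conj_Z b x)" by (rule fmat_eqI) simp
  show "conj_Z b (conj_Z b x) = x" by (rule fmat_eqI) (simp add: bit_sign_def)
  show "conj_Z b (x * y) = conj_Z b x * conj_Z b y"
    by (rule fmat_eqI)
       (auto simp: ent_mult_left[OF N] ent_mult_left[OF corner_conj_Z[OF N]] sum_distrib_left bit_sign_def intro!: sum.cong)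
  show "inner (conj_Z b x) (conj_Z b y) = inner x y"
    unfolding inner_left[OF N] inner_left[OF corner_conj_Z[OF N]]
    by (intro arg_cong[where f = Re] sum.cong refl) (simp add: bit_sign_def)
qed

lemma conj_X_conj_X: "conj_X b (conj_X c x) = conj_X c (conj_X b x)"
  and conj_X_conj_Z: "conj_X b (conj_Z c x) = conj_Z c (conj_X b x)"
  and conj_Z_conj_Z: "conj_Z b (conj_Z c x) = conj_Z c (conj_Z b x)"
  by (rule fmat_eqI, auto simp: flip_commute bit_sign_flip mult_ac)+

lemma conj_X_left_X: "conj_X b (left_X c x) = left_X c (conj_X b x)"
  and conj_Z_left_X: "conj_Z b (left_X c x) = (if b = c then - left_X c (conj_Z b x) else left_X c (conj_Z b x))"
  and conj_X_left_Z: "conj_X b (left_Z c x) = (if b = c then - left_Z c (conj_X b x) else left_Z c (conj_X b x))"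
  and conj_Z_left_Z: "conj_Z b (left_Z c x) = left_Z c (conj_Z b x)"
  by (rule fmat_eqI, auto simp: flip_commute bit_sign_flip mult_ac)+

lemma linear_left_X: "linear (left_X b)" and linear_left_Z: "linear (left_Z b)"
  by (rule linearI, auto intro!: fmat_eqI simp: algebra_simps)+

lemma star_left_Z_mult: "star (left_Z b x) * left_Z b y = star x * y"
proof -
  obtain N where N: "x \<in> corner N" using ex_corner by blast
  show ?thesis
    by (rule fmat_eqI)
       (auto simp: ent_mult_left[OF star_corner[OF N]] ent_mult_left[OF star_corner[OF corner_left_Z[OF N]]] 
         bit_sign_def intro!: sum.cong)
qed

lemma star_left_X_mult: "star (left_X b x) * left_X b y = star x * y"
proof -
  obtain n where n: "n > b" "x \<in> corner (2 ^ n)" using ex_dyadic by meson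
  note re = sum.reindex_bij_betw[OF bij_flip[OF n(1)], symmetric]
  show ?thesis
    by (rule fmat_eqI)
       (simp add: ent_mult_left[OF star_corner[OF n(2)]] ent_mult_left[OF star_corner[OF corner_left_X[OF n(2,1)]]],
         subst (2) re, simp)
qed

lemma l4_sq_left_X [simp]: "l4_sq (left_X b x) = l4_sq x" and l4_sq_left_Z [simp]: "l4_sq (left_Z b x) = l4_sq x"
  by (simp_all add: l4_sq_def star_left_X_mult star_left_Z_mult)

lemma norm_left_X [simp]: "norm (left_X b x) = norm x"
proof -
  obtain n where n: "n > b" "x \<in> corner (2 ^ n)" using ex_dyadic by meson
  note re = sum.reindex_bij_betw[OF bij_flip[OF n(1)], symmetric]
  have "inner (left_X b x) (left_X b x) = inner x x"
    unfolding inner_left[OF n(2)] inner_left[OF corner_left_X[OF n(2,1)]]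
    by (subst (3) re) (simp del: Re_sum)
  then show ?thesis by (simp add: norm_eq_sqrt_inner)
qed

lemma norm_left_Z [simp]: "norm (left_Z b x) = norm x"
proof -
  obtain N where N: "x \<in> corner N" using ex_corner by blast
  have "inner (left_Z b x) (left_Z b x) = inner x x"
    unfolding inner_left[OF N] inner_left[OF corner_left_Z[OF N]]
    by (intro arg_cong[where f = Re] sum.cong refl) (simp add: bit_sign_def)
  then show ?thesis by (simp add: norm_eq_sqrt_inner)
qed

text \<open>
  Averaging over the conjugations by \<open>1\<close>, \<open>X\<close>, \<open>Z\<close> and \<open>X Z\<close> is the normalized partial trace over
  qubit \<open>b\<close>, tensored with the unit.
\<close>

definition average :: "nat \<Rightarrow> fmat \<Rightarrow> fmat" where
  "average b x = (1/4) *\<^sub>R (x + conj_X b x + conj_Z b x + conj_X b (conj_Z b x))"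

lemma ent_average: "ent (average b x) i j =
    (if bit i b = bit j b then (ent x i j + ent x (flip_bit b i) (flip_bit b j)) / 2 else 0)"
  by (simp add: average_def bit_sign_def scaleR_conv_of_real)

lemma conj_X_average [simp]: "conj_X b (average b x) = average b x" and conj_Z_average [simp]: "conj_Z b (average b x) = average b x"
  by (rule fmat_eqI, auto simp: ent_average bit_sign_def algebra_simps)+

interpretation qubit: expectations average
proof (rule expectations.intro)
  fix b c x y
  show "linear (average b)"
    by (rule linearI) (auto simp: average_def X.lin_simps Z.lin_simps algebra_simps)
  show "average b (average b x) = average b x"
    by (rule fmat_eqI) (auto simp: ent_average field_simps)
  show "average b (star x) = star (average b x)"
    by (rule fmat_eqI) (auto simp: ent_average)
  show "inner (average b x) y = inner x (average b y)"
    by (simp add: average_def inner_add_left inner_add_right X.adj Z.adj conj_X_conj_Z)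
  show "average b (average b x * y) = average b x * average b y"
    by (simp add: average_def[of b "average b x * y"] X.mult Z.mult) (simp add: average_def[of b y] algebra_simps)
  show "psd x \<Longrightarrow> psd (average b x)"
    unfolding average_def by (intro psd_scaleR psd_add X.psd Z.psd) auto
  show "average b (average c x) = average c (average b x)"
    by (simp add: average_def X.lin_simps Z.lin_simps conj_X_conj_X[of b c] conj_Z_conj_Z[of b c] conj_X_conj_Z algebra_simps)
qed

lemma average_corner: "x \<in> corner (2 ^ n) \<Longrightarrow> b < n \<Longrightarrow> average b x \<in> corner (2 ^ n)"
  unfolding average_def by (intro corner_closed corner_conj_X corner_conj_Z)

lemma average_unit_upto: "b < n \<Longrightarrow> average b (unit_upto (2 ^ n)) = unit_upto (2 ^ n)"
  by (rule fmat_eqI) (auto simp: ent_average dest: arg_cong[where f = "flip_bit b"])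

abbreviation "qubit_noise \<equiv> qubit.noise"
abbreviation "qubit_damp \<equiv> qubit.damp"

lemma commute_noise:
  assumes "linear f" "\<And>c y. c < k \<Longrightarrow> average c (f y) = f (average c y)"
  shows "qubit_noise r k (f x) = f (qubit_noise r k x)"
  using assms(2)
  by (induction k) (auto simp: qubit.damp_def linear_add[OF assms(1)] linear_scale[OF assms(1)])

lemma conj_X_noise: "qubit_noise r k (conj_X b x) = conj_X b (qubit_noise r k x)" and conj_Z_noise: "qubit_noise r k (conj_Z b x) = conj_Z b (qubit_noise r k x)"
  by (rule commute_noise, rule X.lin Z.lin,
      simp add: average_def X.lin_simps Z.lin_simps conj_X_conj_X[of b] conj_Z_conj_Z[of b] conj_X_conj_Z)+

lemma left_X_noise: "k \<le> b \<Longrightarrow> qubit_noise r k (left_X b x) = left_X b (qubit_noise r k x)"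
  by (rule commute_noise, rule linear_left_X)
     (simp add: average_def linear_add[OF linear_left_X] linear_scale[OF linear_left_X] conj_X_left_X conj_Z_left_X)

lemma left_Z_noise: "k \<le> b \<Longrightarrow> qubit_noise r k (left_Z b x) = left_Z b (qubit_noise r k x)"
  by (rule commute_noise, rule linear_left_Z)
     (simp add: average_def linear_add[OF linear_left_Z] linear_scale[OF linear_left_Z] conj_X_left_Z conj_Z_left_Z)


section \<open>Hypercontractivity\<close>

text \<open>
  Invariance under all sign changes forces the matrix to be diagonal, and invariance under all bit flips
  makes the diagonal constant.
\<close>

lemma invariant_scalar:
  assumes x: "x \<in> corner (2 ^ n)" and X: "\<And>b. b < n \<Longrightarrow> conj_X b x = x" and Z: "\<And>b. b < n \<Longrightarrow> conj_Z b x = x"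
  shows "ent x i j = (if i = j \<and> i < 2 ^ n then ent x 0 0 else 0)"
proof -
  have off: "ent x i j = 0" if "i \<noteq> j" "i < 2 ^ n" "j < 2 ^ n"
  proof -
    obtain b where b: "bit i b \<noteq> bit j b" using \<open>i \<noteq> j\<close> by (metis bit_eq_iff)
    then have "b < n" using that by (metis less_exp_iff_bits not_le)
    from Z[OF this] have "ent x i j = bit_sign b i * bit_sign b j * ent x i j" by (metis ent_conj_Z)
    with b show ?thesis by (auto simp: bit_sign_def split: if_splits)
  qed
  have diag: "ent x i i = ent x 0 0" if "i < 2 ^ n" "k \<le> n" "\<forall>b\<ge>k. \<not> bit i b" for i k
    using that
  proof (induction k arbitrary: i)
    case 0
    then have "i = 0" by (intro bit_eqI) auto
    then show ?case by simp
  next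
    case (Suc k)
    have nb: "\<not> bit i b" if "b > k" for b using Suc.prems(3) that by (simp add: Suc_le_eq)
    have k: "k < n" using Suc.prems by simp
    show ?case
    proof (cases "bit i k")
      case True
      have "ent x i i = ent x (flip_bit k i) (flip_bit k i)"
        using X[of k] Suc.prems by (metis Suc_le_eq ent_conj_X)
      also have "\<dots> = ent x 0 0"
        using Suc.prems(1) k nb True by (intro Suc.IH) (auto simp: le_eq_less_or_eq)
      finally show ?thesis .
    next
      case False
      with Suc.prems show ?thesis
        using nb by (intro Suc.IH) (auto simp: le_eq_less_or_eq)
    qed
  qed
  have "ent x i i = ent x 0 0" if "i < 2 ^ n" for i
    using diag[of i n] that by (auto simp: less_exp_iff_bits)
  with off show ?thesis using cornerD[OF x] by (metis not_le)
qed

text \<open>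
  Induction on the number \<open>m\<close> of qubits on which \<open>x\<close> is not yet known to be trivial.  With respect to
  the conjugations by \<open>X\<close> and \<open>Z\<close> on qubit \<open>m\<close>, \<open>x\<close> has four homogeneous parts.  Left
  multiplication by a Pauli matrix makes each of them trivial on qubit \<open>m\<close> without changing its
  norms, so that the induction hypothesis applies, and \<open>l4_sq_add_le\<close>, used once for \<open>X\<close> and twice
  for \<open>Z\<close>, puts the parts together.  The parameter \<open>1/3\<close> is chosen such that its square compensates
  the largest factor \<open>3 * 3\<close>.
\<close>

lemma hypercontractive_aux:
  assumes "m \<le> n" "x \<in> corner (2 ^ n)"
    "\<And>b. m \<le> b \<Longrightarrow> b < n \<Longrightarrow> conj_X b x = x" "\<And>b. m \<le> b \<Longrightarrow> b < n \<Longrightarrow> conj_Z b x = x"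
  shows "l4_sq (qubit_noise (1/3) m x) * sqrt (2 ^ n) \<le> (norm x)\<^sup>2"
  using assms
proof (induction m arbitrary: x)
  case 0
  define c where "c = ent x 0 0"
  have x: "ent x i j = (if i = j \<and> i < 2 ^ n then c else 0)" for i j
    unfolding c_def using 0 by (intro invariant_scalar) auto
  have xx: "star x * x = (cmod c)\<^sup>2 *\<^sub>R unit_upto (2 ^ n)"
  proof (rule fmat_eqI)
    fix i j
    have "ent (star x * x) i j = (\<Sum>k<2^n. if k = i then (if i = j then cnj c * c else 0) else 0)"
      unfolding ent_mult_right[OF 0(2)] by (intro sum.cong) (auto simp: x)
    also have "\<dots> = ent ((cmod c)\<^sup>2 *\<^sub>R unit_upto (2 ^ n)) i j"
      by (auto simp: scaleR_conv_of_real complex_norm_square[symmetric] mult.commute[of "cnj c"] simp flip: of_real_power)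
    finally show "ent (star x * x) i j = ent ((cmod c)\<^sup>2 *\<^sub>R unit_upto (2 ^ n)) i j" .
  qed
  have nI: "norm (unit_upto (2 ^ n)) = sqrt (2 ^ n)"
    using norm_unit_upto[of "2 ^ n"] by (simp add: real_sqrt_unique)
  have "(norm x)\<^sup>2 = inner (star x * x) (unit_upto (2 ^ n))"
    using inner_mult_adjoint_left[of x x "unit_upto (2 ^ n)"] 0(2) by (simp add: power2_norm_eq_inner)
  also have "\<dots> = (cmod c)\<^sup>2 * 2 ^ n"
    using norm_unit_upto[of "2 ^ n"] by (simp add: xx power2_norm_eq_inner)
  finally show ?case
    by (simp add: l4_sq_def xx nI mult.assoc)
next
  case (Suc m)
  have m: "m < n" using Suc.prems by simp
  let ?P = "qubit_noise (1/3) m"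
  define u where "u = X.even_part m x"
  define v where "v = X.odd_part m x"
  define u0 where "u0 = Z.even_part m u"
  define u1 where "u1 = Z.odd_part m u"
  define v0 where "v0 = Z.even_part m v"
  define v1 where "v1 = Z.odd_part m v"
  note defs = u_def v_def u0_def u1_def v0_def v1_def
  have X: "conj_X m u0 = u0" "conj_X m u1 = u1" "conj_X m v0 = - v0" "conj_X m v1 = - v1"
    by (simp_all add: u0_def u1_def v0_def v1_def Z.even_part_def Z.odd_part_def X.lin_simps conj_X_conj_Z)
       (simp_all add: u_def v_def Z.lin_simps algebra_simps)
  have Z: "conj_Z m u0 = u0" "conj_Z m u1 = - u1" "conj_Z m v0 = v0" "conj_Z m v1 = - v1"
    by (simp_all add: defs(3-6))
  have x: "x = u0 + u1 + (v0 + v1)"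
    by (simp add: defs X.even_plus_odd Z.even_plus_odd)
  have E: "average m x = u0"
    by (simp add: average_def defs X.even_part_def Z.even_part_def Z.lin_simps conj_X_conj_Z algebra_simps flip: scaleR_add_left)
  have "qubit_noise (1/3) (Suc m) x = ?P (qubit_damp (1/3) m x)" by (simp add: qubit.damp_noise_commute)
  also have "qubit_damp (1/3) m x = u0 + (1/3) *\<^sub>R u1 + (1/3) *\<^sub>R (v0 + v1)"
    by (subst qubit.damp_def, subst E, subst x) (simp add: algebra_simps flip: scaleR_add_left)
  finally have Px: "qubit_noise (1/3) (Suc m) x
      = ?P u0 + (1/3) *\<^sub>R ?P u1 + (1/3) *\<^sub>R (?P v0 + ?P v1)"
    by (simp add: qubit.noise_lin)
  have XP: "conj_X m (?P u0) = ?P u0" "conj_X m (?P u1) = ?P u1" "conj_X m (?P v0) = - ?P v0" "conj_X m (?P v1) = - ?P v1"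
    by (simp_all add: conj_X_noise[symmetric] X linear_neg[OF qubit.linear_noise])
  have ZP: "conj_Z m (?P u0) = ?P u0" "conj_Z m (?P u1) = - ?P u1" "conj_Z m (?P v0) = ?P v0" "conj_Z m (?P v1) = - ?P v1"
    by (simp_all add: conj_Z_noise[symmetric] Z linear_neg[OF qubit.linear_noise])
  have "l4_sq (qubit_noise (1/3) (Suc m) x)
      \<le> l4_sq (?P u0 + (1/3) *\<^sub>R ?P u1) + 3 * l4_sq ((1/3) *\<^sub>R (?P v0 + ?P v1))"
    unfolding Px by (rule X.l4_sq_add_le[of m]) (simp_all add: X.lin_simps XP algebra_simps)
  also have "l4_sq (?P u0 + (1/3) *\<^sub>R ?P u1) \<le> l4_sq (?P u0) + 3 * l4_sq ((1/3) *\<^sub>R ?P u1)"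
    by (rule Z.l4_sq_add_le[of m]) (simp_all add: Z.lin_simps ZP)
  also have "3 * l4_sq ((1/3) *\<^sub>R ?P u1) \<le> l4_sq (?P u1)"
    by (simp add: l4_sq_scaleR power2_eq_square)
  also have "3 * l4_sq ((1/3) *\<^sub>R (?P v0 + ?P v1)) \<le> l4_sq (?P v0) + l4_sq (?P v1)"
  proof -
    have "l4_sq (?P v0 + ?P v1) \<le> l4_sq (?P v0) + 3 * l4_sq (?P v1)"
      by (rule Z.l4_sq_add_le[of m]) (simp_all add: ZP)
    moreover have "3 * l4_sq ((1/3) *\<^sub>R (?P v0 + ?P v1)) = l4_sq (?P v0 + ?P v1) / 3"
      by (simp add: l4_sq_scaleR power2_eq_square)
    ultimately show ?thesis using l4_sq_nonneg[of "?P v0"] by linarith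
  qed
  finally have main: "l4_sq (qubit_noise (1/3) (Suc m) x)
      \<le> l4_sq (?P u0) + l4_sq (?P u1) + (l4_sq (?P v0) + l4_sq (?P v1))" by simp
  have xc: "x \<in> corner (2 ^ n)" by (rule Suc.prems)
  have c: "u0 \<in> corner (2 ^ n)" "u1 \<in> corner (2 ^ n)" "v0 \<in> corner (2 ^ n)" "v1 \<in> corner (2 ^ n)"
    unfolding defs X.even_part_def X.odd_part_def Z.even_part_def Z.odd_part_def
    by (intro corner_closed corner_conj_X corner_conj_Z xc m)+
  have fixX: "conj_X b y = y" if "y \<in> {u0, u1, v0, v1}" "m < b" "b < n" for b y
  proof -
    have "conj_X b x = x" using that Suc.prems by simp
    then have "conj_X b u = u" "conj_X b v = v"
      by (simp_all add: defs X.even_part_def X.odd_part_def X.lin_simps conj_X_conj_X[of b])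
    then show ?thesis using that
      by (auto simp: defs(3-6) Z.even_part_def Z.odd_part_def X.lin_simps conj_X_conj_Z)
  qed
  have fixZ: "conj_Z b y = y" if "y \<in> {u0, u1, v0, v1}" "m < b" "b < n" for b y
  proof -
    have "conj_Z b x = x" using that Suc.prems by simp
    then have "conj_Z b u = u" "conj_Z b v = v"
      by (simp_all add: defs X.even_part_def X.odd_part_def Z.lin_simps conj_X_conj_Z[symmetric])
    then show ?thesis using that
      by (auto simp: defs(3-6) Z.even_part_def Z.odd_part_def Z.lin_simps conj_Z_conj_Z[of b])
  qed
  have neg: "left_X b (- y) = - left_X b y" "left_Z b (- y) = - left_Z b y" for b y
    by (rule linear_neg[OF linear_left_X] linear_neg[OF linear_left_Z])+
  have "l4_sq (?P u0) * sqrt (2 ^ n) \<le> (norm u0)\<^sup>2"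
    using X Z fixX[of u0] fixZ[of u0] c m by (intro Suc.IH) (auto simp: le_eq_less_or_eq)
  moreover have "l4_sq (?P (left_X m u1)) * sqrt (2 ^ n) \<le> (norm (left_X m u1))\<^sup>2"
    using X Z fixX[of u1] fixZ[of u1] c m
    by (intro Suc.IH corner_left_X) (auto simp: le_eq_less_or_eq conj_X_left_X conj_Z_left_X neg)
  moreover have "l4_sq (?P (left_Z m v0)) * sqrt (2 ^ n) \<le> (norm (left_Z m v0))\<^sup>2"
    using X Z fixX[of v0] fixZ[of v0] c m
    by (intro Suc.IH corner_left_Z) (auto simp: le_eq_less_or_eq conj_X_left_Z conj_Z_left_Z neg)
  moreover have "l4_sq (?P (left_X m (left_Z m v1))) * sqrt (2 ^ n) \<le> (norm (left_X m (left_Z m v1)))\<^sup>2"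
    using X Z fixX[of v1] fixZ[of v1] c m
    by (intro Suc.IH corner_left_X corner_left_Z) (auto simp: le_eq_less_or_eq conj_X_left_X conj_Z_left_X conj_X_left_Z conj_Z_left_Z neg)
  ultimately have "(l4_sq (?P u0) + l4_sq (?P u1) + (l4_sq (?P v0) + l4_sq (?P v1))) * sqrt (2 ^ n)
      \<le> (norm u0)\<^sup>2 + (norm u1)\<^sup>2 + ((norm v0)\<^sup>2 + (norm v1)\<^sup>2)"
    by (simp add: left_X_noise left_Z_noise algebra_simps)
  also have "\<dots> = (norm x)\<^sup>2"
    by (simp add: defs Z.norm_even_odd X.norm_even_odd)
  finally have "(l4_sq (?P u0) + l4_sq (?P u1) + (l4_sq (?P v0) + l4_sq (?P v1))) * sqrt (2 ^ n) \<le> (norm x)\<^sup>2" .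
  moreover have "l4_sq (qubit_noise (1/3) (Suc m) x) * sqrt (2 ^ n)
      \<le> (l4_sq (?P u0) + l4_sq (?P u1) + (l4_sq (?P v0) + l4_sq (?P v1))) * sqrt (2 ^ n)"
    by (rule mult_right_mono[OF main]) simp
  ultimately show ?case by linarith
qed

theorem hypercontractive:
  "x \<in> corner (2 ^ n) \<Longrightarrow> l4_sq (qubit_noise (1/3) n x) * sqrt (2 ^ n) \<le> (norm x)\<^sup>2"
  by (rule hypercontractive_aux) auto

lemma trace_psd_root_nonneg:
  assumes "x \<in> corner N" "star x = x" "psd x"
  shows "0 \<le> inner (unit_upto N) (psd_root N x)"
proof -
  have "psd (psd_root N x)" "psd_root N x \<in> corner N" using psd_root[OF assms] by (auto simp: is_psd_root_def)
  then show ?thesis unfolding psd_def by (metis mult_unit_upto)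
qed

lemma trace_norm_nonneg: "g \<in> corner N \<Longrightarrow> 0 \<le> trace_norm N g"
  unfolding trace_norm_def
  by (rule trace_psd_root_nonneg) (auto intro!: corner_closed star_corner psd_star_mult)

text \<open>
  With \<open>v = \<langle>g, P g\<rangle>\<close>, where \<open>P\<close> is the square of the noise with parameter \<open>1/3\<close>, hypercontractivity
  bounds \<open>\<parallel>P g\<parallel>\<^sub>4\<^sup>2\<close> by \<open>v\<close> up to normalization.  Then \<open>inner_trace_norm_bound\<close> reads
  \<open>v\<^sup>2 \<le> \<parallel>g\<parallel>\<^sub>1 \<parallel>g\<parallel>\<^sub>2 v\<close>.
\<close>

lemma inner_noise_le_trace_norm:
  assumes g: "g \<in> corner (2 ^ n)" "star g = g"
  shows "inner g (qubit_noise (1/9) n g) * sqrt (2 ^ n) \<le> trace_norm (2 ^ n) g * norm g"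
proof -
  define f where "f = qubit_noise (1/3) n g"
  have f: "qubit_noise (1/9) n g = qubit_noise (1/3) n f" by (simp add: f_def qubit.noise_noise)
  define v where "v = inner g (qubit_noise (1/9) n g)"
  have v: "v = (norm f)\<^sup>2"
    by (simp add: v_def f qubit.noise_adj[symmetric] f_def[symmetric] power2_norm_eq_inner)
  have spectral_sum: "f \<in> corner (2 ^ n)"
  proof -
    have "qubit_noise (1/3) k g \<in> corner (2 ^ n)" if "k \<le> n" for k
      using that by (induction k) (auto simp: qubit.damp_def g intro!: corner_closed average_corner)
    then show ?thesis by (simp add: f_def)
  qed
  have nn: "0 \<le> trace_norm (2 ^ n) g * norm g" by (simp add: trace_norm_nonneg g)
  have "v\<^sup>2 * sqrt (2 ^ n) \<le> trace_norm (2 ^ n) g * norm g * (l4_sq (qubit_noise (1/9) n g) * sqrt (2 ^ n))"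
    using inner_trace_norm_bound[OF g, of "qubit_noise (1/9) n g"]
    by (simp add: v_def l4_sq_def mult.assoc[symmetric] mult_right_mono)
  also have "\<dots> \<le> trace_norm (2 ^ n) g * norm g * v"
    unfolding f v by (intro mult_left_mono hypercontractive spectral_sum nn)
  finally have "v * (v * sqrt (2 ^ n)) \<le> v * (trace_norm (2 ^ n) g * norm g)"
    by (simp add: power2_eq_square mult_ac)
  moreover have "0 \<le> v" by (simp add: v)
  ultimately show ?thesis using nn unfolding v_def[symmetric]
    by (cases "v = 0") auto
qed

section \<open>The inequality for weights\<close>

text \<open>
  Integration of the bound on the derivative of \<open>V(s)\<close>, the sum of \<open>s\<^sup>i W\<^sub>i\<close>: on \<open>{1/2..1}\<close> the function
  \<open>H\<close>, which adds to \<open>V(s)\<close> an antiderivative of the bound, is nonincreasing.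
\<close>

lemma variance_increment:
  fixes W :: "nat \<Rightarrow> real"
  assumes M: "0 \<le> M"
    and grad: "\<And>s. 0 < s \<Longrightarrow> s < 1 \<Longrightarrow> (\<Sum>i=1..n. real i * s ^ i * W i) \<le> sqrt (s / (1 - s)) * M"
    and r: "1/2 \<le> r" "r < 1"
  shows "(\<Sum>i=1..n. W i) \<le> (\<Sum>i=1..n. r ^ i * W i) + 2 * sqrt 2 * M * sqrt (1 - r)"
proof -
  define H where "H s = (\<Sum>i=1..n. s ^ i * W i) + 2 * sqrt 2 * M * sqrt (1 - s)" for s :: real
  \<comment> \<open>The factor \<open>sqrt 2\<close> comes from \<open>sqrt (1 / s) \<le> sqrt 2\<close> for \<open>s \<ge> 1/2\<close>.\<close>
  have "H 1 \<le> H r"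
  proof (rule DERIV_nonpos_imp_decreasing_open[OF less_imp_le[OF r(2)]])
    fix s :: real assume s: "r < s" "s < 1"
    have "0 < s" using s r by simp
    define G where "G = (\<Sum>i=1..n. real i * s ^ (i - 1) * W i)"
    have "(H has_field_derivative G - sqrt 2 * M / sqrt (1 - s)) (at s)"
      unfolding H_def G_def using s
      by (auto intro!: derivative_eq_intros sum.cong simp: field_simps)
    moreover have "G \<le> sqrt 2 * M / sqrt (1 - s)"
    proof -
      have "s * G = (\<Sum>i=1..n. real i * s ^ i * W i)"
        unfolding G_def sum_distrib_left
        by (intro sum.cong refl) (auto simp: power_eq_if)
      also have "\<dots> \<le> sqrt (s / (1 - s)) * M" using grad s \<open>0 < s\<close> by simp
      also have "\<dots> = sqrt s * M / sqrt (1 - s)" by (simp add: real_sqrt_divide)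
      also have "\<dots> \<le> s * (sqrt 2 * M / sqrt (1 - s))"
      proof -
        have "sqrt s * 1 \<le> sqrt s * (sqrt s * sqrt 2)"
          using s r by (intro mult_left_mono) (auto simp flip: real_sqrt_mult)
        then have "sqrt s \<le> s * sqrt 2" using \<open>0 < s\<close> by (simp flip: mult.assoc)
        then have "sqrt s * (M / sqrt (1 - s)) \<le> s * sqrt 2 * (M / sqrt (1 - s))"
          using M s by (intro mult_right_mono) auto
        then show ?thesis by (simp add: mult_ac)
      qed
      finally show ?thesis by (rule mult_left_le_imp_le) fact
    qed
    ultimately show "\<exists>y. (H has_real_derivative y) (at s) \<and> y \<le> 0" by force
  next
    show "continuous_on {r..1} H" unfolding H_def by (intro continuous_intros)
  qed
  then show ?thesis by (simp add: H_def)
qed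

text \<open>
  A power mean inequality: if the mean of \<open>r\<^sup>i\<close> under the weights \<open>W\<close> is at least \<open>1/2\<close>, then the mean of
  \<open>(r\<^sup>i)\<^sup>m\<close> is at least \<open>2\<^sup>-\<^sup>m\<close>.  It is the average of Bernoulli's inequality for \<open>2 r\<^sup>i\<close>.
\<close>

lemma bernoulli_moment:
  fixes W :: "nat \<Rightarrow> real"
  assumes W: "\<And>i. 0 \<le> W i" and r: "0 \<le> r"
    and half: "(\<Sum>i=1..n. W i) \<le> 2 * (\<Sum>i=1..n. r ^ i * W i)"
  shows "(\<Sum>i=1..n. W i) \<le> 2 ^ m * (\<Sum>i=1..n. (r ^ m) ^ i * W i)"
proof -
  have "(\<Sum>i=1..n. (1 + real m * (2 * r ^ i - 1)) * W i) \<le> (\<Sum>i=1..n. (1 + (2 * r ^ i - 1)) ^ m * W i)"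
  proof (intro sum_mono mult_right_mono W)
    fix i show "1 + real m * (2 * r ^ i - 1) \<le> (1 + (2 * r ^ i - 1)) ^ m"
      using r by (intro Bernoulli_inequality) simp
  qed
  also have "\<dots> = 2 ^ m * (\<Sum>i=1..n. (r ^ m) ^ i * W i)"
    by (simp add: sum_distrib_left power_mult_distrib power_mult[symmetric] mult_ac)
  also have "(\<Sum>i=1..n. (1 + real m * (2 * r ^ i - 1)) * W i)
      = (\<Sum>i=1..n. W i) + real m * (2 * (\<Sum>i=1..n. r ^ i * W i) - (\<Sum>i=1..n. W i))"
    by (simp add: algebra_simps sum.distrib sum_subtractf sum_distrib_left)
  finally show ?thesis using half by (smt (verit) mult_nonneg_nonneg of_nat_0_le_iff)
qed

lemma weighted_bound:
  fixes W :: "nat \<Rightarrow> real"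
  assumes W: "\<And>i. 0 \<le> W i" and M: "0 \<le> M" and \<epsilon>: "0 \<le> \<epsilon>"
    and v: "v = (\<Sum>i=1..n. W i)"
    and grad: "\<And>s. 0 < s \<Longrightarrow> s < 1 \<Longrightarrow> (\<Sum>i=1..n. real i * s ^ i * W i) \<le> sqrt (s / (1 - s)) * M"
    and infl: "(\<Sum>i=1..n. (1/9) ^ i * W i) \<le> sqrt \<epsilon> * sqrt v"
    and small: "(\<Sum>i=1..n. (1/9) ^ i * W i) \<le> 2 * v * sqrt v"
  shows "v * sqrt (ln (1 + 1 / \<epsilon>)) \<le> 100 * M"
proof (cases "v = 0 \<or> \<epsilon> = 0")
  case True
  then show ?thesis using M by auto
next
  case False
  have v_nonneg: "0 \<le> v" unfolding v by (intro sum_nonneg W)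
  with False have v_pos: "0 < v" and \<epsilon>_pos: "0 < \<epsilon>" using \<epsilon> by auto
  have pos: "0 < 1 + 1 / \<epsilon>" using \<epsilon>_pos by (simp add: add_pos_pos)
  define V where "V r = (\<Sum>i=1..n. r ^ i * W i)" for r
  have incr: "v \<le> V r + 2 * sqrt 2 * M * sqrt (1 - r)" if "1/2 \<le> r" "r < 1" for r
    unfolding v V_def by (rule variance_increment[OF M grad that])
  \<comment> \<open>The product of the two bounds: this is where the variance gets the exponent one.\<close>
  have V9: "(V (1/9))\<^sup>2 \<le> 2 * v\<^sup>2 * sqrt \<epsilon>"
  proof -
    have "V (1/9) * V (1/9) \<le> (sqrt \<epsilon> * sqrt v) * (2 * v * sqrt v)"
      using infl small unfolding V_def
      by (intro mult_mono) (auto intro!: sum_nonneg mult_nonneg_nonneg W \<epsilon> v_nonneg)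
    also have "\<dots> = 2 * v * (sqrt v * sqrt v) * sqrt \<epsilon>" by (simp only: mult_ac)
    finally show ?thesis using v_nonneg by (simp add: power2_eq_square)
  qed
  show ?thesis
  \<comment> \<open>For large \<open>\<epsilon>\<close> the logarithm is bounded and comparing with \<open>V(1/2) \<le> v / 2\<close> is enough.  The threshold
    makes the exponent \<open>m\<close> of the other case at least four, which guarantees \<open>r \<ge> 1/2\<close>.\<close>
  proof (cases "1 / (4 * 16 ^ 4) \<le> \<epsilon>")
    case True
    have "V (1/2) \<le> v / 2"
      unfolding V_def v sum_divide_distrib
    proof (intro sum_mono)
      fix i assume "i \<in> {1..n}"
      then have "(1/2::real) ^ i \<le> (1/2) ^ 1" by (intro power_decreasing) auto
      then show "(1/2) ^ i * W i \<le> W i / 2" using mult_right_mono[OF _ W[of i]] by fastforce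
    qed
    moreover have "v \<le> V (1/2) + 2 * M * (sqrt 2 * sqrt (1/2))"
      using incr[of "1/2"] by (simp add: mult_ac)
    moreover have "sqrt 2 * sqrt (1/2) = (1::real)" by (simp flip: real_sqrt_mult)
    ultimately have v4: "v \<le> 4 * M" by simp
    have "1 / \<epsilon> \<le> 2 ^ 18" using True \<epsilon>_pos by (simp add: field_simps)
    then have "ln (1 + 1 / \<epsilon>) \<le> ln (2 ^ 19)" using pos by (intro ln_mono) auto
    also have "\<dots> = 19 * ln 2" by (subst ln_realpow) simp_all
    also have "\<dots> \<le> 5\<^sup>2" using ln_2_less_1 by simp
    finally have "sqrt (ln (1 + 1 / \<epsilon>)) \<le> 5" by (intro real_le_lsqrt) auto
    then have "v * sqrt (ln (1 + 1 / \<epsilon>)) \<le> (4 * M) * 5"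
      using v4 v_nonneg M \<epsilon>_pos by (intro mult_mono) auto
    then show ?thesis using M by simp
  next
    case False
    have "\<exists>k. 1 / (4 * 16 ^ k) \<le> \<epsilon>"
    proof -
      obtain k where "(1/16) ^ k < 4 * \<epsilon>" using real_arch_pow_inv[of "4 * \<epsilon>" "1/16"] \<epsilon>_pos by auto
      then show ?thesis by (intro exI[of _ k]) (simp add: field_simps)
    qed
    \<comment> \<open>\<open>m\<close> is the largest exponent with \<open>4 * 16\<^sup>m < 1 / \<epsilon>\<close>, the condition that contradicts the power mean bound.\<close>
    define k where "k = (LEAST k. 1 / (4 * 16 ^ k) \<le> \<epsilon>)"
    have k: "1 / (4 * 16 ^ k) \<le> \<epsilon>" unfolding k_def by (rule LeastI_ex) fact
    have "4 < k"
    proof (rule ccontr)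
      assume "\<not> 4 < k"
      then have "(16::real) ^ k \<le> 16 ^ 4" by (intro power_increasing) auto
      then have "1 / (4 * 16 ^ 4) \<le> 1 / (4 * 16 ^ k :: real)" by (intro divide_left_mono) auto
      with k False show False by simp
    qed
    then obtain m where m: "k = Suc m" "4 \<le> m" by (cases k) auto
    have m_less: "\<epsilon> < 1 / (4 * 16 ^ m)"
      using not_less_Least[of m "\<lambda>k. 1 / (4 * 16 ^ k) \<le> \<epsilon>"] m unfolding k_def by auto
    define r :: real where "r = exp (- (ln 9 / m))"
    have "r ^ m = exp (real m * - (ln 9 / m))" unfolding r_def by (rule exp_of_nat_mult[symmetric])
    also have "real m * - (ln 9 / m) = - ln 9" using m by simp
    finally have rm: "r ^ m = 1 / 9" by (simp add: exp_minus inverse_eq_divide)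
    have "ln (9::real) \<le> ln (2 ^ 4)" by (intro ln_mono) auto
    also have "\<dots> = 4 * ln 2" by (subst ln_realpow) simp_all
    finally have ln9: "ln (9::real) \<le> 4 * ln 2" .
    also have "4 * ln 2 \<le> real m * ln 2" using m by (intro mult_right_mono) auto
    finally have "ln 9 \<le> real m * ln 2" .
    then have "exp (- ln 2) \<le> r" unfolding r_def using m by (simp add: field_simps)
    then have r_half: "1 / 2 \<le> r" by (simp add: exp_minus inverse_eq_divide)
    have r1: "r < 1" using m by (simp add: r_def)
    have "1 + - (ln 9 / m) \<le> r" unfolding r_def by (rule exp_ge_add_one_self)
    moreover have "ln 9 / m \<le> 4 / real m" using ln9 ln_2_less_1 by (intro divide_right_mono) auto
    ultimately have r_close: "1 - r \<le> 4 / m" by simp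
    have "V r \<le> v / 2"
    proof (rule ccontr)
      assume "\<not> V r \<le> v / 2"
      then have "(\<Sum>i=1..n. W i) \<le> 2 * (\<Sum>i=1..n. r ^ i * W i)" by (simp add: V_def v)
      from bernoulli_moment[OF W _ this, of m] have "v \<le> 2 ^ m * V (1/9)"
        using r_half by (simp add: V_def v rm)
      then have "v\<^sup>2 \<le> (2 ^ m * V (1/9))\<^sup>2" using v_nonneg by (intro power_mono)
      also have "\<dots> = 4 ^ m * (V (1/9))\<^sup>2"
        by (simp add: power_mult_distrib power_mult[symmetric] mult.commute[of m] power_mult[of 2 2])
      also have "\<dots> \<le> 4 ^ m * (2 * v\<^sup>2 * sqrt \<epsilon>)" using V9 by (intro mult_left_mono) auto
      finally have "v\<^sup>2 * 1 \<le> v\<^sup>2 * (2 * 4 ^ m * sqrt \<epsilon>)" by (simp add: mult_ac)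
      then have "1 \<le> 2 * 4 ^ m * sqrt \<epsilon>" using v_pos by (simp only: mult_le_cancel_left_pos zero_less_power)
      then have "1\<^sup>2 \<le> (2 * 4 ^ m * sqrt \<epsilon>)\<^sup>2" by (intro power_mono) auto
      also have "\<dots> = 4 * 16 ^ m * \<epsilon>"
        using \<epsilon> by (simp add: power_mult_distrib power_mult[symmetric] mult.commute[of m] power_mult[of 4 2])
      finally show False using m_less by (simp add: field_simps)
    qed
    then have "v \<le> 4 * sqrt 2 * M * sqrt (1 - r)" using incr[OF r_half r1] by simp
    also have "\<dots> \<le> 4 * sqrt 2 * M * sqrt (4 / m)"
      using r_close M by (intro mult_left_mono) auto
    finally have v_le: "v \<le> 8 * sqrt 2 * M / sqrt m" by (simp add: real_sqrt_divide)
    have "1 / \<epsilon> \<le> 4 * 16 ^ k" using k \<epsilon>_pos by (simp add: field_simps)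
    also have "\<dots> = 64 * 16 ^ m" by (simp add: m)
    also have "\<dots> \<le> 128 * 16 ^ m - 1"
    proof -
      have "(1::real) \<le> 16 ^ m" by simp
      then show ?thesis by linarith
    qed
    also have "(128 * 16 ^ m :: real) = 2 ^ (4 * m + 7)" by (simp add: power_add power_mult)
    finally have "ln (1 + 1 / \<epsilon>) \<le> ln (2 ^ (4 * m + 7))" using pos by (intro ln_mono) auto
    also have "\<dots> = real (4 * m + 7) * ln 2" by (rule ln_realpow)
    also have "\<dots> \<le> real (4 * m + 7) * 1" using ln_2_less_1 by (intro mult_left_mono) auto
    also have "\<dots> \<le> 8 * real m" using m by simp
    finally have "sqrt (ln (1 + 1 / \<epsilon>)) \<le> sqrt (8 * real m)" by simp
    then have "v * sqrt (ln (1 + 1 / \<epsilon>)) \<le> (8 * sqrt 2 * M / sqrt m) * sqrt (8 * real m)"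
      using v_le v_nonneg M \<epsilon>_pos by (intro mult_mono) auto
    also have "\<dots> = 8 * M * (sqrt 2 * sqrt 8)" using m by (simp add: real_sqrt_mult)
    also have "sqrt 2 * sqrt 8 = sqrt (4\<^sup>2 :: real)" by (simp flip: real_sqrt_mult)
    also have "\<dots> = (4::real)" by simp
    finally show ?thesis using M by simp
  qed
qed


section \<open>Projections on qubits\<close>

lemma diff_op_corner: "x \<in> corner (2 ^ n) \<Longrightarrow> b < n \<Longrightarrow> qubit.diff_op b x \<in> corner (2 ^ n)"
  unfolding qubit.diff_op_def by (intro corner_closed average_corner)

lemma noise_corner: "x \<in> corner (2 ^ n) \<Longrightarrow> k \<le> n \<Longrightarrow> qubit_noise r k x \<in> corner (2 ^ n)"
  by (induction k) (auto simp: qubit.damp_def intro!: corner_closed average_corner)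

lemma noise_unit_upto: "k \<le> n \<Longrightarrow> qubit_noise r k (unit_upto (2 ^ n)) = unit_upto (2 ^ n)"
  by (induction k) (auto simp: qubit.damp_def average_unit_upto simp flip: scaleR_add_left)

lemma inner_unit_upto [simp]: "inner (unit_upto N) (unit_upto N) = real N"
  using norm_unit_upto[of N] by (simp add: power2_norm_eq_inner)

lemma noise_0_eq_trace:
  assumes x: "x \<in> corner (2 ^ n)" "star x = x"
  shows "qubit_noise 0 n x = (inner (unit_upto (2 ^ n)) x / 2 ^ n) *\<^sub>R unit_upto (2 ^ n)"
proof -
  define y where "y = qubit_noise 0 n x"
  have E: "average b y = y" if "b < n" for b
    using qubit.damp_noise_0[OF that, of 0 x] by (simp add: qubit.damp_def y_def)
  have y: "y \<in> corner (2 ^ n)" "star y = y"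
    by (simp_all add: y_def noise_corner x qubit.noise_star[symmetric])
  define c where "c = ent y 0 0"
  have "conj_X b y = y" "conj_Z b y = y" if "b < n" for b
    using E[OF that] conj_X_average[of b y] conj_Z_average[of b y] by simp_all
  then have ent_y: "ent y i j = (if i = j \<and> i < 2 ^ n then c else 0)" for i j
    unfolding c_def by (rule invariant_scalar[OF y(1)])
  have "cnj c = c" unfolding c_def by (metis ent_star y(2))
  then have "c = of_real (Re c)" by (simp add: complex_eq_iff)
  then have yc: "y = Re c *\<^sub>R unit_upto (2 ^ n)"
    by (intro fmat_eqI) (auto simp: ent_y scaleR_conv_of_real)
  have "inner (unit_upto (2 ^ n)) y = inner (unit_upto (2 ^ n)) x"
    unfolding y_def qubit.noise_adj[symmetric] by (simp add: noise_unit_upto)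
  then have "Re c * 2 ^ n = inner (unit_upto (2 ^ n)) x" by (simp add: yc)
  then have "Re c = inner (unit_upto (2 ^ n)) x / 2 ^ n" by (simp add: field_simps)
  then show ?thesis using yc by (simp add: y_def)
qed

text \<open>
  All quantities are normalized by the dimension \<open>N\<close> as in the theorem: \<open>\<tau>\<close> is the normalized
  trace of \<open>T\<close>, \<open>weight i\<close> its Fourier weight on level \<open>i\<close>, \<open>gradient_norm\<close> the \<open>L\<^sub>1\<close> norm of the
  square function of the gradient, and \<open>\<epsilon>\<close> the sum of the squared \<open>L\<^sub>1\<close> influences.
\<close>

locale qubit_projection =
  fixes n :: nat and T :: fmat
  assumes T: "T \<in> corner (2 ^ n)" "star T = T" "T * T = T"
begin

definition N :: real where "N = 2 ^ n"
definition \<tau> :: real where "\<tau> = inner (unit_upto (2 ^ n)) T / N"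
definition variance :: real where "variance = \<tau> - \<tau>\<^sup>2"
definition weight :: "nat \<Rightarrow> real" where "weight i = inner T (qubit.level n i T) / N"
definition gradient_norm :: real where
  "gradient_norm = inner (unit_upto (2 ^ n)) (psd_root (2 ^ n) (\<Sum>b<n. star (qubit.diff_op b T) * qubit.diff_op b T)) / N"
definition \<epsilon> :: real where "\<epsilon> = (\<Sum>b<n. (trace_norm (2 ^ n) (qubit.diff_op b T) / N)\<^sup>2)"

lemma N_pos: "0 < N"
  by (simp add: N_def)

lemma inner_T_T: "inner T T = \<tau> * N" "inner (unit_upto (2 ^ n)) T = \<tau> * N"
  using inner_mult_adjoint_left[of "unit_upto (2 ^ n)" T T] T N_pos by (simp_all add: \<tau>_def)

lemma noise_0_T: "qubit_noise 0 n T = \<tau> *\<^sub>R unit_upto (2 ^ n)"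
  using noise_0_eq_trace[OF T(1,2)] by (simp add: \<tau>_def N_def)

lemma weight_0: "weight 0 = \<tau>\<^sup>2"
  using N_pos inner_T_T(2) by (simp add: weight_def qubit.level_0 noise_0_T inner_commute[of T] power2_eq_square)

lemma sum_weight: "(\<Sum>i=1..n. r ^ i * weight i) = inner T (qubit_noise r n T) / N - \<tau>\<^sup>2"
proof -
  have "inner T (qubit_noise r n T) / N = (\<Sum>i\<le>n. r ^ i * weight i)"
    by (simp add: qubit.noise_eq_sum_level inner_sum_right weight_def sum_divide_distrib)
  also have "\<dots> = weight 0 + (\<Sum>i=1..n. r ^ i * weight i)"
    by (simp add: sum.atMost_shift atLeast0LessThan sum.shift_bounds_cl_Suc_ivl[symmetric] sum.atLeast1_atMost_eq)
  finally show ?thesis by (simp add: weight_0)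
qed

lemma variance_eq: "variance = (\<Sum>i=1..n. weight i)"
  using sum_weight[of 1] N_pos by (simp add: inner_T_T variance_def)

text \<open>
  The left-hand side is the sum over \<open>b\<close> of the normalized pairing of \<open>d\<^sub>b P\<^sub>s T\<close> with \<open>d\<^sub>b T\<close>.  As
  \<open>T\<^sup>* T = T \<le> 1\<close>, the reverse Poincare inequality bounds the first family in column \<open>L\<^sub>\<infinity>\<close> by
  \<open>sqrt (s / (1 - s))\<close>.
\<close>

lemma gradient_bound:
  assumes s: "0 < s" "s < 1"
  shows "(\<Sum>i=1..n. real i * s ^ i * weight i) \<le> sqrt (s / (1 - s)) * gradient_norm"
proof -
  define c where "c = sqrt (s / (1 - s))"
  have c: "0 \<le> c" "c\<^sup>2 = s / (1 - s)" using s by (simp_all add: c_def)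
  let ?P = "qubit_noise s n T"
  define S where "S = (\<Sum>b<n. star (qubit.diff_op b ?P) * qubit.diff_op b ?P)"
  have "star (unit_upto (2 ^ n) - T) * (unit_upto (2 ^ n) - T) = unit_upto (2 ^ n) - T"
    using T by (simp add: algebra_simps)
  then have "psd (unit_upto (2 ^ n) - T)" by (metis psd_star_mult)
  then have "psd (qubit_noise s n (unit_upto (2 ^ n) - T))" using s by (intro qubit.noise_pos) auto
  then have 1: "psd (unit_upto (2 ^ n) - ?P)" by (simp add: qubit.noise_lin noise_unit_upto)
  have "psd (?P - star ?P * ?P - ((1 - s) / s) *\<^sub>R S)"
    using qubit.reverse_poincare[of s n T] s T by (simp add: S_def)
  then have "psd (c\<^sup>2 *\<^sub>R ((unit_upto (2 ^ n) - ?P) + star ?P * ?P + (?P - star ?P * ?P - ((1 - s) / s) *\<^sub>R S)))"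
    using 1 by (intro psd_scaleR psd_add psd_star_mult) auto
  also have "c\<^sup>2 *\<^sub>R ((unit_upto (2 ^ n) - ?P) + star ?P * ?P + (?P - star ?P * ?P - ((1 - s) / s) *\<^sub>R S))
      = c\<^sup>2 *\<^sub>R unit_upto (2 ^ n) - (c\<^sup>2 * ((1 - s) / s)) *\<^sub>R S"
    by (simp add: algebra_simps)
  also have "c\<^sup>2 * ((1 - s) / s) = 1" using s by (simp add: c)
  finally have "psd (c\<^sup>2 *\<^sub>R unit_upto (2 ^ n) - S)" by simp
  then have "(\<Sum>b<n. inner (qubit.diff_op b ?P) (qubit.diff_op b T)) \<le> c * (gradient_norm * N)"
    unfolding gradient_norm_def S_def using c N_pos duality[of "{..<n}" "\<lambda>b. qubit.diff_op b T" "2 ^ n" c "\<lambda>b. qubit.diff_op b ?P"]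
    by (simp add: diff_op_corner T)
  moreover have "(\<Sum>b<n. inner (qubit.diff_op b ?P) (qubit.diff_op b T)) = (\<Sum>i=1..n. real i * s ^ i * weight i) * N"
  proof -
    have "(\<Sum>b<n. inner (qubit.diff_op b ?P) (qubit.diff_op b T)) = inner T (\<Sum>b<n. qubit.diff_op b ?P)"
      by (simp add: qubit.diff_op_adj[of _ ?P] inner_sum_right inner_commute[of T] qubit.diff_op_adj)
    also have "(\<Sum>b<n. qubit.diff_op b ?P) = (\<Sum>b<n. \<Sum>i\<le>n. s ^ i *\<^sub>R qubit.diff_op b (qubit.level n i T))"
      by (simp add: qubit.noise_eq_sum_level linear_sum[OF qubit.linear_diff_op] qubit.diff_op_lin)
    also have "\<dots> = (\<Sum>i\<le>n. s ^ i *\<^sub>R (real i *\<^sub>R qubit.level n i T))"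
      by (subst sum.swap) (simp only: scaleR_sum_right[symmetric] qubit.sum_diff_op_level)
    also have "inner T \<dots> = (\<Sum>i\<le>n. real i * s ^ i * weight i) * N"
      unfolding inner_sum_right sum_distrib_right
      using N_pos by (intro sum.cong refl) (simp add: weight_def)
    also have "(\<Sum>i\<le>n. real i * s ^ i * weight i) = (\<Sum>i=1..n. real i * s ^ i * weight i)"
      by (rule sum.mono_neutral_right) (auto simp: Suc_le_eq)
    finally show ?thesis .
  qed
  ultimately show ?thesis using N_pos by (simp add: c_def)
qed

text \<open>
  The martingale differences \<open>D k\<close> carry the whole variance, while their trace norms are at most
  those of the partial derivatives; so the bound by \<open>\<parallel>D k\<parallel>\<^sub>1 \<parallel>D k\<parallel>\<^sub>2\<close> for each of them can be
  summed by the Cauchy--Schwarz inequality.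
\<close>

lemma low_degree_influence: "(\<Sum>i=1..n. (1/9) ^ i * weight i) \<le> sqrt \<epsilon> * sqrt variance"
proof -
  define D where "D k = qubit.diff_op k (qubit_noise 0 k T)" for k
  have split: "inner T (qubit_noise r n T) / N - \<tau>\<^sup>2 = (\<Sum>k<n. inner (D k) (qubit_noise r n (D k)) / N)" for r
    using qubit.martingale_split[of T r n n] N_pos
    by (simp add: noise_0_T qubit.noise_lin noise_unit_upto D_def sum_divide_distrib N_def add_divide_distrib power2_eq_square)
  have variance: "variance = (\<Sum>k<n. (norm (D k) / sqrt N)\<^sup>2)"
    using split[of 1] N_pos by (simp add: inner_T_T variance_def power_divide power2_norm_eq_inner)
  have "inner (D k) (qubit_noise (1/9) n (D k)) / N
      \<le> \<bar>trace_norm (2 ^ n) (qubit.diff_op k T) / N\<bar> * \<bar>norm (D k) / sqrt N\<bar>" if k: "k < n" for k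
  proof -
    have Dc: "D k \<in> corner (2 ^ n)" "star (D k) = D k"
      using k T by (auto simp: D_def qubit.diff_op_star[symmetric] qubit.noise_star[symmetric] intro!: diff_op_corner noise_corner)
    have "inner (D k) (qubit_noise (1/9) n (D k)) * sqrt N \<le> trace_norm (2 ^ n) (D k) * norm (D k)"
      unfolding N_def by (rule inner_noise_le_trace_norm[OF Dc])
    also have "trace_norm (2 ^ n) (D k) \<le> trace_norm (2 ^ n) (qubit.diff_op k T)"
      unfolding D_def qubit.diff_op_noise_commute using k T
      by (intro qubit.trace_norm_noise_le) (auto simp: average_corner average_unit_upto diff_op_corner qubit.diff_op_star[symmetric])
    finally have "inner (D k) (qubit_noise (1/9) n (D k)) * sqrt N / (N * sqrt N)
        \<le> trace_norm (2 ^ n) (qubit.diff_op k T) * norm (D k) / (N * sqrt N)"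
      using N_pos by (intro divide_right_mono) (auto simp: mult_right_mono)
    then show ?thesis
      using N_pos k T by (simp add: trace_norm_nonneg diff_op_corner)
  qed
  then have "(\<Sum>i=1..n. (1/9) ^ i * weight i)
      \<le> (\<Sum>k<n. \<bar>trace_norm (2 ^ n) (qubit.diff_op k T) / N\<bar> * \<bar>norm (D k) / sqrt N\<bar>)"
    unfolding sum_weight split by (intro sum_mono) simp
  also have "\<dots> \<le> L2_set (\<lambda>k. trace_norm (2 ^ n) (qubit.diff_op k T) / N) {..<n} * L2_set (\<lambda>k. norm (D k) / sqrt N) {..<n}"
    by (rule L2_set_mult_ineq)
  also have "\<dots> = sqrt \<epsilon> * sqrt variance"
    by (simp add: L2_set_def \<epsilon>_def variance)
  finally show ?thesis .
qed

lemma \<tau>_bounds: "0 \<le> \<tau>" "\<tau> \<le> 1"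
proof -
  have "0 \<le> inner T T" by simp
  then show "0 \<le> \<tau>" using N_pos by (simp add: inner_T_T zero_le_mult_iff)
  have "0 \<le> inner (unit_upto (2 ^ n) - T) (unit_upto (2 ^ n) - T)" by simp
  also have "\<dots> = (1 - \<tau>) * N"
    by (simp add: inner_diff_left inner_diff_right inner_commute[of T "unit_upto (2 ^ n)"] inner_T_T N_def algebra_simps)
  finally show "\<tau> \<le> 1" using N_pos by (simp add: zero_le_mult_iff)
qed

text \<open>
  The same bound for \<open>g = T - \<tau>\<close>, whose absolute value \<open>(1 - \<tau>) T + \<tau> (1 - T)\<close> has trace
  \<open>2 \<tau> (1 - \<tau>)\<close>.  It takes over when the variance is so small that \<open>low_degree_influence\<close> is weak.
\<close>

lemma low_degree_small: "(\<Sum>i=1..n. (1/9) ^ i * weight i) \<le> 2 * variance * sqrt variance"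
proof -
  let ?unit_upto = "unit_upto (2 ^ n)"
  define g where "g = T - \<tau> *\<^sub>R ?unit_upto"
  have g: "g \<in> corner (2 ^ n)" "star g = g"
    by (auto simp: g_def T intro!: corner_closed)
  define R where "R = (1 - \<tau>) *\<^sub>R T + \<tau> *\<^sub>R (?unit_upto - T)"
  have IT: "star (?unit_upto - T) * (?unit_upto - T) = ?unit_upto - T" and TT: "star T * T = T"
    using T by (simp_all add: algebra_simps)
  have "psd ((1 - \<tau>) *\<^sub>R (star T * T) + \<tau> *\<^sub>R (star (?unit_upto - T) * (?unit_upto - T)))"
    using \<tau>_bounds by (intro psd_add psd_scaleR psd_star_mult) auto
  then have "psd R" unfolding IT TT R_def .
  then have "is_psd_root (2 ^ n) (star g * g) R"
    using T unfolding is_psd_root_def g(2)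
    by (auto simp: R_def g_def algebra_simps intro!: corner_closed simp flip: scaleR_add_left)
  then have "trace_norm (2 ^ n) g = inner ?unit_upto R" by (simp add: trace_norm_def psd_root_eq)
  also have "\<dots> = 2 * variance * N"
    by (simp add: R_def inner_add_right inner_diff_right inner_T_T variance_def N_def algebra_simps power2_eq_square)
  finally have tn: "trace_norm (2 ^ n) g = 2 * variance * N" .
  have PT: "inner ?unit_upto (qubit_noise r n T) = \<tau> * N" for r
    unfolding qubit.noise_adj[symmetric] by (simp add: noise_unit_upto inner_T_T)
  have gP: "inner g (qubit_noise r n g) = (inner T (qubit_noise r n T) / N - \<tau>\<^sup>2) * N" for r
    using N_pos
    by (simp add: g_def qubit.noise_lin noise_unit_upto inner_diff_left inner_diff_right PT inner_T_T inner_commute[of T ?unit_upto]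
        power2_eq_square N_def[symmetric] algebra_simps)
  have "inner g g = variance * N" using gP[of 1] N_pos by (simp add: inner_T_T variance_def)
  then have ng: "norm g = sqrt variance * sqrt N" by (simp add: norm_eq_sqrt_inner real_sqrt_mult)
  have "(inner T (qubit_noise (1/9) n T) / N - \<tau>\<^sup>2) * N * sqrt N \<le> 2 * variance * N * (sqrt variance * sqrt N)"
    using inner_noise_le_trace_norm[OF g] unfolding gP tn ng N_def[symmetric] .
  then have "(inner T (qubit_noise (1/9) n T) / N - \<tau>\<^sup>2) * (N * sqrt N) \<le> (2 * variance * sqrt variance) * (N * sqrt N)"
    by (simp only: mult_ac)
  then show ?thesis unfolding sum_weight using N_pos by (simp only: mult_le_cancel_right) auto
qed

lemma gradient_norm_nonneg: "0 \<le> gradient_norm"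
  unfolding gradient_norm_def using N_pos
  by (intro divide_nonneg_pos trace_psd_root_nonneg corner_closed psd_sum psd_star_mult)
     (auto intro!: star_corner diff_op_corner T)

theorem eldan_gross: "variance * sqrt (ln (1 + 1 / \<epsilon>)) \<le> 100 * gradient_norm"
proof (rule weighted_bound[OF _ _ _ variance_eq gradient_bound low_degree_influence low_degree_small])
  show "0 \<le> weight i" for i using N_pos by (simp add: weight_def qubit.inner_level_nonneg)
  show "0 \<le> \<epsilon>" by (simp add: \<epsilon>_def sum_nonneg)
  show "0 \<le> gradient_norm" by (rule gradient_norm_nonneg)
qed

end

section \<open>Transfer from matrices to the ring\<close>

lemma of_mat_corner: "A \<in> carrier_mat N N \<Longrightarrow> of_mat A \<in> corner N"
  by (rule cornerI) (auto simp: ent_of_mat)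

lemma of_mat_inject: "A \<in> carrier_mat N N \<Longrightarrow> B \<in> carrier_mat N N \<Longrightarrow> of_mat A = of_mat B \<longleftrightarrow> A = B"
proof
  assume A: "A \<in> carrier_mat N N" "B \<in> carrier_mat N N" and eq: "of_mat A = of_mat B"
  show "A = B"
  proof (rule eq_matI)
    fix i j assume "i < dim_row B" "j < dim_col B"
    then show "A $$ (i, j) = B $$ (i, j)"
      using arg_cong[OF eq, of "\<lambda>x. ent x i j"] A by (simp add: ent_of_mat)
  qed (use A in auto)
qed simp

lemma to_mat_of_mat: "A \<in> carrier_mat N N \<Longrightarrow> to_mat N (of_mat A) = A"
  by (subst of_mat_inject[of _ N, symmetric]) (auto simp: of_mat_corner)

lemma of_mat_mult: "A \<in> carrier_mat N N \<Longrightarrow> B \<in> carrier_mat N N \<Longrightarrow> of_mat (A * B) = of_mat A * of_mat B"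
  by (rule fmat_eqI)
     (auto simp: ent_mult_left[OF of_mat_corner] ent_of_mat scalar_prod_def atLeast0LessThan intro!: sum.cong)

lemma mat_adjoint_carrier: "A \<in> carrier_mat N N \<Longrightarrow> mat_adjoint A \<in> carrier_mat N N"
  by (auto simp: mat_adjoint_def mat_of_rows_def)

lemma of_mat_adjoint: "A \<in> carrier_mat N N \<Longrightarrow> of_mat (mat_adjoint A) = star (of_mat A)"
  by (rule fmat_eqI) (auto simp: ent_of_mat mat_adjoint_def mat_of_rows_def)

lemma hermitian_of_mat: "A \<in> carrier_mat N N \<Longrightarrow> hermitian_mat A \<longleftrightarrow> star (of_mat A) = of_mat A"
  unfolding hermitian_mat_def
  by (auto simp: of_mat_adjoint[symmetric] of_mat_inject[of _ N] mat_adjoint_carrier square_mat.simps)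

lemma quadratic_form_of_mat:
  assumes "A \<in> carrier_mat N N" "v \<in> carrier_vec N"
  shows "(A *\<^sub>v v) \<bullet>c v = (\<Sum>i<N. cnj (v $ i) * (\<Sum>k<N. ent (of_mat A) i k * v $ k))"
  using assms by (auto simp: scalar_prod_def atLeast0LessThan ent_of_mat mult.commute intro!: sum.cong)

text \<open>
  In one direction a matrix \<open>y\<close> is tested column by column; in the other a vector is made
  into a matrix with a single nonzero column.
\<close>

lemma positive_of_mat:
  assumes A: "A \<in> carrier_mat N N"
  shows "positive_mat A \<longleftrightarrow> star (of_mat A) = of_mat A \<and> psd (of_mat A)"
proof -
  have "(\<forall>v\<in>carrier_vec N. 0 \<le> Re ((A *\<^sub>v v) \<bullet>c v)) \<longleftrightarrow> psd (of_mat A)"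
  proof
    assume pos: "\<forall>v\<in>carrier_vec N. 0 \<le> Re ((A *\<^sub>v v) \<bullet>c v)"
    show "psd (of_mat A)" unfolding psd_def
    proof
      fix y
      obtain K where K: "y \<in> corner K" "of_mat A * y \<in> corner K" using ex_corner2 by blast
      have "inner y (of_mat A * y) = Re (\<Sum>i<K. \<Sum>j<K. cnj (ent y i j) * ent (of_mat A * y) i j)"
        by (rule inner_left[OF K(1)])
      also have "(\<Sum>i<K. \<Sum>j<K. cnj (ent y i j) * ent (of_mat A * y) i j)
          = (\<Sum>j<K. \<Sum>i<K. cnj (ent y i j) * ent (of_mat A * y) i j)" by (rule sum.swap)
      also have "\<dots> = (\<Sum>j<K. \<Sum>i<N. cnj (ent y i j) * ent (of_mat A * y) i j)"
      proof (rule sum.cong[OF refl])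
        fix j
        have "ent (of_mat A * y) i j = 0" if "N \<le> i" for i
          using that A by (simp add: ent_mult_left[OF of_mat_corner[OF A]] cornerD[OF of_mat_corner[OF A]])
        then show "(\<Sum>i<K. cnj (ent y i j) * ent (of_mat A * y) i j) = (\<Sum>i<N. cnj (ent y i j) * ent (of_mat A * y) i j)"
          by (intro sum.mono_neutral_cong) (use cornerD[OF K(1)] in \<open>auto simp: not_less\<close>)
      qed
      also have "Re \<dots> = (\<Sum>j<K. Re ((A *\<^sub>v vec N (\<lambda>i. ent y i j)) \<bullet>c vec N (\<lambda>i. ent y i j)))"
        by (simp add: quadratic_form_of_mat[OF A] ent_mult_left[OF of_mat_corner[OF A]] del: Re_sum) (simp only: Re_sum)
      also have "0 \<le> \<dots>" using pos by (intro sum_nonneg) auto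
      finally show "0 \<le> inner y (of_mat A * y)" .
    qed
  next
    assume pos: "psd (of_mat A)"
    show "\<forall>v\<in>carrier_vec N. 0 \<le> Re ((A *\<^sub>v v) \<bullet>c v)"
    proof
      fix v :: "complex vec" assume v: "v \<in> carrier_vec N"
      define y where "y = Fmat (\<lambda>i j. if i < N \<and> j = 0 then v $ i else 0)"
      have ent_y: "ent y i j = (if i < N \<and> j = 0 then v $ i else 0)" for i j
        unfolding y_def by (subst ent_Fmat[where N = "max N 1"]) auto
      have y: "y \<in> corner (N + 1)" by (rule cornerI) (auto simp: ent_y)
      have "0 \<le> inner y (of_mat A * y)" using pos by (simp add: psd_def)
      also have "\<dots> = Re (\<Sum>i<N + 1. \<Sum>j<N + 1. cnj (ent y i j) * ent (of_mat A * y) i j)"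
        by (rule inner_left[OF y])
      also have "(\<Sum>i<N + 1. \<Sum>j<N + 1. cnj (ent y i j) * ent (of_mat A * y) i j)
          = (\<Sum>i<N + 1. cnj (ent y i 0) * ent (of_mat A * y) i 0)"
      proof (rule sum.cong[OF refl])
        fix i
        have "(\<Sum>j<N + 1. cnj (ent y i j) * ent (of_mat A * y) i j)
            = (\<Sum>j\<in>{0}. cnj (ent y i j) * ent (of_mat A * y) i j)"
          by (rule sum.mono_neutral_right) (auto simp: ent_y)
        then show "(\<Sum>j<N + 1. cnj (ent y i j) * ent (of_mat A * y) i j) = cnj (ent y i 0) * ent (of_mat A * y) i 0"
          by simp
      qed
      also have "\<dots> = (A *\<^sub>v v) \<bullet>c v"
        by (simp add: quadratic_form_of_mat[OF A v] ent_mult_left[OF of_mat_corner[OF A]] ent_y)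
      finally show "0 \<le> Re ((A *\<^sub>v v) \<bullet>c v)" .
    qed
  qed
  then show ?thesis using A hermitian_of_mat[OF A] by (simp add: positive_mat_def)
qed

lemma mat_sqrt_of_mat:
  assumes A: "A \<in> carrier_mat N N" "star (of_mat A) = of_mat A" "psd (of_mat A)"
  shows "mat_sqrt A \<in> carrier_mat N N" "of_mat (mat_sqrt A) = psd_root N (of_mat A)"
proof -
  define R where "R = psd_root N (of_mat A)"
  have R: "is_psd_root N (of_mat A) R" unfolding R_def by (rule psd_root) (simp_all add: A of_mat_corner)
  have iff: "B \<in> carrier_mat N N \<and> positive_mat B \<and> B * B = A \<longleftrightarrow>
      B \<in> carrier_mat N N \<and> is_psd_root N (of_mat A) (of_mat B)" for B
    using A(1) by (auto simp: is_psd_root_def of_mat_corner positive_of_mat of_mat_mult[symmetric] of_mat_inject[of _ N])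
  have "mat_sqrt A = to_mat N R"
    unfolding mat_sqrt_def
  proof (rule the_equality)
    have dim: "dim_row A = N" using A by simp
    show "to_mat N R \<in> carrier_mat (dim_row A) (dim_row A) \<and> positive_mat (to_mat N R) \<and> to_mat N R * to_mat N R = A"
      unfolding dim iff using R by (auto simp: is_psd_root_def)
    fix B assume "B \<in> carrier_mat (dim_row A) (dim_row A) \<and> positive_mat B \<and> B * B = A"
    then have B: "B \<in> carrier_mat N N" "is_psd_root N (of_mat A) (of_mat B)" unfolding dim iff by auto
    then have "of_mat B = R" using R psd_root_unique by blast
    then show "B = to_mat N R" using to_mat_of_mat[OF B(1)] by simp
  qed
  with R show "mat_sqrt A \<in> carrier_mat N N" "of_mat (mat_sqrt A) = psd_root N (of_mat A)"
    by (auto simp: is_psd_root_def R_def)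
qed

lemma trace_of_mat:
  assumes A: "A \<in> carrier_mat N N"
  shows "Re (ntr A) = inner (unit_upto N) (of_mat A) / N"
proof -
  have "(\<Sum>i<N. \<Sum>j<N. cnj (ent (unit_upto N) i j) * ent (of_mat A) i j) = (\<Sum>i<N. \<Sum>j<N. if j = i then A $$ (i, i) else 0)"
    using A by (intro sum.cong) (auto simp: ent_of_mat)
  also have "\<dots> = (\<Sum>i<N. A $$ (i, i))" by simp
  finally have "inner (unit_upto N) (of_mat A) = Re (\<Sum>i<N. A $$ (i, i))"
    by (simp only: inner_left[OF unit_upto_corner])
  then show ?thesis using A by (simp add: ntr_def del: Re_sum)
qed

lemma of_mat_abs_sq:
  assumes A: "A \<in> carrier_mat N N"
  shows "abs_sq_mat A \<in> carrier_mat N N" "of_mat (abs_sq_mat A) = star (of_mat A) * of_mat A"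
  unfolding abs_sq_mat_def
  by (rule mult_carrier_mat[OF mat_adjoint_carrier[OF A] A])
     (simp add: of_mat_mult[OF mat_adjoint_carrier[OF A] A] of_mat_adjoint[OF A])

lemma L1_norm_of_mat:
  assumes A: "A \<in> carrier_mat N N"
  shows "L1_norm A = trace_norm N (of_mat A) / N"
proof -
  have sq: "abs_sq_mat A \<in> carrier_mat N N" "of_mat (abs_sq_mat A) = star (of_mat A) * of_mat A"
    using of_mat_abs_sq[OF A] by auto
  have "star (of_mat (abs_sq_mat A)) = of_mat (abs_sq_mat A)" "psd (of_mat (abs_sq_mat A))"
    by (simp_all add: sq psd_star_mult)
  from mat_sqrt_of_mat[OF sq(1) this] show ?thesis
    by (simp add: L1_norm_def abs_mat_def trace_of_mat[of _ N] trace_norm_def sq)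
qed

text \<open>
  A positive square root is its own absolute value.
\<close>

lemma L1_norm_mat_sqrt:
  assumes A: "A \<in> carrier_mat N N" "star (of_mat A) = of_mat A" "psd (of_mat A)"
  shows "L1_norm (mat_sqrt A) = inner (unit_upto N) (psd_root N (of_mat A)) / N"
proof -
  note R = mat_sqrt_of_mat[OF A]
  have s: "is_psd_root N (of_mat A) (psd_root N (of_mat A))" by (rule psd_root) (simp_all add: A of_mat_corner)
  then have "psd_root N (star (psd_root N (of_mat A)) * psd_root N (of_mat A)) = psd_root N (of_mat A)"
    by (intro psd_root_eq) (auto simp: is_psd_root_def)
  then show ?thesis
    by (simp add: L1_norm_of_mat[OF R(1)] R(2) trace_norm_def)
qed

lemma of_mat_sum_square:
  assumes "\<And>j. j \<in> J \<Longrightarrow> f j \<in> carrier_mat N N"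
  shows "of_mat (sum_square_mats N f J) = (\<Sum>j\<in>J. of_mat (f j))"
  by (intro fmat_eqI)
     (auto simp: ent_of_mat sum_square_mats_def carrier_matD[OF assms] intro!: sum.cong sum.neutral)


section \<open>Entries of the partial derivatives\<close>

lemma dim_tensor_map [simp]: "dim_row (tensor_map a b F G A) = a * b" "dim_col (tensor_map a b F G A) = a * b"
  by (simp_all add: tensor_map_def sum_square_mats_def)

lemma tensor_map_index:
  assumes F: "\<And>i j. i < a \<Longrightarrow> j < a \<Longrightarrow> F (unit_matrix a i j) \<in> carrier_mat a a"
    and G: "\<And>k l. k < b \<Longrightarrow> l < b \<Longrightarrow> G (unit_matrix b k l) \<in> carrier_mat b b"
    and r: "r < a * b" "c < a * b"
  shows "tensor_map a b F G A $$ (r, c) = (\<Sum>i<a. \<Sum>j<a. \<Sum>k<b. \<Sum>l<b.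
    A $$ (i * b + k, j * b + l) * (F (unit_matrix a i j) $$ (r div b, c div b) * G (unit_matrix b k l) $$ (r mod b, c mod b)))"
proof -
  have "tensor_map a b F G A $$ (r, c) = (\<Sum>(i, j, k, l)\<in>{..<a} \<times> {..<a} \<times> {..<b} \<times> {..<b}.
     (A $$ (i * b + k, j * b + l) \<cdot>\<^sub>m kron (F (unit_matrix a i j)) (G (unit_matrix b k l))) $$ (r, c))"
    using r by (simp add: tensor_map_def sum_square_mats_def case_prod_unfold)
  also have "\<dots> = (\<Sum>(i, j, k, l)\<in>{..<a} \<times> {..<a} \<times> {..<b} \<times> {..<b}.
     A $$ (i * b + k, j * b + l) * (F (unit_matrix a i j) $$ (r div b, c div b) * G (unit_matrix b k l) $$ (r mod b, c mod b)))"
    using r by (intro sum.cong refl) (auto simp: kron_def carrier_matD[OF F] carrier_matD[OF G])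
  finally show ?thesis by (simp add: sum.cartesian_product[symmetric])
qed

lemma tensor_map_id_right:
  assumes F: "\<And>i j. i < a \<Longrightarrow> j < a \<Longrightarrow> F (unit_matrix a i j) \<in> carrier_mat a a"
    and r: "r < a * b" "c < a * b"
  shows "tensor_map a b F id A $$ (r, c) = (\<Sum>i<a. \<Sum>j<a.
    A $$ (i * b + r mod b, j * b + c mod b) * F (unit_matrix a i j) $$ (r div b, c div b))"
proof -
  have b: "0 < b" using r by (cases b) auto
  have "(\<Sum>k<b. \<Sum>l<b. A $$ (i * b + k, j * b + l) * (z * id (unit_matrix b k l) $$ (r mod b, c mod b)))
     = A $$ (i * b + r mod b, j * b + c mod b) * z" for i j z
  proof -
    have "(\<Sum>k<b. \<Sum>l<b. A $$ (i * b + k, j * b + l) * (z * id (unit_matrix b k l) $$ (r mod b, c mod b)))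
      = (\<Sum>k<b. \<Sum>l<b. if l = c mod b then (if k = r mod b then A $$ (i * b + k, j * b + l) * z else 0) else 0)"
      using b by (intro sum.cong refl) (auto simp: unit_matrix_def)
    then show ?thesis using b by simp
  qed
  then show ?thesis
    using F by (subst tensor_map_index) (auto simp: r unit_matrix_def[of b])
qed

lemma D_map_unit:
  assumes "k < 2" "l < 2" "r < 2" "c < 2"
  shows "D_map (unit_matrix 2 k l) $$ (r, c)
    = (if k = r \<and> l = c then 1 else 0) - (if k = l \<and> r = c then 1/2 else 0)"
proof -
  have "{..<2::nat} = {0, 1}" by auto
  then show ?thesis using assms
    by (auto simp: D_map_def unit_matrix_def ntr_def less_2_cases_iff)
qed

lemma D_map_carrier: "D_map (unit_matrix 2 k l) \<in> carrier_mat 2 2"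
  by (auto simp: D_map_def unit_matrix_def)

lemma binary_digit_iff: "k < 2 \<Longrightarrow> p * 2 + k = i \<longleftrightarrow> i div 2 = p \<and> k = i mod 2" for i :: nat
  by auto

text \<open>
  The index \<open>r\<close> splits into the leading digits \<open>r div 2\<close>, on which the map is the identity, and the
  last binary digit \<open>r mod 2\<close>, on which it acts as \<open>D_map\<close>.
\<close>

lemma id_tensor_D:
  assumes r: "r < a * 2" "c < a * 2" and i: "i < a * 2" "j < a * 2"
  shows "tensor_map a 2 id D_map (unit_matrix (a * 2) i j) $$ (r, c)
    = (if i div 2 = r div 2 \<and> j div 2 = c div 2 then
        (if i mod 2 = r mod 2 \<and> j mod 2 = c mod 2 then 1 else 0)
        - (if i mod 2 = j mod 2 \<and> r mod 2 = c mod 2 then 1/2 else 0) else 0)"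
proof -
  have rc: "r div 2 < a" "c div 2 < a" using r by auto
  have "tensor_map a 2 id D_map (unit_matrix (a * 2) i j) $$ (r, c) = (\<Sum>i'<a. \<Sum>j'<a. \<Sum>k<2. \<Sum>l<2.
    unit_matrix (a * 2) i j $$ (i' * 2 + k, j' * 2 + l) *
     (id (unit_matrix a i' j') $$ (r div 2, c div 2) * D_map (unit_matrix 2 k l) $$ (r mod 2, c mod 2)))"
    by (rule tensor_map_index) (auto simp: r D_map_carrier unit_matrix_def[of a])
  also have "\<dots> = (\<Sum>i'<a. \<Sum>j'<a. if j' = c div 2 then (if i' = r div 2 then (\<Sum>k<2. \<Sum>l<2.
    unit_matrix (a * 2) i j $$ (i' * 2 + k, j' * 2 + l) * D_map (unit_matrix 2 k l) $$ (r mod 2, c mod 2)) else 0) else 0)"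
    using rc by (intro sum.cong refl) (auto simp: unit_matrix_def)
  also have "\<dots> = (\<Sum>k<2. \<Sum>l<2. unit_matrix (a * 2) i j $$ (r div 2 * 2 + k, c div 2 * 2 + l) *
      D_map (unit_matrix 2 k l) $$ (r mod 2, c mod 2))"
    using rc by simp
  also have "\<dots> = (\<Sum>k<2. \<Sum>l<2. if l = j mod 2 then (if k = i mod 2 then 
      (if i div 2 = r div 2 \<and> j div 2 = c div 2 then D_map (unit_matrix 2 (i mod 2) (j mod 2)) $$ (r mod 2, c mod 2) else 0) else 0) else 0)"
  proof (intro sum.cong refl)
    fix k l :: nat assume kl: "k \<in> {..<2}" "l \<in> {..<2}"
    have "r div 2 * 2 + k < a * 2" "c div 2 * 2 + l < a * 2" using rc kl by auto
    moreover have "r div 2 * 2 + k = i \<longleftrightarrow> i div 2 = r div 2 \<and> k = i mod 2"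
      "c div 2 * 2 + l = j \<longleftrightarrow> j div 2 = c div 2 \<and> l = j mod 2"
      using kl by (auto simp: binary_digit_iff)
    ultimately show "unit_matrix (a * 2) i j $$ (r div 2 * 2 + k, c div 2 * 2 + l) *
      D_map (unit_matrix 2 k l) $$ (r mod 2, c mod 2) = (if l = j mod 2 then (if k = i mod 2 then 
      (if i div 2 = r div 2 \<and> j div 2 = c div 2 then D_map (unit_matrix 2 (i mod 2) (j mod 2)) $$ (r mod 2, c mod 2) else 0) else 0) else 0)"
      by (auto simp: unit_matrix_def)
  qed
  also have "\<dots> = (if i div 2 = r div 2 \<and> j div 2 = c div 2 then D_map (unit_matrix 2 (i mod 2) (j mod 2)) $$ (r mod 2, c mod 2) else 0)"
    by simp
  finally show ?thesis by (simp add: D_map_unit)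
qed

lemma sum_div_2:
  fixes f :: "nat \<Rightarrow> 'a::comm_monoid_add"
  assumes "p < a"
  shows "(\<Sum>i<a * 2. if i div 2 = p then f i else 0) = f (p * 2) + f (p * 2 + 1)"
proof -
  have "(\<Sum>i<a * 2. if i div 2 = p then f i else 0) = sum f {i. i < a * 2 \<and> i div 2 = p}"
    by (simp add: sum.inter_filter[symmetric] lessThan_def)
  also have "{i. i < a * 2 \<and> i div 2 = p} = {p * 2, p * 2 + 1}" using assms by auto
  finally show ?thesis by simp
qed

text \<open>
  Summation of the entries given by \<open>id_tensor_D\<close> against a matrix: the indices that contribute are
  those with the same leading digits, which leaves the two values of the last digit.
\<close>

lemma digit_sum:
  fixes f :: "nat \<Rightarrow> nat \<Rightarrow> complex"
  assumes "x < a * 2" "y < a * 2"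
  shows "(\<Sum>i<a * 2. \<Sum>j<a * 2. if i div 2 = x div 2 \<and> j div 2 = y div 2
      then f i j * ((if i mod 2 = x mod 2 \<and> j mod 2 = y mod 2 then 1 else 0)
        - (if i mod 2 = j mod 2 \<and> x mod 2 = y mod 2 then 1/2 else 0)) else 0)
    = f x y - (if x mod 2 = y mod 2
        then (f (x div 2 * 2) (y div 2 * 2) + f (x div 2 * 2 + 1) (y div 2 * 2 + 1)) / 2 else 0)"
proof -
  define g :: "nat \<Rightarrow> nat \<Rightarrow> complex" where
    "g i j = (if i mod 2 = x mod 2 \<and> j mod 2 = y mod 2 then 1 else 0)
        - (if i mod 2 = j mod 2 \<and> x mod 2 = y mod 2 then 1/2 else 0)" for i j
  define p where "p = x div 2"
  define q where "q = y div 2"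
  have pq: "p < a" "q < a" using assms by (auto simp: p_def q_def)
  have "(\<Sum>i<a * 2. \<Sum>j<a * 2. if i div 2 = p \<and> j div 2 = q then f i j * g i j else 0)
      = (\<Sum>i<a * 2. \<Sum>j<a * 2. if j div 2 = q then (if i div 2 = p then f i j * g i j else 0) else 0)"
    by (intro sum.cong refl) auto
  also have "\<dots> = f (p * 2) (q * 2) * g (p * 2) (q * 2) + f (p * 2 + 1) (q * 2) * g (p * 2 + 1) (q * 2)
      + (f (p * 2) (q * 2 + 1) * g (p * 2) (q * 2 + 1) + f (p * 2 + 1) (q * 2 + 1) * g (p * 2 + 1) (q * 2 + 1))"
    by (simp only: sum_div_2[OF pq(1)] sum_div_2[OF pq(2)] sum.distrib)
  also have "\<dots> = f x y - (if x mod 2 = y mod 2 then (f (p * 2) (q * 2) + f (p * 2 + 1) (q * 2 + 1)) / 2 else 0)"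
  proof -
    have odd: "(k * 2 + 1) mod 2 = 1" for k :: nat by presburger
    have x: "x = p * 2 + x mod 2" and y: "y = q * 2 + y mod 2" by (simp_all add: p_def q_def)
    consider "x mod 2 = 0" "y mod 2 = 0" | "x mod 2 = 0" "y mod 2 = 1"
      | "x mod 2 = 1" "y mod 2 = 0" | "x mod 2 = 1" "y mod 2 = 1" by linarith
    then show ?thesis
    proof cases
      case 1
      then have "x = p * 2" "y = q * 2" using x y by auto
      with 1 show ?thesis by (simp add: g_def odd[simplified] field_simps)
    next
      case 2
      then have "x = p * 2" "y = q * 2 + 1" using x y by auto
      with 2 show ?thesis by (simp add: g_def odd[simplified] field_simps)
    next
      case 3
      then have "x = p * 2 + 1" "y = q * 2" using x y by auto
      with 3 show ?thesis by (simp add: g_def odd[simplified] field_simps)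
    next
      case 4
      then have "x = p * 2 + 1" "y = q * 2 + 1" using x y by auto
      with 4 show ?thesis by (simp add: g_def odd[simplified] field_simps)
    qed
  qed
  finally show ?thesis unfolding g_def p_def q_def .
qed

lemma flip_bit_nat_eq: "flip_bit k x = (if bit x k then x - 2 ^ k else x + 2 ^ k :: nat)"
proof -
  have add: "flip_bit k y = y + 2 ^ k" if "\<not> bit y k" for y :: nat
    using that by (simp add: flip_bit_eq_if set_bit_eq)
  show ?thesis using add[of x] add[of "flip_bit k x"] by auto
qed

text \<open>
  The tensor factor \<open>j\<close>, counted from the left, is the binary digit of weight \<open>2\<^sup>n\<^sup>-\<^sup>j\<close> of the indices,
  and summing over its two values amounts to flipping this digit.
\<close>

lemma partial_deriv_index:
  assumes j: "1 \<le> j" "j \<le> n" and r: "r < 2 ^ n" "c < 2 ^ n"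
  shows "partial_deriv n j A $$ (r, c) = A $$ (r, c) -
    (if bit r (n - j) = bit c (n - j) then
      (A $$ (r, c) + A $$ (flip_bit (n - j) r, flip_bit (n - j) c)) / 2 else 0)"
proof -
  define b :: nat where "b = 2 ^ (n - j)"
  define a :: nat where "a = 2 ^ (j - 1)"
  have a2: "a * 2 = 2 ^ j" using j by (simp add: a_def power_eq_if)
  have ab: "a * 2 * b = 2 ^ n" unfolding a2 b_def using j by (simp flip: power_add)
  have b: "0 < b" by (simp add: b_def)
  have rc: "r < a * 2 * b" "c < a * 2 * b" using r by (simp_all add: ab)
  have rb: "r div b < a * 2" "c div b < a * 2"
    using rc by (simp_all add: less_mult_imp_div_less)
  let ?t = "\<lambda>x. x div b div 2 * 2"
  have involution: "x = x div 2 * 2 \<and> x mod 2 = 0 \<or> x = x div 2 * 2 + 1 \<and> x mod 2 = 1" for x :: nat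
    by presburger
  define f where "f i i' = A $$ (i * b + r mod b, i' * b + c mod b)" for i i'
  have "partial_deriv n j A $$ (r, c) = (\<Sum>i<a * 2. \<Sum>i'<a * 2.
      f i i' * tensor_map a 2 id D_map (unit_matrix (a * 2) i i') $$ (r div b, c div b))"
    unfolding partial_deriv_def a2[symmetric] a_def[symmetric] b_def[symmetric] f_def
    by (rule tensor_map_id_right[OF _ rc]) (auto intro!: carrier_matI)
  also have "\<dots> = (\<Sum>i<a * 2. \<Sum>i'<a * 2. if i div 2 = r div b div 2 \<and> i' div 2 = c div b div 2
      then f i i' * ((if i mod 2 = r div b mod 2 \<and> i' mod 2 = c div b mod 2 then 1 else 0)
        - (if i mod 2 = i' mod 2 \<and> r div b mod 2 = c div b mod 2 then 1/2 else 0)) else 0)"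
    by (intro sum.cong refl) (auto simp: id_tensor_D[OF rb])
  also have "\<dots> = f (r div b) (c div b) -
    (if r div b mod 2 = c div b mod 2 then (f (?t r) (?t c) + f (?t r + 1) (?t c + 1)) / 2 else 0)"
    by (rule digit_sum[OF rb])
  also have "f (r div b) (c div b) = A $$ (r, c)" by (simp add: f_def)
  also have "r div b mod 2 = c div b mod 2 \<longleftrightarrow> bit r (n - j) = bit c (n - j)"
    unfolding b_def bit_iff_odd by (metis even_iff_mod_2_eq_zero not_mod_2_eq_0_eq_1)
  also have "(if bit r (n - j) = bit c (n - j) then (f (?t r) (?t c) + f (?t r + 1) (?t c + 1)) / 2 else 0)
    = (if bit r (n - j) = bit c (n - j) then
      (A $$ (r, c) + A $$ (flip_bit (n - j) r, flip_bit (n - j) c)) / 2 else 0)"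
  proof -
    have flip: "flip_bit (n - j) x = (if bit x (n - j) then ?t x else ?t x + 1) * b + x mod b"
      and self: "x = (if bit x (n - j) then ?t x + 1 else ?t x) * b + x mod b" for x
    proof -
      have odd: "bit x (n - j) \<longleftrightarrow> x div b mod 2 = 1" unfolding b_def bit_iff_odd by presburger
      have "x = x div b * b + x mod b" by simp
      moreover have "x div b = (if bit x (n - j) then ?t x + 1 else ?t x)"
        unfolding odd using involution[of "x div b"] by auto
      ultimately show self: "x = (if bit x (n - j) then ?t x + 1 else ?t x) * b + x mod b" by metis
      have "flip_bit (n - j) x = (if bit x (n - j) then x - b else x + b)"
        unfolding b_def by (rule flip_bit_nat_eq)
      then show "flip_bit (n - j) x = (if bit x (n - j) then ?t x else ?t x + 1) * b + x mod b"
        using self by (cases "bit x (n - j)") (auto simp: algebra_simps)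
    qed
    show ?thesis
    proof (cases "bit r (n - j) = bit c (n - j)")
      case True
      then show ?thesis
        using self[of r] self[of c] flip[of r] flip[of c] unfolding f_def
        by (cases "bit r (n - j)") (auto simp: add.commute)
    qed simp
  qed
  finally show ?thesis .
qed

lemma partial_deriv_carrier:
  assumes "1 \<le> j" "j \<le> n"
  shows "partial_deriv n j A \<in> carrier_mat (2 ^ n) (2 ^ n)"
  using assms by (intro carrier_matI) (simp_all add: partial_deriv_def flip: power_add)

lemma of_mat_partial_deriv:
  assumes A: "A \<in> carrier_mat (2 ^ n) (2 ^ n)" and j: "1 \<le> j" "j \<le> n"
  shows "of_mat (partial_deriv n j A) = qubit.diff_op (n - j) (of_mat A)"
proof (rule fmat_eqI)
  fix r c
  have "n - j < n" using j by simp
  then show "ent (of_mat (partial_deriv n j A)) r c = ent (qubit.diff_op (n - j) (of_mat A)) r c"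
    using A partial_deriv_carrier[OF j, of A]
    by (auto simp: qubit.diff_op_def ent_average ent_of_mat partial_deriv_index[OF j])
qed

theorem theorem1p11:
  shows "\<exists>K::real. K > 0 \<and>
    (\<forall>n::nat. \<forall>T::complex mat. n \<ge> 1 \<longrightarrow> T \<in> carrier_mat (2 ^ n) (2 ^ n) \<longrightarrow> projection_mat T \<longrightarrow>
      (if \<forall>j\<in>{1..n}. partial_deriv n j T = 0\<^sub>m (2 ^ n) (2 ^ n) then 0
       else mat_var T * sqrt (ln (1 + 1 / (\<Sum>j=1..n. (L1_norm (partial_deriv n j T))\<^sup>2))))
      \<le> K * L1_norm (mat_sqrt (sum_square_mats (2 ^ n) (\<lambda>j. abs_sq_mat (partial_deriv n j T)) {1..n})))"
proof (intro exI[of _ 100] conjI allI impI)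
  fix n :: nat and T :: "complex mat"
  assume A: "T \<in> carrier_mat (2 ^ n) (2 ^ n)" and proj: "projection_mat T"
  define t where "t = of_mat T"
  have t: "t \<in> corner (2 ^ n)" "star t = t" "t * t = t"
    using A proj hermitian_of_mat[OF A] by (auto simp: t_def projection_mat_def of_mat_corner of_mat_mult[symmetric])
  interpret qubit_projection n t by unfold_locales (fact t)+
  have reindex: "(\<Sum>j=1..n. f (n - j)) = (\<Sum>b<n. f b)" for f :: "nat \<Rightarrow> 'a::comm_monoid_add"
    by (rule sum.reindex_bij_witness[of _ "\<lambda>b. n - b" "\<lambda>j. n - j"]) auto
  have d: "of_mat (partial_deriv n j T) = qubit.diff_op (n - j) t" "partial_deriv n j T \<in> carrier_mat (2 ^ n) (2 ^ n)"
    if "j \<in> {1..n}" for j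
    using that by (simp_all add: t_def of_mat_partial_deriv[OF A] partial_deriv_carrier)
  have "(\<Sum>j=1..n. (L1_norm (partial_deriv n j T))\<^sup>2) = (\<Sum>j=1..n. (trace_norm (2 ^ n) (qubit.diff_op (n - j) t) / N)\<^sup>2)"
    by (intro sum.cong refl) (simp add: L1_norm_of_mat[OF d(2)] d(1) N_def)
  also have "\<dots> = \<epsilon>" unfolding \<epsilon>_def by (rule reindex)
  finally have eps: "(\<Sum>j=1..n. (L1_norm (partial_deriv n j T))\<^sup>2) = \<epsilon>" .
  define S where "S = sum_square_mats (2 ^ n) (\<lambda>j. abs_sq_mat (partial_deriv n j T)) {1..n}"
  have "of_mat S = (\<Sum>j=1..n. of_mat (abs_sq_mat (partial_deriv n j T)))"
    unfolding S_def by (rule of_mat_sum_square) (simp add: of_mat_abs_sq d)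
  also have "\<dots> = (\<Sum>j=1..n. star (qubit.diff_op (n - j) t) * qubit.diff_op (n - j) t)"
    by (intro sum.cong refl) (simp add: of_mat_abs_sq(2)[OF d(2)] d(1))
  also have "\<dots> = (\<Sum>b<n. star (qubit.diff_op b t) * qubit.diff_op b t)" by (rule reindex)
  finally have S: "of_mat S = (\<Sum>b<n. star (qubit.diff_op b t) * qubit.diff_op b t)" .
  have "L1_norm (mat_sqrt S) = inner (unit_upto (2 ^ n)) (psd_root (2 ^ n) (of_mat S)) / (2 ^ n :: nat)"
    by (rule L1_norm_mat_sqrt) (auto simp: S S_def[symmetric] intro!: psd_sum psd_star_mult, simp add: S_def sum_square_mats_def)
  then have gradient_norm: "L1_norm (mat_sqrt S) = gradient_norm" by (simp add: gradient_norm_def S N_def)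
  have "inner (unit_upto (2 ^ n)) (star t * t) = \<tau> * N" using t inner_T_T by simp
  then have tr2: "Re (ntr (abs_sq_mat T)) = \<tau>"
    using N_pos by (simp add: trace_of_mat[OF of_mat_abs_sq(1)[OF A]] of_mat_abs_sq(2)[OF A] t_def[symmetric] N_def)
  have "Im (ntr T) = 0"
  proof -
    have "Im (T $$ (i, i)) = 0" if "i < 2 ^ n" for i
    proof -
      have "cnj (ent t i i) = ent t i i" by (metis ent_star t(2))
      then show ?thesis using that A by (simp add: t_def ent_of_mat complex_eq_iff)
    qed
    then show ?thesis using A by (simp add: ntr_def)
  qed
  moreover have "Re (ntr T) = \<tau>" using trace_of_mat[OF A, folded t_def] by (simp add: \<tau>_def N_def)
  ultimately have "mat_var T = variance" by (simp add: mat_var_def tr2 variance_def cmod_power2)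
  moreover have "0 \<le> gradient_norm" by (rule gradient_norm_nonneg)
  ultimately show "(if \<forall>j\<in>{1..n}. partial_deriv n j T = 0\<^sub>m (2 ^ n) (2 ^ n) then 0
       else mat_var T * sqrt (ln (1 + 1 / (\<Sum>j=1..n. (L1_norm (partial_deriv n j T))\<^sup>2))))
      \<le> 100 * L1_norm (mat_sqrt (sum_square_mats (2 ^ n) (\<lambda>j. abs_sq_mat (partial_deriv n j T)) {1..n}))"
    using eldan_gross unfolding S_def[symmetric] gradient_norm eps by auto
qed simp

end
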